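(* Let $\eta_1,\eta_2,\ldots$ be independent copies of a real random variable $\eta$ with $\mathbb{E}[\eta]=0$ and $\sigma^2=\mathbb{E}[\eta^2]\in(0,\infty)$. Then $$C\Big(\Big(\Big(\frac{1}{2\sigma^2\log 1/s\, \log\log\log 1/s}\Big)^{1/2}\sum_p\frac{\eta_p}{p^{1/2+s}}:\ s\in(0,\mathrm{e}^{-\mathrm{e}})\Big)\Big)=[-1,1]\quad\text{a.s.}$$ In particular, $$\limsup_{s\to 0+}\Big(\frac{1}{\log 1/s\, \log\log\log 1/s}\Big)^{1/2}\sum_p\frac{\eta_p}{p^{1/2+s}}=\sqrt{2}\,\sigma\quad\text{a.s.}$$ and $$\liminf_{s\to 0+}\Big(\frac{1}{\log 1/s\, \log\log\log 1/s}\Big)^{1/2}\sum_p\frac{\eta_p}{p^{1/2+s}}=-\sqrt{2}\,\sigma\quad\text{a.s.}$$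
   Context: $\sum_p$ denotes summation over the set of prime numbers (taken in increasing order). For each $s>0$ the series $X(s):=\sum_p\eta_p p^{-1/2-s}$ converges almost surely, and $s\mapsto X(s)$ is a.s. a continuous function on $(0,\infty)$. For a family $(x_s)$ of real numbers, $C((x_s))$ denotes the set of its limit points as $s\to 0+$. *)

theory Defs
  imports "HOL-Probability.Probability" "HOL-Computational_Algebra.Primes"
    "HOL-Library.Infinite_Set"
begin

text \<open>Summation over the primes in increasing order. The series considered need not converge
  absolutely, so the order matters and an unordered sum would not do. As usual for \<^const>\<open>suminf\<close>,
  the value is meaningful only if the series converges.\<close>

definition sum_primes :: "(nat \<Rightarrow> real) \<Rightarrow> real" where
  "sum_primes f = (\<Sum>k. f (enumerate {p. prime p} k))"

text \<open>The set of (finite) limit points, as \<open>s \<rightarrow> 0+\<close>, of a family \<open>x\<close> of reals indexed by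
  a set \<open>S\<close> of positive reals.\<close>

definition limit_points_0 :: "real set \<Rightarrow> (real \<Rightarrow> real) \<Rightarrow> real set" where
  "limit_points_0 S x =
     {y. \<exists>t. (\<forall>n. t n \<in> S) \<and> t \<longlonglongrightarrow> 0 \<and> (\<lambda>n. x (t n)) \<longlonglongrightarrow> y}"

end

theory Submission
  imports Defs "HOL-Real_Asymp.Real_Asymp"
begin

text \<open>
  Put \<open>l = ln (1 / s)\<close> and let \<open>X s\<close> be the random series. The sum of the reciprocals of the primes
  \<open>p\<close> with \<open>ln (ln p) \<le> v\<close> is asymptotic to \<open>v\<close> (\<open>sum_inverse_primes_asymp\<close>), and the factor
  \<open>p powr (- s)\<close> acts as a smooth cut-off near \<open>ln (ln p) = l\<close>. Hence the variance of \<open>X s\<close> is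
  asymptotic to \<open>\<sigma>\<^sup>2 * l\<close>, and the theorem is a law of the iterated logarithm with the scale
  \<open>sqrt (2 * \<sigma>\<^sup>2 * l * ln (ln l))\<close>, which is \<open>\<sigma> * lil_scale l\<close>.

  Second moments suffice because the coefficient of \<open>\<eta>\<^sub>p\<close> is \<open>1 / sqrt p\<close>: truncating \<open>\<eta>\<^sub>p\<close> at
  \<open>sqrt p\<close> makes all summands bounded by one constant while their variances still have an infinite sum,
  and the total of the parts cut off has a finite expectation (\<open>sum_truncated_primes_le\<close>), so that almost
  surely it is a bounded perturbation (\<open>AE_summable_truncation_error\<close>).

  For the upper half, bounded centred variables have nearly Gaussian exponential moments for small
  parameters (\<open>mgf_bounds\<close>); a maximal inequality and the Borel-Cantelli lemma along geometrically growing
  variances give Kolmogorov's bound for the partial sums (\<open>kolmogorov_lil_upper\<close>). By Abel summation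
  \<open>X s\<close> is a combination of the partial sums of \<open>\<eta>\<^sub>p / sqrt p\<close> with nonnegative coefficients of total mass at
  most 1, concentrated on \<open>ln (ln p) \<le> (1 + h) * l\<close>. As \<open>lil_scale\<close> varies regularly, \<open>X s\<close> inherits the
  bound (\<open>prime_series_upper\<close>). The same summation gives convergence and continuity of \<open>X\<close>.

  For the lower half, the two-sided estimate of the exponential moments yields a lower bound for tail
  probabilities (\<open>sum_lower_tail\<close>). Along \<open>l\<^sub>n = (2 / \<epsilon>\<^sup>2) ^ n\<close> the blocks of primes given by
  \<open>\<epsilon>\<^sup>2 * l\<^sub>n < ln (ln p) \<le> 2 * l\<^sub>n\<close> are disjoint and carry almost all of the variance, so by the second
  Borel-Cantelli lemma infinitely many block sums are almost as large as the scale
  (\<open>AE_block_sum_lower\<close>). What lies outside the block is small, again by the upper half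
  (\<open>prime_series_lower\<close>).

  Applied to \<open>\<eta>\<close> and to \<open>- \<eta>\<close>, this shows that the normalised series has upper limit 1 and lower limit -1.
  Being continuous, it comes arbitrarily close to every value between them
  (\<open>limit_points_0_eq_interval\<close>).
\<close>

section \<open>Exponential moments of sums of bounded independent variables\<close>

lemma exp_quadratic_approx:
  fixes x :: real
  assumes "\<bar>x\<bar> \<le> 1"
  shows "\<bar>exp x - (1 + x + x\<^sup>2 / 2)\<bar> \<le> \<bar>x\<bar> ^ 3"
proof -
  obtain t where t: "\<bar>t\<bar> \<le> \<bar>x\<bar>" "exp x = (\<Sum>m<3. x ^ m / fact m) + exp t / fact 3 * x ^ 3"
    using Maclaurin_exp_le[of x 3] by blast
  have "exp t \<le> exp 1" using t assms by simp
  also have "\<dots> \<le> 3" by (rule exp_le)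
  finally have e: "exp t \<le> 3" .
  have "exp x - (1 + x + x\<^sup>2 / 2) = exp t / 6 * x ^ 3"
    using t(2) by (simp add: eval_nat_numeral)
  then have "\<bar>exp x - (1 + x + x\<^sup>2 / 2)\<bar> = exp t / 6 * \<bar>x\<bar> ^ 3"
    by (simp only: abs_mult power_abs abs_divide) simp
  also have "\<dots> \<le> 1 * \<bar>x\<bar> ^ 3" using e by (intro mult_right_mono) auto
  finally show ?thesis by simp
qed

context prob_space
begin

text \<open>In the second-order expansion of the exponential the linear term has expectation 0, and the cubic
  remainder is at most \<open>l * c\<close> times the quadratic term. So up to a factor close to 1 in the exponent the moment
  generating function is that of a Gaussian variable with the same variance.\<close>
lemma mgf_bounds:
  fixes Y :: "'a \<Rightarrow> real"
  assumes [measurable]: "random_variable borel Y" and bd: "\<And>x. x \<in> space M \<Longrightarrow> \<bar>Y x\<bar> \<le> c"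
    and cent: "expectation Y = 0" and l: "0 \<le> l" "l * c \<le> \<delta> / 4" and d: "0 < \<delta>" "\<delta> \<le> 1"
  shows "exp (l\<^sup>2 * expectation (\<lambda>x. (Y x)\<^sup>2) / 2 * (1 - \<delta>)) \<le> expectation (\<lambda>x. exp (l * Y x))"
    and "expectation (\<lambda>x. exp (l * Y x)) \<le> exp (l\<^sup>2 * expectation (\<lambda>x. (Y x)\<^sup>2) / 2 * (1 + \<delta>))"
proof -
  let ?v = "expectation (\<lambda>x. (Y x)\<^sup>2)"
  have c: "0 \<le> c" using bd not_empty by force
  have lc: "0 \<le> l * c" using l c by simp
  have lY: "\<bar>l * Y x\<bar> \<le> l * c" if "x \<in> space M" for x
    using bd[OF that] l by (simp add: abs_mult mult_left_mono)
  have iY: "integrable M Y"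
    by (rule integrable_const_bound[of _ c]) (auto intro!: AE_I2 bd)
  have Y2: "(Y x)\<^sup>2 \<le> c\<^sup>2" if "x \<in> space M" for x
    using power_mono[OF bd[OF that], of 2] by simp
  have iY2: "integrable M (\<lambda>x. (Y x)\<^sup>2)"
    by (rule integrable_const_bound[of _ "c\<^sup>2"]) (auto intro!: AE_I2 Y2)
  have iE: "integrable M (\<lambda>x. exp (l * Y x))"
    by (rule integrable_const_bound[of _ "exp (l*c)"]) (use lY in \<open>auto intro!: AE_I2 simp: abs_le_iff\<close>)
  have v0: "0 \<le> ?v" by (intro integral_nonneg_AE) auto
  have v1: "?v \<le> c\<^sup>2"
    using integral_mono[OF iY2 integrable_const[of "c\<^sup>2"] Y2] by (simp add: prob_space)
  have key: "\<bar>exp (l * Y x) - (1 + l * Y x + l\<^sup>2 / 2 * (Y x)\<^sup>2)\<bar> \<le> (l * c) * (l\<^sup>2 * (Y x)\<^sup>2)"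
    if "x \<in> space M" for x
  proof -
    have "\<bar>l * Y x\<bar> \<le> 1" using lY[OF that] l d by simp
    then have "\<bar>exp (l * Y x) - (1 + l * Y x + (l * Y x)\<^sup>2 / 2)\<bar> \<le> \<bar>l * Y x\<bar> ^ 3"
      by (rule exp_quadratic_approx)
    also have "\<dots> = \<bar>l * Y x\<bar> * (l * Y x)\<^sup>2" by (simp add: power3_eq_cube power2_eq_square flip: mult.assoc)
    also have "\<dots> \<le> (l * c) * (l * Y x)\<^sup>2" using lY[OF that] by (intro mult_right_mono) auto
    finally show ?thesis by (simp add: power_mult_distrib)
  qed
  have e1: "expectation (\<lambda>x. 1 + l * Y x + l\<^sup>2 / 2 * (Y x)\<^sup>2 + t * (l * c) * (l\<^sup>2 * (Y x)\<^sup>2))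
      = 1 + l\<^sup>2 * ?v / 2 * (1 + t * 2 * (l * c))" for t
    using iY iY2 cent by (simp add: prob_space algebra_simps)
  have i1: "integrable M (\<lambda>x. 1 + l * Y x + l\<^sup>2 / 2 * (Y x)\<^sup>2 + t * (l * c) * (l\<^sup>2 * (Y x)\<^sup>2))" for t
    using iY iY2 by simp
  have up: "expectation (\<lambda>x. exp (l * Y x)) \<le> 1 + l\<^sup>2 * ?v / 2 * (1 + 2 * (l * c))"
    using integral_mono[OF iE i1[of 1]] key e1[of 1] by (force simp: abs_le_iff)
  have lo: "1 + l\<^sup>2 * ?v / 2 * (1 - 2 * (l * c)) \<le> expectation (\<lambda>x. exp (l * Y x))"
    using integral_mono[OF i1[of "-1"] iE] key e1[of "-1"] by (force simp: abs_le_iff)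
  have lv: "0 \<le> l\<^sup>2 * ?v / 2" using v0 by simp
  have "1 + l\<^sup>2 * ?v / 2 * (1 + 2 * (l * c)) \<le> 1 + l\<^sup>2 * ?v / 2 * (1 + \<delta>)"
    using l d by (intro add_left_mono mult_left_mono[OF _ lv]) auto
  also have "\<dots> \<le> exp (l\<^sup>2 * ?v / 2 * (1 + \<delta>))" by (rule exp_ge_add_one_self)
  finally show "expectation (\<lambda>x. exp (l * Y x)) \<le> exp (l\<^sup>2 * ?v / 2 * (1 + \<delta>))" using up by simp
  define t where "t = l\<^sup>2 * ?v / 2 * (1 - 2 * (l * c))"
  have h: "1 - 2 * (l*c) \<ge> 1 - \<delta> / 2" "1 - 2 * (l*c) \<le> 1" "1 - 2 * (l*c) \<ge> 0" using l d lc by auto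
  have t0: "0 \<le> t" unfolding t_def using h(3) lv by simp
  have "l\<^sup>2 * ?v \<le> (l*c)\<^sup>2" using v1 by (simp add: power_mult_distrib mult_left_mono)
  also have "\<dots> \<le> (\<delta>/4)\<^sup>2" using l lc by (intro power_mono) auto
  also have "\<dots> \<le> \<delta> / 16" using d by (simp add: power2_eq_square)
  finally have q: "l\<^sup>2 * ?v / 2 \<le> \<delta> / 32" by simp
  have "t \<le> l\<^sup>2 * ?v / 2 * 1" unfolding t_def using h lv by (intro mult_left_mono) auto
  then have t1: "t \<le> \<delta> / 32" using q by simp
  have "l\<^sup>2 * ?v / 2 * (1 - \<delta>) \<le> l\<^sup>2 * ?v / 2 * ((1 - 2*(l*c)) * (1 - t))"
  proof (rule mult_left_mono[OF _ lv])
    have "(1 - \<delta>/2) * (1 - \<delta>/32) \<le> (1 - 2*(l*c)) * (1 - t)"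
      using h t1 d by (intro mult_mono) auto
    moreover have "1 - \<delta> \<le> (1 - \<delta>/2) * (1 - \<delta>/32)" using d by (simp add: algebra_simps)
    ultimately show "1 - \<delta> \<le> (1 - 2*(l*c)) * (1 - t)" by simp
  qed
  also have "\<dots> = t * (1 - t)" unfolding t_def by (simp only: mult.assoc)
  also have "\<dots> = t - t\<^sup>2" by (simp add: power2_eq_square algebra_simps)
  also have "\<dots> \<le> ln (1 + t)" using t0 t1 d by (intro ln_one_plus_pos_lower_bound) auto
  finally have "exp (l\<^sup>2 * ?v / 2 * (1 - \<delta>)) \<le> exp (ln (1 + t))" by simp
  also have "\<dots> = 1 + t" using t0 by simp
  also have "\<dots> \<le> expectation (\<lambda>x. exp (l * Y x))" using lo by (simp add: t_def)
  finally show "exp (l\<^sup>2 * ?v / 2 * (1 - \<delta>)) \<le> expectation (\<lambda>x. exp (l * Y x))" .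
qed

definition indep_bounded_centered :: "('i \<Rightarrow> 'a \<Rightarrow> real) \<Rightarrow> real \<Rightarrow> 'i set \<Rightarrow> bool" where
  "indep_bounded_centered Z c I \<longleftrightarrow> indep_vars (\<lambda>_. borel) Z I
     \<and> (\<forall>i\<in>I. (\<forall>x\<in>space M. \<bar>Z i x\<bar> \<le> c) \<and> expectation (Z i) = 0)"

lemma indep_bounded_centered_subset: "indep_bounded_centered Z c I \<Longrightarrow> J \<subseteq> I \<Longrightarrow> indep_bounded_centered Z c J"
  unfolding indep_bounded_centered_def by (auto intro: indep_vars_subset)

lemma indep_bounded_centeredD:
  assumes "indep_bounded_centered Z c I" "i \<in> I"
  shows "random_variable borel (Z i)" "\<And>x. x \<in> space M \<Longrightarrow> \<bar>Z i x\<bar> \<le> c" "expectation (Z i) = 0"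
  using assms by (auto simp: indep_bounded_centered_def indep_vars_def)

lemma indep_vars_expectation_exp_sum:
  assumes Z: "indep_bounded_centered Z c I" and fin: "finite I"
  shows "expectation (\<lambda>x. exp (l * (\<Sum>i\<in>I. Z i x))) = (\<Prod>i\<in>I. expectation (\<lambda>x. exp (l * Z i x)))"
    and "integrable M (\<lambda>x. exp (l * (\<Sum>i\<in>I. Z i x)))"
proof -
  have ind: "indep_vars (\<lambda>_. borel) (\<lambda>i x. exp (l * Z i x)) I"
    by (rule indep_vars_compose2[where M'="\<lambda>_. borel" and X=Z])
       (use Z in \<open>auto simp: indep_bounded_centered_def\<close>)
  have int: "integrable M (\<lambda>x. exp (l * Z i x))" if "i \<in> I" for i
  proof (rule integrable_const_bound[of _ "exp (\<bar>l\<bar> * c)"])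
    note [measurable] = indep_bounded_centeredD(1)[OF Z that]
    show "(\<lambda>x. exp (l * Z i x)) \<in> borel_measurable M" by measurable
    show "AE x in M. norm (exp (l * Z i x)) \<le> exp (\<bar>l\<bar> * c)"
    proof (rule AE_I2)
      fix x assume "x \<in> space M"
      then have "\<bar>l\<bar> * \<bar>Z i x\<bar> \<le> \<bar>l\<bar> * c" using indep_bounded_centeredD(2)[OF Z that] by (intro mult_left_mono) auto
      then have "l * Z i x \<le> \<bar>l\<bar> * c" unfolding abs_mult[symmetric] by linarith
      then show "norm (exp (l * Z i x)) \<le> exp (\<bar>l\<bar> * c)" by simp
    qed
  qed
  have eq: "(\<lambda>x. exp (l * (\<Sum>i\<in>I. Z i x))) = (\<lambda>x. \<Prod>i\<in>I. exp (l * Z i x))"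
    using fin by (simp add: sum_distrib_left exp_sum)
  show "expectation (\<lambda>x. exp (l * (\<Sum>i\<in>I. Z i x))) = (\<Prod>i\<in>I. expectation (\<lambda>x. exp (l * Z i x)))"
    unfolding eq by (rule indep_vars_lebesgue_integral[OF fin ind int])
  show "integrable M (\<lambda>x. exp (l * (\<Sum>i\<in>I. Z i x)))"
    unfolding eq by (rule indep_vars_integrable[OF fin ind int])
qed

lemma mgf_sum_bounds:
  assumes Z: "indep_bounded_centered Z c I" and fin: "finite I"
    and l: "0 \<le> l" "l * c \<le> \<delta> / 4" and d: "0 < \<delta>" "\<delta> \<le> 1"
    and W: "W = (\<Sum>i\<in>I. expectation (\<lambda>x. (Z i x)\<^sup>2))"
  shows "exp (l\<^sup>2 * W / 2 * (1 - \<delta>)) \<le> expectation (\<lambda>x. exp (l * (\<Sum>i\<in>I. Z i x)))"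
    and "expectation (\<lambda>x. exp (l * (\<Sum>i\<in>I. Z i x))) \<le> exp (l\<^sup>2 * W / 2 * (1 + \<delta>))"
proof -
  have E: "exp (l\<^sup>2 * W / 2 * r) = (\<Prod>i\<in>I. exp (l\<^sup>2 * expectation (\<lambda>x. (Z i x)\<^sup>2) / 2 * r))" for r
    unfolding W using fin
    by (simp add: exp_sum[symmetric] sum_distrib_left sum_distrib_right sum_divide_distrib)
  note b = mgf_bounds[OF indep_bounded_centeredD[OF Z] l d]
  show "exp (l\<^sup>2 * W / 2 * (1 - \<delta>)) \<le> expectation (\<lambda>x. exp (l * (\<Sum>i\<in>I. Z i x)))"
    unfolding E indep_vars_expectation_exp_sum(1)[OF Z fin]
    by (intro prod_mono conjI b) auto
  show "expectation (\<lambda>x. exp (l * (\<Sum>i\<in>I. Z i x))) \<le> exp (l\<^sup>2 * W / 2 * (1 + \<delta>))"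
    unfolding E indep_vars_expectation_exp_sum(1)[OF Z fin]
    by (intro prod_mono conjI b integral_nonneg_AE) auto
qed

text \<open>Split according to the first \<open>k\<close> at which the partial sum reaches \<open>y\<close>. On that event the remaining
  increment is independent of the past and, being centred, has an exponential moment of at least 1. Hence
  replacing the final sum by the one at time \<open>k\<close> does not increase the expectation.\<close>
lemma exponential_maximal_inequality:
  fixes Z :: "nat \<Rightarrow> 'a \<Rightarrow> real"
  assumes Z: "indep_bounded_centered Z c UNIV" and l: "0 \<le> l"
  shows "prob {x \<in> space M. \<exists>k\<le>n. y \<le> (\<Sum>j<k. Z j x)}
     \<le> exp (- l * y) * expectation (\<lambda>x. exp (l * (\<Sum>j<n. Z j x)))"
proof -
  define F where "F k f \<longleftrightarrow> y \<le> (\<Sum>j<k. f j) \<and> (\<forall>i\<in>{..<k}. (\<Sum>j<i. f j) < y)" for k and f :: "nat \<Rightarrow> real"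
  define A where "A k = {x \<in> space M. F k (\<lambda>j. Z j x)}" for k
  define S where "S k x = (\<Sum>j<k. Z j x)" for k x
  have rv [measurable]: "random_variable borel (Z j)" for j
    using indep_bounded_centeredD(1)[OF Z] by simp
  have [measurable]: "random_variable borel (S k)" for k
    unfolding S_def by measurable
  have mA [measurable]: "A k \<in> events" for k
    unfolding A_def F_def S_def[symmetric] by measurable
  have un: "{x \<in> space M. \<exists>k\<le>n. y \<le> (\<Sum>j<k. Z j x)} = (\<Union>k\<le>n. A k)"
  proof (intro equalityI subsetI)
    fix x assume "x \<in> {x \<in> space M. \<exists>k\<le>n. y \<le> (\<Sum>j<k. Z j x)}"
    then obtain k where x: "x \<in> space M" and k: "k \<le> n" "y \<le> S k x" by (auto simp: S_def)
    define m where "m = (LEAST k. y \<le> S k x)"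
    have "y \<le> S m x" unfolding m_def by (rule LeastI[of "\<lambda>k. y \<le> S k x", OF k(2)])
    moreover have "m \<le> n" using Least_le[of "\<lambda>k. y \<le> S k x", OF k(2)] k(1) by (simp add: m_def)
    moreover have "S i x < y" if "i < m" for i
      using not_less_Least[of i "\<lambda>k. y \<le> S k x"] that by (simp add: m_def)
    ultimately have "m \<le> n" "x \<in> A m" using x by (auto simp: A_def F_def S_def)
    then show "x \<in> (\<Union>k\<le>n. A k)" by blast
  next
    fix x assume "x \<in> (\<Union>k\<le>n. A k)"
    then show "x \<in> {x \<in> space M. \<exists>k\<le>n. y \<le> (\<Sum>j<k. Z j x)}" by (auto simp: A_def F_def)
  qed
  have disj': "A i \<inter> A k = {}" if "i < k" for i k
    using that by (force simp: A_def F_def)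
  then have disj: "disjoint_family_on A {..n}"
    unfolding disjoint_family_on_def by (metis Int_commute linorder_neqE_nat)
  have iE: "integrable M (\<lambda>x. exp (l * (\<Sum>i\<in>I. Z i x)))" if "finite I" for I
    using that by (rule indep_vars_expectation_exp_sum(2)[OF indep_bounded_centered_subset[OF Z subset_UNIV]])
  have iZ: "integrable M (Z i)" for i
    by (rule integrable_const_bound[of _ c])
       (use indep_bounded_centeredD(2)[OF Z] in \<open>auto intro!: AE_I2\<close>)
  have E1: "1 \<le> expectation (\<lambda>x. exp (l * (\<Sum>i\<in>I. Z i x)))" if I: "finite I" for I
  proof -
    have "1 = expectation (\<lambda>x. 1 + l * (\<Sum>i\<in>I. Z i x))"
      using iZ indep_bounded_centeredD(3)[OF Z] by (simp add: prob_space)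
    also have "\<dots> \<le> expectation (\<lambda>x. exp (l * (\<Sum>i\<in>I. Z i x)))"
    proof (rule integral_mono[OF _ iE[OF I]])
      show "integrable M (\<lambda>x. 1 + l * (\<Sum>i\<in>I. Z i x))" using iZ by simp
    qed (rule exp_ge_add_one_self)
    finally show ?thesis .
  qed
  have step: "exp (l * y) * prob (A k) \<le> expectation (\<lambda>x. indicator (A k) x * exp (l * S n x))"
    if k: "k \<le> n" for k
  proof -
    define G where "G f = (if F k f then exp (l * (\<Sum>j<k. f j)) else 0)" for f
    define H where "H f = exp (l * (\<Sum>j\<in>{k..<n}. f j))" for f :: "nat \<Rightarrow> real"
    have "indep_var borel (G \<circ> (\<lambda>\<omega>. restrict (\<lambda>i. Z i \<omega>) {..<k}))
                   borel (H \<circ> (\<lambda>\<omega>. restrict (\<lambda>i. Z i \<omega>) {k..<n}))"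
    proof (rule indep_var_compose[OF indep_var_restrict[where I="UNIV" and M'="\<lambda>_. borel"]])
      show "indep_vars (\<lambda>_. borel) Z UNIV" using Z by (simp add: indep_bounded_centered_def)
      have c: "(\<lambda>f. \<Sum>j<i. f j) \<in> borel_measurable (Pi\<^sub>M {..<k} (\<lambda>_. borel :: real measure))" if "i \<le> k" for i
        using that by (intro borel_measurable_sum measurable_component_singleton) auto
      have "Measurable.pred (Pi\<^sub>M {..<k} (\<lambda>_. borel)) (\<lambda>f. (\<Sum>j<i. f j) < y)" if "i \<in> {..<k}" for i
        unfolding pred_def by (rule borel_measurable_less[OF c borel_measurable_const]) (use that in auto)
      then have "Measurable.pred (Pi\<^sub>M {..<k} (\<lambda>_. borel)) (\<lambda>f. \<forall>i\<in>{..<k}. (\<Sum>j<i. f j) < y)"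
        by (intro pred_intros_finite) auto
      moreover have "Measurable.pred (Pi\<^sub>M {..<k} (\<lambda>_. borel)) (\<lambda>f. y \<le> (\<Sum>j<k. f j))"
        unfolding pred_def by (rule borel_measurable_le[OF borel_measurable_const c]) auto
      ultimately have [measurable]: "Measurable.pred (Pi\<^sub>M {..<k} (\<lambda>_. borel)) (F k)"
        unfolding F_def by (rule pred_intros_logic(3)[rotated])
      note [measurable] = c[of k, OF order.refl]
      show "G \<in> borel_measurable (Pi\<^sub>M {..<k} (\<lambda>_. borel))"
        unfolding G_def by measurable
      show "H \<in> borel_measurable (Pi\<^sub>M {k..<n} (\<lambda>_. borel))"
        unfolding H_def by measurable
    qed (use k in auto)
    also have "H \<circ> (\<lambda>\<omega>. restrict (\<lambda>i. Z i \<omega>) {k..<n}) = (\<lambda>x. exp (l * (\<Sum>j\<in>{k..<n}. Z j x)))"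
      by (auto simp: H_def)
    also have "G \<circ> (\<lambda>\<omega>. restrict (\<lambda>i. Z i \<omega>) {..<k}) = (\<lambda>x. if F k (\<lambda>j. Z j x) then exp (l * S k x) else 0)"
    proof -
      have "F k (restrict f {..<k}) = F k f" for f :: "nat \<Rightarrow> real"
      proof -
        have "(\<Sum>j<i. restrict f {..<k} j) = (\<Sum>j<i. f j)" if "i \<le> k" for i
          using that by (intro sum.cong) auto
        then show ?thesis unfolding F_def by auto
      qed
      then show ?thesis by (auto simp: G_def S_def fun_eq_iff)
    qed
    finally have ind: "indep_var borel (\<lambda>x. if F k (\<lambda>j. Z j x) then exp (l * S k x) else 0)
        borel (\<lambda>x. exp (l * (\<Sum>j\<in>{k..<n}. Z j x)))" .
    have i0: "integrable M (\<lambda>x. exp (l * S k x))" using iE[of "{..<k}"] k by (auto simp: S_def)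
    have eqA: "(if F k (\<lambda>j. Z j x) then exp (l * S k x) else 0) = indicator (A k) x * exp (l * S k x)"
      if "x \<in> space M" for x using that by (auto simp: A_def)
    have i1: "integrable M (\<lambda>x. indicator (A k) x * exp (l * S k x))"
      using integrable_mult_indicator[OF mA i0] by simp
    have i1': "integrable M (\<lambda>x. if F k (\<lambda>j. Z j x) then exp (l * S k x) else 0)"
      using i1 by (subst Bochner_Integration.integrable_cong[OF refl eqA]) auto
    have "expectation (\<lambda>x. indicator (A k) x * exp (l * S n x)) =
       expectation (\<lambda>x. (if F k (\<lambda>j. Z j x) then exp (l * S k x) else 0) * exp (l * (\<Sum>j\<in>{k..<n}. Z j x)))"
    proof (rule Bochner_Integration.integral_cong[OF refl])
      fix x assume x: "x \<in> space M"
      have "S n x = S k x + (\<Sum>j\<in>{k..<n}. Z j x)"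
        unfolding S_def using k sum.atLeastLessThan_concat[of 0 k n "\<lambda>j. Z j x"]
        by (simp add: atLeast0LessThan)
      then show "indicator (A k) x * exp (l * S n x) =
        (if F k (\<lambda>j. Z j x) then exp (l * S k x) else 0) * exp (l * (\<Sum>j\<in>{k..<n}. Z j x))"
        unfolding eqA[OF x] by (simp add: exp_add distrib_left mult.assoc)
    qed
    also have "\<dots> = expectation (\<lambda>x. if F k (\<lambda>j. Z j x) then exp (l * S k x) else 0)
        * expectation (\<lambda>x. exp (l * (\<Sum>j\<in>{k..<n}. Z j x)))"
      by (rule indep_var_lebesgue_integral[OF ind i1' iE]) auto
    also have "\<dots> \<ge> expectation (\<lambda>x. if F k (\<lambda>j. Z j x) then exp (l * S k x) else 0) * 1"
      by (intro mult_left_mono E1 integral_nonneg_AE) auto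
    finally have *: "expectation (\<lambda>x. if F k (\<lambda>j. Z j x) then exp (l * S k x) else 0)
       \<le> expectation (\<lambda>x. indicator (A k) x * exp (l * S n x))" by simp
    have "exp (l * y) * prob (A k) = expectation (\<lambda>x. exp (l * y) * indicator (A k) x)"
      using mA by simp
    also have "\<dots> \<le> expectation (\<lambda>x. if F k (\<lambda>j. Z j x) then exp (l * S k x) else 0)"
    proof (rule integral_mono[OF _ i1'])
      show "integrable M (\<lambda>x. exp (l * y) * indicator (A k) x)"
        using mA by (intro integrable_mult_right) (simp add: emeasure_eq_measure)
      show "exp (l * y) * indicator (A k) x \<le> (if F k (\<lambda>j. Z j x) then exp (l * S k x) else 0)"
        if "x \<in> space M" for x
        using that l by (auto simp: A_def F_def S_def indicator_def intro: mult_left_mono)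
    qed
    finally show ?thesis using * by simp
  qed
  have iS: "integrable M (\<lambda>x. exp (l * S n x))" using iE[of "{..<n}"] by (simp add: S_def)
  have iA: "integrable M (\<lambda>x. indicator (A k) x * exp (l * S n x))" for k
    using integrable_mult_indicator[OF mA iS, of k] by simp
  have "exp (l * y) * prob (\<Union>k\<le>n. A k) = (\<Sum>k\<le>n. exp (l * y) * prob (A k))"
    using disj by (subst finite_measure_finite_Union) (auto simp: sum_distrib_left)
  also have "\<dots> \<le> (\<Sum>k\<le>n. expectation (\<lambda>x. indicator (A k) x * exp (l * S n x)))"
    by (intro sum_mono step) auto
  also have "\<dots> = expectation (\<lambda>x. \<Sum>k\<le>n. indicator (A k) x * exp (l * S n x))"
    by (rule Bochner_Integration.integral_sum[symmetric]) (rule iA)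
  also have "\<dots> \<le> expectation (\<lambda>x. exp (l * S n x))"
  proof (rule integral_mono[OF _ iS])
    show "integrable M (\<lambda>x. \<Sum>k\<le>n. indicator (A k) x * exp (l * S n x))"
      by (intro Bochner_Integration.integrable_sum iA)
    fix x
    have "(\<Sum>k\<le>n. indicator (A k) x) = (indicator (\<Union>k\<le>n. A k) x :: real)"
      by (rule indicator_UN_disjoint[symmetric]) (use disj in auto)
    also have "\<dots> \<le> 1" by (simp add: indicator_def)
    finally show "(\<Sum>k\<le>n. indicator (A k) x * exp (l * S n x)) \<le> exp (l * S n x)"
      unfolding sum_distrib_right[symmetric]
      using mult_right_mono[of "\<Sum>k\<le>n. indicator (A k) x" 1 "exp (l * S n x)"] by simp
  qed
  finally show ?thesis
    unfolding un S_def by (simp add: exp_minus field_simps)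
qed

text \<open>Changing the exponential weight from \<open>l\<close> to \<open>a\<close> at the price of a factor \<open>b\<close> is the form of Markov's
  inequality that handles both tails in \<open>sum_lower_tail\<close>.\<close>
lemma markov_exp_mgf:
  fixes X :: "'a \<Rightarrow> real"
  assumes [measurable]: "random_variable borel X" and "0 \<le> b" and "integrable M (\<lambda>x. exp (a * X x))"
    and "\<And>x. x \<in> space M \<Longrightarrow> P x \<Longrightarrow> exp (l * X x) \<le> exp (a * X x) * b"
    and [measurable]: "Measurable.pred M P"
  shows "expectation (\<lambda>x. exp (l * X x) * (if P x then 1 else 0)) \<le> expectation (\<lambda>x. exp (a * X x)) * b"
proof -
  have "expectation (\<lambda>x. exp (l * X x) * (if P x then 1 else 0)) \<le> expectation (\<lambda>x. exp (a * X x) * b)"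
  proof (rule integral_mono)
    show i: "integrable M (\<lambda>x. exp (a * X x) * b)" using assms by simp
    show "exp (l * X x) * (if P x then 1 else 0) \<le> exp (a * X x) * b" if "x \<in> space M" for x
      using assms(2,4) that by auto
    then show "integrable M (\<lambda>x. exp (l * X x) * (if P x then 1 else 0))"
      using assms(2,4) by (intro Bochner_Integration.integrable_bound[OF i]) (auto intro!: AE_I2)
  qed
  then show ?thesis by simp
qed

text \<open>Weight the law of the sum \<open>X\<close> by \<open>exp (l * X)\<close> with \<open>l = y / W\<close>. For a Gaussian variable this moves
  the mean to \<open>y\<close>; here too, comparison with the parameters \<open>(1 - \<delta>) * l\<close> and \<open>(1 + \<delta>) * l\<close> shows that the
  parts with \<open>X < (1 - \<delta>) * y\<close> and \<open>X > (1 + \<delta>) * y\<close> each contribute at most a quarter of the weighted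
  mass. The rest contributes at least half, and its weight is at most \<open>exp (l * (1 + \<delta>) * y)\<close>, which bounds
  its probability from below.\<close>
lemma sum_lower_tail:
  assumes Z: "indep_bounded_centered Z c I" and fin: "finite I"
    and W: "W = (\<Sum>i\<in>I. expectation (\<lambda>x. (Z i x)\<^sup>2))" and W0: "0 < W" and y: "0 < y"
    and d: "0 < \<delta>" "\<delta> \<le> 1/4"
    and small: "y / W * c \<le> \<delta>\<^sup>2 / 64" and large: "16 * ln 2 \<le> y\<^sup>2 / W * \<delta>\<^sup>2"
  shows "exp (- (y\<^sup>2 / (2 * W)) * (1 + 3 * \<delta>)) \<le> 2 * prob {x \<in> space M. (1 - \<delta>) * y \<le> (\<Sum>i\<in>I. Z i x)}"
proof -
  define X where "X x = (\<Sum>i\<in>I. Z i x)" for x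
  define l where "l = y / W"
  define q where "q = y\<^sup>2 / (2 * W)"
  \<comment> \<open>Moving the parameter by the factor \<open>1 \<plusminus> \<delta>\<close> gains \<open>\<delta>\<^sup>2\<close> in the exponent; this relative precision of the
    exponential moments is fine enough to keep a quarter of the gain.\<close>
  define \<gamma> where "\<gamma> = \<delta>\<^sup>2 / 8"
  have l0: "0 < l" using y W0 by (simp add: l_def)
  have g: "0 < \<gamma>" "\<gamma> \<le> 1" "\<gamma> \<le> \<delta> / 32"
    using d power_mono[of \<delta> "1/4" 2] by (auto simp: \<gamma>_def power2_eq_square)
  have q0: "0 < q" using y W0 by (simp add: q_def)
  have qW: "l\<^sup>2 * W / 2 = q" using W0 by (simp add: l_def q_def power2_eq_square field_simps)
  have ly: "l * y = 2 * q" by (simp add: l_def q_def power2_eq_square)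
  have c0: "0 \<le> c \<or> I = {}" using indep_bounded_centeredD(2)[OF Z] not_empty by fastforce
  have rv [measurable]: "random_variable borel X"
    unfolding X_def using indep_bounded_centeredD(1)[OF Z] by (intro borel_measurable_sum) auto
  have int: "integrable M (\<lambda>x. exp (a * X x))" for a
    unfolding X_def by (rule indep_vars_expectation_exp_sum(2)[OF Z fin])
  have lc: "r * l * c \<le> \<gamma> / 4" if "0 \<le> r" "r \<le> 2" for r
  proof -
    have "r * (l * c) \<le> 2 * (\<gamma>/8)"
    proof (cases "0 \<le> c")
      case True
      have "l * c \<le> \<gamma> / 8" using small by (simp add: l_def \<gamma>_def)
      then show ?thesis using that l0 True g by (intro mult_mono) auto
    next
      case False
      then have "r * (l * c) \<le> 0" using l0 that by (simp add: mult_nonneg_nonpos)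
      then show ?thesis using g by simp
    qed
    then show ?thesis by (simp add: mult.assoc)
  qed
  have up: "expectation (\<lambda>x. exp (r * l * X x)) \<le> exp (r\<^sup>2 * q * (1 + \<gamma>))" if "0 \<le> r" "r \<le> 2" for r
  proof -
    have "(r * l)\<^sup>2 * W / 2 = r\<^sup>2 * q" by (simp add: qW[symmetric] power_mult_distrib)
    with mgf_sum_bounds(2)[OF Z fin _ lc[OF that] g(1,2) W] that l0
    show ?thesis by (simp add: X_def)
  qed
  have lo: "exp (q * (1 - \<gamma>)) \<le> expectation (\<lambda>x. exp (l * X x))"
    using mgf_sum_bounds(1)[OF Z fin _ lc[of 1] g(1,2) W] l0 qW by (simp add: X_def)
  define E where "E = exp (q * (1 - \<gamma>))"
  have bound: "exp (r\<^sup>2 * q * (1 + \<gamma>)) * exp (2 * q * (1 - r) * r) \<le> E / 4"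
    if r: "0 \<le> r" "r \<le> 2" "(1 - r)\<^sup>2 = \<delta>\<^sup>2" for r
  proof -
    have "r\<^sup>2 * \<gamma> \<le> 4 * \<gamma>" using power_mono[of r 2 2] r g by (intro mult_right_mono) auto
    moreover have "r\<^sup>2 + 2 * (1 - r) * r = 1 - (1 - r)\<^sup>2" by (simp add: power2_eq_square algebra_simps)
    moreover have "r\<^sup>2 * (1 + \<gamma>) + 2 * (1 - r) * r = (r\<^sup>2 + 2 * (1 - r) * r) + r\<^sup>2 * \<gamma>"
      by (simp add: algebra_simps)
    moreover have "\<delta>\<^sup>2 = 8 * \<gamma>" by (simp add: \<gamma>_def)
    ultimately have "r\<^sup>2 * (1 + \<gamma>) + 2 * (1 - r) * r \<le> 1 - \<gamma> - \<delta>\<^sup>2 / 4"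
      using r(3) g(1) by linarith
    from mult_left_mono[OF this, of q] q0
    have "r\<^sup>2 * q * (1 + \<gamma>) + 2 * q * (1 - r) * r \<le> q * (1 - \<gamma>) - q * \<delta>\<^sup>2 / 4"
      by (simp add: algebra_simps)
    moreover have "2 * ln 2 \<le> q * \<delta>\<^sup>2 / 4" using large by (simp add: q_def)
    ultimately have "r\<^sup>2 * q * (1 + \<gamma>) + 2 * q * (1 - r) * r \<le> q * (1 - \<gamma>) - 2 * ln 2"
      by simp
    moreover have "q * (1 - \<gamma>) - 2 * ln 2 = ln (E / 4)"
      by (simp add: E_def ln_div ln_powr[of 2 2, symmetric] powr_numeral flip: ln_realpow)
    ultimately have "exp (r\<^sup>2 * q * (1 + \<gamma>) + 2 * q * (1 - r) * r) \<le> exp (ln (E/4))"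
      by simp
    then show ?thesis by (simp add: exp_add E_def)
  qed
  have low: "expectation (\<lambda>x. exp (l * X x) * (if X x < (1 - \<delta>) * y then 1 else 0)) \<le> E / 4"
  proof -
    have "expectation (\<lambda>x. exp (l * X x) * (if X x < (1 - \<delta>) * y then 1 else 0))
      \<le> expectation (\<lambda>x. exp ((1 - \<delta>) * l * X x)) * exp (2 * q * (1 - (1 - \<delta>)) * (1 - \<delta>))"
    proof (rule markov_exp_mgf[OF rv _ int])
      fix x assume "X x < (1 - \<delta>) * y"
      then have "\<delta> * l * X x \<le> \<delta> * l * ((1 - \<delta>) * y)" using d l0 by (intro mult_left_mono) auto
      also have "\<dots> = \<delta> * (1 - \<delta>) * (l * y)" by (simp add: algebra_simps)
      finally show "exp (l * X x) \<le> exp ((1 - \<delta>) * l * X x) * exp (2 * q * (1 - (1 - \<delta>)) * (1 - \<delta>))"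
        unfolding ly exp_add[symmetric] by (simp add: algebra_simps)
    qed auto
    also have "\<dots> \<le> exp ((1 - \<delta>)\<^sup>2 * q * (1 + \<gamma>)) * exp (2 * q * (1 - (1 - \<delta>)) * (1 - \<delta>))"
      using d by (intro mult_right_mono up) auto
    also have "\<dots> \<le> E / 4" using d by (intro bound) auto
    finally show ?thesis .
  qed
  have high: "expectation (\<lambda>x. exp (l * X x) * (if (1 + \<delta>) * y < X x then 1 else 0)) \<le> E / 4"
  proof -
    have "expectation (\<lambda>x. exp (l * X x) * (if (1 + \<delta>) * y < X x then 1 else 0))
      \<le> expectation (\<lambda>x. exp ((1 + \<delta>) * l * X x)) * exp (2 * q * (1 - (1 + \<delta>)) * (1 + \<delta>))"
    proof (rule markov_exp_mgf[OF rv _ int])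
      fix x assume "(1 + \<delta>) * y < X x"
      then have "\<delta> * l * ((1 + \<delta>) * y) \<le> \<delta> * l * X x" using d l0 by (intro mult_left_mono) auto
      moreover have "\<delta> * l * ((1 + \<delta>) * y) = \<delta> * (1 + \<delta>) * (l * y)" by (simp add: algebra_simps)
      ultimately have "\<delta> * (1 + \<delta>) * (2 * q) \<le> \<delta> * l * X x" by (simp only: ly)
      then show "exp (l * X x) \<le> exp ((1 + \<delta>) * l * X x) * exp (2 * q * (1 - (1 + \<delta>)) * (1 + \<delta>))"
        unfolding exp_add[symmetric] by (simp add: algebra_simps)
    qed auto
    also have "\<dots> \<le> exp ((1 + \<delta>)\<^sup>2 * q * (1 + \<gamma>)) * exp (2 * q * (1 - (1 + \<delta>)) * (1 + \<delta>))"
      using d by (intro mult_right_mono up) auto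
    also have "\<dots> \<le> E / 4" using d by (intro bound) auto
    finally show ?thesis .
  qed
  define B where "B = exp (2 * q * (1 + \<delta>))"
  define f where "f x = exp (l * X x) * (if X x < (1 - \<delta>) * y then 1 else 0)" for x
  define g where "g x = exp (l * X x) * (if (1 + \<delta>) * y < X x then 1 else 0)" for x
  define h where "h x = B * indicator {x \<in> space M. (1 - \<delta>) * y \<le> X x} x" for x
  have B0: "0 \<le> B" by (simp add: B_def)
  have i_f: "integrable M f"
    unfolding f_def by (rule Bochner_Integration.integrable_bound[OF int[of l]]) auto
  have i_g: "integrable M g"
    unfolding g_def by (rule Bochner_Integration.integrable_bound[OF int[of l]]) auto
  have i_h: "integrable M h"
    unfolding h_def
    by (intro integrable_mult_right integrable_real_indicator) (auto simp: emeasure_eq_measure)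
  have E_h: "expectation h = B * prob {x \<in> space M. (1 - \<delta>) * y \<le> X x}"
  proof -
    have "{x \<in> space M. (1 - \<delta>) * y \<le> X x} \<inter> space M = {x \<in> space M. (1 - \<delta>) * y \<le> X x}" by auto
    then show ?thesis unfolding h_def by simp
  qed
  have "E \<le> expectation (\<lambda>x. exp (l * X x))" using lo by (simp add: E_def)
  also have "\<dots> \<le> expectation (\<lambda>x. f x + g x + h x)"
  proof (rule integral_mono[OF int])
    show "integrable M (\<lambda>x. f x + g x + h x)" using i_f i_g i_h by simp
    fix x assume x: "x \<in> space M"
    show "exp (l * X x) \<le> f x + g x + h x"
    proof (cases "(1 - \<delta>) * y \<le> X x \<and> X x \<le> (1 + \<delta>) * y")
      case True
      then have "l * X x \<le> l * ((1 + \<delta>) * y)" using l0 by (intro mult_left_mono) auto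
      also have "\<dots> = (1 + \<delta>) * (l * y)" by (simp add: algebra_simps)
      finally have "exp (l * X x) \<le> B" by (simp add: B_def ly algebra_simps)
      then show ?thesis using True x by (auto simp: f_def g_def h_def indicator_def)
    next
      case False
      then show ?thesis using B0 by (auto simp: f_def g_def h_def indicator_def)
    qed
  qed
  also have "\<dots> = expectation f + expectation g + expectation h" using i_f i_g i_h by simp
  also have "\<dots> \<le> E / 4 + E / 4 + B * prob {x \<in> space M. (1 - \<delta>) * y \<le> X x}"
    using low high unfolding E_h f_def[abs_def] g_def[abs_def] by simp
  finally have "E \<le> E / 4 + E / 4 + B * prob {x \<in> space M. (1 - \<delta>) * y \<le> X x}" .
  then have "E \<le> 2 * (B * prob {x \<in> space M. (1 - \<delta>) * y \<le> X x})" by linarith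
  then have "E / B \<le> 2 * prob {x \<in> space M. (1 - \<delta>) * y \<le> X x}"
    by (simp add: B_def field_simps)
  moreover have "exp (- q * (1 + 3 * \<delta>)) \<le> E / B"
  proof -
    have "E / B = exp (q * (1 - \<gamma>) - 2 * q * (1 + \<delta>))" by (simp add: E_def B_def exp_diff)
    moreover have "q * \<gamma> \<le> q * \<delta>" using q0 g d by (intro mult_left_mono) auto
    then have "- q * (1 + 3 * \<delta>) \<le> q * (1 - \<gamma>) - 2 * q * (1 + \<delta>)" by (simp add: algebra_simps)
    ultimately show ?thesis by simp
  qed
  ultimately show ?thesis by (simp add: X_def q_def)
qed

end

section \<open>The law of the iterated logarithm for bounded variables, upper half\<close>

lemma filterlim_power_at_top: "1 < x \<Longrightarrow> filterlim (\<lambda>n. x ^ n) at_top sequentially" for x :: real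
  by (intro filterlim_at_infinity_imp_filterlim_at_top filterlim_realpow_sequentially_gt1) auto

text \<open>For \<open>v \<ge> exp 1\<close> the scale satisfies \<open>(lil_scale v)\<^sup>2 / (2 * v) = ln (ln v)\<close>. A Gaussian tail of variance \<open>v\<close> at this
  level is thus of order \<open>1 / ln v\<close>, the borderline of summability along a geometric sequence of \<open>v\<close>.\<close>
definition lil_scale :: "real \<Rightarrow> real" where
  "lil_scale v = sqrt (2 * v * ln (ln v))"

lemma exp_1_le_imp_ln_ln_nonneg: "exp 1 \<le> v \<Longrightarrow> 0 \<le> ln (ln v)" for v :: real
proof -
  assume "exp 1 \<le> v"
  then have "1 \<le> ln v" using ln_ge_iff[of v 1] less_le_trans[OF exp_gt_zero[of "1::real"]] by metis
  then show ?thesis by simp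
qed

lemma lil_scale_nonneg: "exp 1 \<le> v \<Longrightarrow> 0 \<le> lil_scale v"
  using exp_1_le_imp_ln_ln_nonneg[of v] less_le_trans[OF exp_gt_zero[of "1::real"], of v]
  by (simp add: lil_scale_def)

lemma lil_scale_mono:
  assumes "exp 1 \<le> u" "u \<le> v"
  shows "lil_scale u \<le> lil_scale v"
proof -
  have u: "0 < u" "1 < u" using assms(1) less_le_trans[of 0 "exp 1" u] one_less_exp_iff[of "1::real"] by (auto simp del: one_less_exp_iff)
  then have "0 < ln u" "ln u \<le> ln v" using assms by auto
  then have "ln (ln u) \<le> ln (ln v)" by simp
  then show ?thesis unfolding lil_scale_def
    using exp_1_le_imp_ln_ln_nonneg[OF assms(1)] u assms
    by (intro real_sqrt_le_mono mult_mono) auto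
qed

lemma lil_scale_over_arg: "((\<lambda>v. lil_scale v / v) \<longlongrightarrow> 0) at_top"
  unfolding lil_scale_def by real_asymp

lemma lil_scale_at_top: "filterlim lil_scale at_top at_top"
  unfolding lil_scale_def by real_asymp

lemma eventually_lil_scale_pos: "\<forall>\<^sub>F v in at_top. 0 < lil_scale v"
  using lil_scale_at_top unfolding filterlim_at_top_dense by blast

lemma lil_scale_scale:
  assumes "0 < c"
  shows "((\<lambda>v. lil_scale (c * v) / lil_scale v) \<longlongrightarrow> sqrt c) at_top"
  using assms unfolding lil_scale_def
  by real_asymp (simp add: powr_mult powr_half_sqrt)

context prob_space
begin

text \<open>By independence the probability that none of the events with indices in an interval occurs is a
  product, and \<open>1 - p \<le> exp (- p)\<close> bounds it by the exponential of a sum that diverges to minus infinity.\<close>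
lemma borel_cantelli_indep_vars:
  fixes B :: "nat \<Rightarrow> 'a \<Rightarrow> real"
  assumes ind: "indep_vars (\<lambda>_. borel) B UNIV"
    and div: "\<not> summable (\<lambda>n. prob {x \<in> space M. y n \<le> B n x})"
  shows "AE x in M. \<exists>\<^sub>\<infinity>n. y n \<le> B n x"
proof -
  have [measurable]: "random_variable borel (B n)" for n using ind by (auto simp: indep_vars_def)
  define p where "p n = prob {x \<in> space M. y n \<le> B n x}" for n
  define C where "C n = {x \<in> space M. B n x < y n}" for n
  have [measurable]: "C n \<in> events" for n unfolding C_def by measurable
  have pC: "prob (C n) = 1 - p n" for n
  proof -
    have "C n = space M - {x \<in> space M. y n \<le> B n x}" by (auto simp: C_def)
    then show ?thesis by (simp add: p_def prob_compl)
  qed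
  have indC: "indep_events C UNIV"
    unfolding C_def by (rule indep_eventsI_indep_vars[OF ind]) auto
  have null: "prob (\<Inter>n\<in>{m..}. C n) = 0" for m
  proof (rule ccontr)
    define e where "e = prob (\<Inter>n\<in>{m..}. C n)"
    assume "prob (\<Inter>n\<in>{m..}. C n) \<noteq> 0"
    then have e: "0 < e" using measure_nonneg[of M "\<Inter>n\<in>{m..}. C n"] by (simp add: e_def less_le)
    have "(\<Sum>n<k. p (n + m)) \<le> - ln e" for k
    proof (cases "k = 0")
      case True then show ?thesis using e by (simp add: e_def)
    next
      case False
      have "e \<le> prob (\<Inter>n\<in>{m..<m+k}. C n)"
        unfolding e_def using False by (intro finite_measure_mono) auto
      also have "\<dots> = (\<Prod>n\<in>{m..<m+k}. 1 - p n)"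
        using indC False unfolding indep_events_def by (auto simp: pC)
      also have "\<dots> \<le> (\<Prod>n\<in>{m..<m+k}. exp (- p n))"
        by (intro prod_mono conjI) (auto simp: p_def exp_ge_one_minus_x_over_n_power_n, metis add.commute exp_ge_add_one_self uminus_add_conv_diff)
      also have "\<dots> = exp (- (\<Sum>n\<in>{m..<m+k}. p n))" by (simp only: exp_sum[OF finite_atLeastLessThan, symmetric] sum_negf)
      also have "(\<Sum>n\<in>{m..<m+k}. p n) = (\<Sum>n<k. p (n + m))"
        using sum.shift_bounds_nat_ivl[of p 0 m k] by (simp add: atLeast0LessThan add.commute)
      finally have "ln e \<le> ln (exp (- (\<Sum>n<k. p (n + m))))" using e by (subst ln_le_cancel_iff) auto
      then show ?thesis by simp
    qed
    then have "summable (\<lambda>n. p (n + m))" by (intro summableI_nonneg_bounded) (auto simp: p_def)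
    then show False using div summable_iff_shift[of p m] by (simp add: p_def[abs_def])
  qed
  have "AE x in M. \<forall>m. x \<notin> (\<Inter>n\<in>{m..}. C n)"
    unfolding AE_all_countable
  proof
    fix m
    have "(\<Inter>n\<in>{m..}. C n) \<in> events" by measurable
    then have "(\<Inter>n\<in>{m..}. C n) \<in> null_sets M" using null[of m] by (simp add: emeasure_eq_measure null_sets_def)
    then show "AE x in M. x \<notin> (\<Inter>n\<in>{m..}. C n)" by (rule AE_not_in)
  qed
  then show ?thesis
    using AE_space by eventually_elim (force simp: C_def INFM_nat_le not_less)
qed

text \<open>At variance \<open>\<theta> ^ n\<close>, the maximal inequality with \<open>l = lil_scale (\<theta> ^ n) / \<theta> ^ n\<close> bounds the probability
  that the partial sums exceed \<open>(1 + \<delta>) * lil_scale (\<theta> ^ n)\<close> by \<open>(n * ln \<theta>) powr (- (1 + \<delta>))\<close>, which is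
  summable. For \<open>\<theta>\<close> close to 1 the scale hardly changes between two consecutive powers. The conclusion is
  about all \<open>k\<close> with \<open>V k \<le> v\<close> because Abel summation calls for running maxima.\<close>
lemma kolmogorov_lil_upper:
  fixes Z :: "nat \<Rightarrow> 'a \<Rightarrow> real"
  assumes Z: "indep_bounded_centered Z c UNIV"
    and V: "\<And>n. V n = (\<Sum>j<n. expectation (\<lambda>x. (Z j x)\<^sup>2))"
    and V_inf: "filterlim V at_top sequentially" and e: "0 < \<epsilon>"
  shows "AE x in M. \<forall>\<^sub>F v in at_top. \<forall>k. V k \<le> v \<longrightarrow> (\<Sum>j<k. Z j x) \<le> (1 + \<epsilon>) * lil_scale v"
proof -
  define \<delta> where "\<delta> = min 1 \<epsilon> / 3"
  define \<theta> where "\<theta> = 1 + \<delta>"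
  have d: "0 < \<delta>" "\<delta> \<le> 1" "3 * \<delta> \<le> \<epsilon>" using e by (auto simp: \<delta>_def)
  have t: "1 < \<theta>" using d by (simp add: \<theta>_def)
  define y where "y n = (1 + \<delta>) * lil_scale (\<theta> ^ n)" for n
  define S where "S k x = (\<Sum>j<k. Z j x)" for k x
  have [measurable]: "random_variable borel (Z j)" for j using indep_bounded_centeredD(1)[OF Z] by simp
  have [measurable]: "random_variable borel (S k)" for k unfolding S_def by measurable
  define E where "E n = {x \<in> space M. \<exists>k. V k \<le> \<theta> ^ n \<and> y n \<le> S k x}" for n
  have [measurable]: "E n \<in> events" for n unfolding E_def by measurable
  have pow: "filterlim (\<lambda>n. \<theta> ^ n) at_top sequentially" by (rule filterlim_power_at_top[OF t])
  have ev: "\<forall>\<^sub>F n in sequentially. exp 1 \<le> \<theta> ^ n \<and> lil_scale (\<theta> ^ n) / \<theta> ^ n * c \<le> \<delta> / 4"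
  proof (intro eventually_conj)
    show "\<forall>\<^sub>F n in sequentially. exp 1 \<le> \<theta> ^ n" using pow unfolding filterlim_at_top by blast
    have "((\<lambda>n. lil_scale (\<theta> ^ n) / \<theta> ^ n * c) \<longlongrightarrow> 0 * c) sequentially"
      by (intro tendsto_mult_right filterlim_compose[OF lil_scale_over_arg pow])
    then have "\<forall>\<^sub>F n in sequentially. lil_scale (\<theta> ^ n) / \<theta> ^ n * c < \<delta> / 4"
      by (rule order_tendstoD) (use d in auto)
    then show "\<forall>\<^sub>F n in sequentially. lil_scale (\<theta> ^ n) / \<theta> ^ n * c \<le> \<delta> / 4" by eventually_elim simp
  qed
  have bnd: "prob (E n) \<le> (ln \<theta>) powr (-(1+\<delta>)) * real n powr (-(1+\<delta>))"
    if n: "exp 1 \<le> \<theta> ^ n" "lil_scale (\<theta> ^ n) / \<theta> ^ n * c \<le> \<delta> / 4" for n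
  proof -
    \<comment> \<open>The last index of variance at most \<open>\<theta> ^ n\<close>, so that the variance at \<open>N\<close> does not overshoot.\<close>
    define N where "N = Max {k. V k \<le> \<theta> ^ n}"
    have "\<forall>\<^sub>F k in sequentially. \<theta> ^ n < V k" using V_inf unfolding filterlim_at_top_dense by auto
    then obtain k0 where k0: "\<And>k. k \<ge> k0 \<Longrightarrow> \<theta> ^ n < V k" unfolding eventually_sequentially by blast
    have "k \<le> k0" if "V k \<le> \<theta> ^ n" for k
      using k0[of k] that by (cases "k \<le> k0") auto
    then have "{k. V k \<le> \<theta> ^ n} \<subseteq> {..k0}" by auto
    then have fin: "finite {k. V k \<le> \<theta> ^ n}" by (rule finite_subset) simp
    have "V 0 \<le> \<theta> ^ n" using t by (simp add: V)
    then have VN: "V N \<le> \<theta> ^ n" using Max_in[OF fin] unfolding N_def by blast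
    have leN: "k \<le> N" if "V k \<le> \<theta> ^ n" for k unfolding N_def using that by (intro Max_ge fin) auto
    define l where "l = lil_scale (\<theta> ^ n) / \<theta> ^ n"
    define w where "w = ln (ln (\<theta> ^ n))"
    have w0: "0 \<le> w" unfolding w_def by (rule exp_1_le_imp_ln_ln_nonneg[OF n(1)])
    have tn: "0 < \<theta> ^ n" using t by simp
    have l0: "0 \<le> l" using lil_scale_nonneg[OF n(1)] tn by (simp add: l_def)
    have sq: "(lil_scale (\<theta> ^ n))\<^sup>2 = 2 * \<theta> ^ n * w" 
      unfolding lil_scale_def w_def[symmetric] by (rule real_sqrt_pow2) (use w0 tn in simp)
    have ly: "l * y n = (1 + \<delta>) * (2 * w)"
    proof -
      have "l * y n = (1 + \<delta>) * ((lil_scale (\<theta> ^ n))\<^sup>2 / \<theta> ^ n)"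
        by (simp add: l_def y_def power2_eq_square)
      also have "\<dots> = (1 + \<delta>) * (2 * w)" unfolding sq using t by simp
      finally show ?thesis by simp
    qed
    have l2: "l\<^sup>2 * \<theta> ^ n = 2 * w"
    proof -
      have "l\<^sup>2 * \<theta> ^ n = (lil_scale (\<theta> ^ n))\<^sup>2 / \<theta> ^ n"
        using tn unfolding l_def power_divide by (simp add: power2_eq_square)
      also have "\<dots> = 2 * w" unfolding sq using t by simp
      finally show ?thesis by simp
    qed
    have "prob (E n) \<le> prob {x \<in> space M. \<exists>k\<le>N. y n \<le> (\<Sum>j<k. Z j x)}"
    proof (rule finite_measure_mono)
      show "E n \<subseteq> {x \<in> space M. \<exists>k\<le>N. y n \<le> (\<Sum>j<k. Z j x)}"
        unfolding E_def S_def using leN by blast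
      show "{x \<in> space M. \<exists>k\<le>N. y n \<le> (\<Sum>j<k. Z j x)} \<in> events" by measurable
    qed
    also have "\<dots> \<le> exp (- l * y n) * expectation (\<lambda>x. exp (l * (\<Sum>j<N. Z j x)))"
      by (rule exponential_maximal_inequality[OF Z l0])
    also have "\<dots> \<le> exp (- l * y n) * exp (l\<^sup>2 * V N / 2 * (1 + \<delta>))"
    proof (rule mult_left_mono)
      show "expectation (\<lambda>x. exp (l * (\<Sum>j<N. Z j x))) \<le> exp (l\<^sup>2 * V N / 2 * (1 + \<delta>))"
        by (rule mgf_sum_bounds(2)[OF indep_bounded_centered_subset[OF Z subset_UNIV] finite_lessThan l0 _ d(1,2) V])
           (use n(2) in \<open>simp add: l_def\<close>)
    qed simp
    also have "\<dots> \<le> exp (- l * y n) * exp (l\<^sup>2 * \<theta> ^ n / 2 * (1 + \<delta>))"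
    proof -
      have "l\<^sup>2 * V N / 2 * (1 + \<delta>) \<le> l\<^sup>2 * \<theta> ^ n / 2 * (1 + \<delta>)"
        using VN d by (intro mult_right_mono divide_right_mono mult_left_mono) auto
      then show ?thesis by simp
    qed
    also have "\<dots> = exp (- (1 + \<delta>) * w)"
    proof -
      have "- l * y n + l\<^sup>2 * \<theta> ^ n / 2 * (1 + \<delta>) = - (1 + \<delta>) * w"
        unfolding l2 mult_minus_left ly by (simp add: algebra_simps)
      then show ?thesis unfolding exp_add[symmetric] by simp
    qed
    also have "\<dots> = (ln (\<theta> ^ n)) powr (-(1+\<delta>))"
    proof -
      have "ln (\<theta> ^ n) \<noteq> 0" using n(1) ln_ge_iff[OF tn, of 1] by auto
      then show ?thesis by (simp add: powr_def w_def)
    qed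
    also have "\<dots> = (ln \<theta>) powr (-(1+\<delta>)) * real n powr (-(1+\<delta>))"
    proof -
      have "ln (\<theta> ^ n) = ln \<theta> * real n" using t by (simp add: ln_realpow)
      then show ?thesis using t by (simp only: powr_mult)
    qed
    finally show ?thesis .
  qed
  have "summable (\<lambda>n. prob (E n))"
  proof (rule summable_comparison_test_ev)
    show "\<forall>\<^sub>F n in sequentially. norm (prob (E n)) \<le> (ln \<theta>) powr (-(1+\<delta>)) * real n powr (-(1+\<delta>))"
      using ev by eventually_elim (use bnd in simp)
    show "summable (\<lambda>n. (ln \<theta>) powr (-(1+\<delta>)) * real n powr (-(1+\<delta>)))"
      using d by (intro summable_mult) (simp add: summable_real_powr_iff)
  qed
  then have "AE x in M. eventually (\<lambda>n. x \<in> space M - E n) sequentially"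
    by (intro borel_cantelli_AE1) (auto simp: emeasure_eq_measure)
  then show ?thesis
  proof eventually_elim
    case (elim x)
    then obtain n0 where n0: "\<And>n. n \<ge> n0 \<Longrightarrow> x \<in> space M - E n" unfolding eventually_sequentially by blast
    have "sqrt \<theta> < \<theta>" using t by (intro real_less_lsqrt) (simp_all add: power2_eq_square)
    then have "\<forall>\<^sub>F v in at_top. lil_scale (\<theta> * v) / lil_scale v < \<theta>"
      using order_tendstoD(2)[OF lil_scale_scale[of \<theta>]] t by simp
    moreover note eventually_lil_scale_pos
    moreover have "\<forall>\<^sub>F v in at_top. max (\<theta> ^ n0) (exp 1) \<le> v" by (rule eventually_ge_at_top)
    ultimately show ?case
    proof eventually_elim
      case (elim v)
      show ?case
      proof (intro allI impI)
        fix k assume k: "V k \<le> v"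
        define m where "m = (LEAST m. v < \<theta> ^ m)"
        obtain m' where "v < \<theta> ^ m'" using real_arch_pow[OF t] by blast
        then have m: "v < \<theta> ^ m" unfolding m_def by (rule LeastI)
        have "n0 < m"
        proof (rule ccontr)
          assume "\<not> n0 < m"
          then have "\<theta> ^ m \<le> \<theta> ^ n0" using t by (intro power_increasing) auto
          then show False using m elim(3) by simp
        qed
        then obtain n where mn: "m = Suc n" "n0 \<le> n" by (cases m) auto
        have "\<not> v < \<theta> ^ n" using not_less_Least[of n "\<lambda>m. v < \<theta> ^ m"] mn by (simp add: m_def)
        then have vn: "\<theta> ^ n \<le> v" by simp
        have "x \<in> space M - E m" using n0[of m] mn by simp
        then have "\<not> (V k \<le> \<theta> ^ m \<and> y m \<le> S k x)" unfolding E_def by blast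
        then have "S k x < y m" using k m by linarith
        also have "y m \<le> (1 + \<delta>) * lil_scale (\<theta> * v)"
        proof -
          have "\<theta> ^ m \<le> \<theta> * v" using vn t by (simp add: mn(1))
          moreover have "exp 1 \<le> \<theta> ^ m" using m elim(3) by simp
          ultimately show ?thesis
            unfolding y_def using d by (intro mult_left_mono lil_scale_mono) simp_all
        qed
        also have "\<dots> \<le> (1 + \<delta>) * (\<theta> * lil_scale v)"
          using elim(1,2) d by (intro mult_left_mono) (simp_all add: pos_divide_less_eq)
        also have "\<dots> = ((1 + \<delta>) * (1 + \<delta>)) * lil_scale v" by (simp add: \<theta>_def)
        also have "\<dots> \<le> (1 + \<epsilon>) * lil_scale v"
        proof (intro mult_right_mono)
          have "\<delta> * \<delta> \<le> \<delta> * 1" using d by (intro mult_left_mono) auto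
          moreover have "(1 + \<delta>) * (1 + \<delta>) = 1 + 2 * \<delta> + \<delta> * \<delta>"
            by (simp add: algebra_simps)
          ultimately show "(1 + \<delta>) * (1 + \<delta>) \<le> 1 + \<epsilon>" using d by linarith
        qed (use elim(2) in simp)
        finally show "(\<Sum>j<k. Z j x) \<le> (1 + \<epsilon>) * lil_scale v" by (simp add: S_def)
      qed
    qed
  qed
qed

lemma indep_vars_reindex_inj:
  assumes ind: "indep_vars (\<lambda>_. N) X I" and f: "inj f" "range f \<subseteq> I"
  shows "indep_vars (\<lambda>_. N) (\<lambda>k. X (f k)) UNIV"
proof -
  have "indep_vars (\<lambda>k. PiM {f k} (\<lambda>_. N)) (\<lambda>k \<omega>. restrict (\<lambda>i. X i \<omega>) {f k}) UNIV"
    using f by (intro indep_vars_restrict[OF ind]) (auto simp: disjoint_family_on_def dest: injD)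
  then have "indep_vars (\<lambda>_. N) (\<lambda>k \<omega>. (restrict (\<lambda>i. X i \<omega>) {f k}) (f k)) UNIV"
    by (rule indep_vars_compose2) (simp add: measurable_component_singleton)
  then show ?thesis by simp
qed

end

section \<open>The sum of the reciprocals of the primes\<close>

context
  fixes f :: "nat \<Rightarrow> real"
  assumes f1: "f (Suc 0) = 1" and f_mult: "\<And>m n. 0 < m \<Longrightarrow> 0 < n \<Longrightarrow> f (m * n) = f m * f n"
    and f_nonneg: "\<And>n. 0 \<le> f n"
begin

lemma multiplicative_power: "0 < m \<Longrightarrow> f (m ^ k) = f m ^ k"
  by (induction k) (simp_all add: f1 f_mult)

lemma multiplicative_prod: "(\<And>i. i \<in> I \<Longrightarrow> 0 < h i) \<Longrightarrow> f (prod h I) = (\<Prod>i\<in>I. f (h i))"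
proof (induction I rule: infinite_finite_induct)
  case (insert i I)
  then show ?case by (simp add: f_mult prod_pos)
qed (simp_all add: f1)

text \<open>By unique factorisation, distinct exponent vectors yield distinct integers.\<close>
lemma euler_product_expand:
  assumes S: "finite S" "\<And>p. p \<in> S \<Longrightarrow> prime p"
  shows "(\<Prod>p\<in>S. \<Sum>j\<le>K. f p ^ j) = (\<Sum>n\<in>(\<lambda>g. \<Prod>p\<in>S. p ^ g p) ` (PiE S (\<lambda>_. {..K})). f n)"
proof -
  have inj: "inj_on (\<lambda>g. \<Prod>p\<in>S. p ^ g p) (PiE S (\<lambda>_. {..K}))"
  proof (rule inj_onI)
    fix g h assume gh: "g \<in> PiE S (\<lambda>_. {..K})" "h \<in> PiE S (\<lambda>_. {..K})"
      and eq: "(\<Prod>p\<in>S. p ^ g p) = (\<Prod>p\<in>S. p ^ h p)"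
    show "g = h"
    proof (rule PiE_ext[OF gh])
      fix p assume p: "p \<in> S"
      have "g p = multiplicity p (\<Prod>p\<in>S. p ^ g p)"
        using multiplicity_prod_prime_powers[OF S S(2)[OF p], of g] p by simp
      also have "\<dots> = h p"
        unfolding eq using multiplicity_prod_prime_powers[OF S S(2)[OF p], of h] p by simp
      finally show "g p = h p" .
    qed
  qed
  have "(\<Prod>p\<in>S. \<Sum>j\<le>K. f p ^ j) = (\<Sum>g\<in>PiE S (\<lambda>_. {..K}). \<Prod>p\<in>S. f p ^ g p)"
    by (rule prod_sum_PiE) (use S in auto)
  also have "\<dots> = (\<Sum>g\<in>PiE S (\<lambda>_. {..K}). f (\<Prod>p\<in>S. p ^ g p))"
    using S by (intro sum.cong refl) (simp add: multiplicative_prod multiplicative_power prime_gt_0_nat)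
  also have "\<dots> = (\<Sum>n\<in>(\<lambda>g. \<Prod>p\<in>S. p ^ g p) ` (PiE S (\<lambda>_. {..K})). f n)"
    by (simp add: sum.reindex[OF inj])
  finally show ?thesis .
qed

text \<open>The expanded products run over a set of positive integers; letting \<open>K\<close> tend to infinity turns the
  finite geometric sums into the Euler factors.\<close>
lemma euler_product_le:
  assumes S: "finite S" "\<And>p. p \<in> S \<Longrightarrow> prime p" and lt: "\<And>p. p \<in> S \<Longrightarrow> f p < 1"
    and B: "\<And>N. (\<Sum>n\<in>{1..N}. f n) \<le> B"
  shows "(\<Prod>p\<in>S. 1 / (1 - f p)) \<le> B"
proof (rule LIMSEQ_le_const2)
  show "(\<lambda>K. \<Prod>p\<in>S. \<Sum>j\<le>K. f p ^ j) \<longlonglongrightarrow> (\<Prod>p\<in>S. 1 / (1 - f p))"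
  proof (rule tendsto_prod)
    fix p assume "p \<in> S"
    then have "(\<lambda>j. f p ^ j) sums (1 / (1 - f p))" using lt f_nonneg by (intro geometric_sums) auto
    then show "(\<lambda>K. \<Sum>j\<le>K. f p ^ j) \<longlonglongrightarrow> 1 / (1 - f p)" by (simp add: sums_def_le)
  qed
  show "\<exists>N. \<forall>K\<ge>N. (\<Prod>p\<in>S. \<Sum>j\<le>K. f p ^ j) \<le> B"
  proof (intro exI allI impI)
    fix K :: nat
    let ?T = "(\<lambda>g. \<Prod>p\<in>S. p ^ g p) ` (PiE S (\<lambda>_. {..K}))"
    have fin: "finite ?T" using S by (intro finite_imageI finite_PiE) auto
    have "?T \<subseteq> {1..Max ?T}"
    proof
      fix n assume n: "n \<in> ?T"
      then have "0 < n" using S by (auto intro!: prod_pos simp: prime_gt_0_nat)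
      then show "n \<in> {1..Max ?T}" using Max_ge[OF fin n] by simp
    qed
    then have "(\<Sum>n\<in>?T. f n) \<le> (\<Sum>n\<in>{1..Max ?T}. f n)"
      by (intro sum_mono2) (auto simp: f_nonneg)
    also have "\<dots> \<le> B" by (rule B)
    finally show "(\<Prod>p\<in>S. \<Sum>j\<le>K. f p ^ j) \<le> B"
      by (subst euler_product_expand) (use S in auto)
  qed
qed

text \<open>Every \<open>n \<le> N\<close> is a product of powers of primes up to \<open>N\<close> with exponents up to \<open>N\<close>, so it occurs in the
  expanded product.\<close>
lemma euler_product_ge:
  assumes lt: "\<And>p. prime p \<Longrightarrow> f p < 1"
  shows "(\<Sum>n\<in>{1..N}. f n) \<le> (\<Prod>p\<in>{p. prime p \<and> p \<le> N}. 1 / (1 - f p))"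
proof -
  define S where "S = {p::nat. prime p \<and> p \<le> N}"
  have S: "finite S" "\<And>p. p \<in> S \<Longrightarrow> prime p" by (auto simp: S_def)
  let ?T = "(\<lambda>g. \<Prod>p\<in>S. p ^ g p) ` (PiE S (\<lambda>_. {..N}))"
  have "{1..N} \<subseteq> ?T"
  proof
    fix n assume n: "n \<in> {1..N}"
    define g where "g = restrict (\<lambda>p. multiplicity p n) S"
    have "multiplicity p n \<le> N" if "p \<in> S" for p
    proof -
      have "p ^ multiplicity p n \<le> n" using n by (intro dvd_imp_le multiplicity_dvd) auto
      moreover have "multiplicity p n < p ^ multiplicity p n"
        using prime_gt_1_nat[OF S(2)[OF that]] by (intro power_gt_expt) auto
      ultimately show ?thesis using n by simp
    qed
    then have g: "g \<in> PiE S (\<lambda>_. {..N})" by (auto simp: g_def)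
    have sub: "prime_factors n \<subseteq> S"
      using n by (auto simp: S_def prime_factors_dvd dest!: dvd_imp_le)
    have "n = (\<Prod>p\<in>prime_factors n. p ^ multiplicity p n)" using n by (intro prime_factorization_nat) auto
    also have "\<dots> = (\<Prod>p\<in>S. p ^ multiplicity p n)"
    proof (rule prod.mono_neutral_left[OF S(1) sub], rule ballI)
      fix p assume p: "p \<in> S - prime_factors n"
      then have "\<not> p dvd n" using n S(2) by (auto simp: prime_factors_dvd)
      then show "p ^ multiplicity p n = 1" by (simp add: not_dvd_imp_multiplicity_0)
    qed
    also have "\<dots> = (\<Prod>p\<in>S. p ^ g p)" by (simp add: g_def)
    finally show "n \<in> ?T" using g by (intro image_eqI)
  qed
  moreover have "finite ?T" using S by (intro finite_imageI finite_PiE) auto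
  ultimately have "(\<Sum>n\<in>{1..N}. f n) \<le> (\<Sum>n\<in>?T. f n)"
    by (intro sum_mono2) (auto simp: f_nonneg)
  also have "\<dots> = (\<Prod>p\<in>S. \<Sum>j\<le>N. f p ^ j)" by (rule euler_product_expand[OF S, symmetric])
  also have "\<dots> \<le> (\<Prod>p\<in>S. 1 / (1 - f p))"
  proof (intro prod_mono conjI sum_nonneg)
    fix p assume "p \<in> S"
    then have g: "(\<lambda>j. f p ^ j) sums (1 / (1 - f p))"
      using lt S f_nonneg by (intro geometric_sums) auto
    have "(\<Sum>j\<in>{..N}. f p ^ j) \<le> (\<Sum>j. f p ^ j)"
      using sums_summable[OF g] f_nonneg by (intro sum_le_suminf) auto
    then show "(\<Sum>j\<le>N. f p ^ j) \<le> 1 / (1 - f p)" using sums_unique[OF g] by simp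
  qed (simp add: f_nonneg)
  finally show ?thesis by (simp add: S_def)
qed

end

text \<open>Comparison with the integral of \<open>x powr (-1 - u)\<close>, in the form of a telescoping sum.\<close>
lemma sum_powr_le:
  assumes u: "0 < u"
  shows "(\<Sum>n\<in>{1..N}. real n powr (-1 - u)) \<le> 1 + 1 / u"
proof -
  have incr: "real (Suc n) powr (-1 - u) \<le> (real n powr (-u) - real (Suc n) powr (-u)) / u" if n: "1 \<le> n" for n
  proof -
    have "\<exists>z>real n. z < real (Suc n) \<and> real (Suc n) powr (-u) - real n powr (-u)
        = (real (Suc n) - real n) * ((-u) * z powr (-u - 1))"
      using n by (intro MVT2 has_real_derivative_powr) auto
    then obtain z where z: "real n < z" "z < real (Suc n)"
      "real (Suc n) powr (-u) - real n powr (-u) = - (u * z powr (-u - 1))" by auto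
    have "real (Suc n) powr (-1 - u) \<le> z powr (-1 - u)"
      using z n u by (intro powr_mono2') auto
    moreover have "-1 - u = -u - 1" by simp
    ultimately have "u * real (Suc n) powr (-1 - u) \<le> u * z powr (-u - 1)"
      using u by (metis mult_left_mono less_imp_le)
    then have "u * real (Suc n) powr (-1 - u) \<le> real n powr (-u) - real (Suc n) powr (-u)"
      using z(3) by linarith
    then show ?thesis using u by (simp add: pos_le_divide_eq mult.commute)
  qed
  have "(\<Sum>n\<in>{1..N}. real n powr (-1 - u)) \<le> 1 + (1 - real N powr (-u)) / u" if "1 \<le> N"
    using that
  proof (induction N rule: dec_induct)
    case base then show ?case by simp
  next
    case (step n)
    then show ?case using incr[of n] u by (simp add: diff_divide_distrib)
  qed
  moreover have "(1 - real N powr (-u)) / u \<le> 1 / u" using u by (intro divide_right_mono) auto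
  ultimately show ?thesis using u by (cases "1 \<le> N") auto
qed

text \<open>Take logarithms in the Euler product and use \<open>x \<le> - ln (1 - x)\<close>.\<close>
lemma sum_prime_powr_le:
  assumes S: "finite S" "\<And>p. p \<in> S \<Longrightarrow> prime p" and u: "0 < u"
  shows "(\<Sum>p\<in>S. real p powr (-1 - u)) \<le> ln (1 + 1 / u)"
proof -
  have lt: "real p powr (-1 - u) < 1" if "p \<in> S" for p
    using S(2)[OF that, THEN prime_gt_1_nat] u powr_less_mono[of "-1-u" 0 "real p"] by simp
  have pr: "(\<Prod>p\<in>S. 1 / (1 - real p powr (-1 - u))) \<le> 1 + 1 / u"
    by (rule euler_product_le[where f="\<lambda>n. real n powr (-1 - u)"])
       (use S lt sum_powr_le[OF u] in \<open>auto simp: powr_mult\<close>)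
  have pos: "0 < (\<Prod>p\<in>S. 1 / (1 - real p powr (-1 - u)))"
    using lt by (intro prod_pos) auto
  have "(\<Sum>p\<in>S. real p powr (-1 - u)) \<le> (\<Sum>p\<in>S. ln (1 / (1 - real p powr (-1 - u))))"
  proof (rule sum_mono)
    fix p assume "p \<in> S"
    then show "real p powr (-1 - u) \<le> ln (1 / (1 - real p powr (-1 - u)))"
      using lt[of p] ln_add_one_self_le_self2[of "- (real p powr (-1 - u))"] by (simp add: ln_div)
  qed
  also have "\<dots> = ln (\<Prod>p\<in>S. 1 / (1 - real p powr (-1 - u)))"
  proof (rule ln_prod[symmetric])
    show "1 / (1 - real p powr (-1 - u)) \<noteq> 0" if "p \<in> S" for p using lt[OF that] by simp
  qed (rule S)
  also have "\<dots> \<le> ln (1 + 1 / u)" using pr pos by (intro ln_mono) auto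
  finally show ?thesis .
qed

text \<open>Euler's argument: the product of \<open>1 / (1 - 1 / p)\<close> exceeds the harmonic sum, and in its logarithm the
  terms beyond \<open>1 / p\<close> are dominated by the convergent series of \<open>2 / n\<^sup>2\<close>.\<close>
lemma sum_inverse_primes_ge:
  obtains C where "\<And>N. 1 \<le> N \<Longrightarrow> ln (ln (real N + 1)) - C \<le> (\<Sum>p\<in>{p. prime p \<and> p \<le> N}. 1 / real p)"
proof
  define C where "C = (\<Sum>n. 2 * inverse ((real n)\<^sup>2))"
  have sC: "summable (\<lambda>n. 2 * inverse ((real n)\<^sup>2))"
    using inverse_power_summable[of 2, where 'a=real] by (intro summable_mult) auto
  fix N :: nat assume N: "1 \<le> N"
  define S where "S = {p::nat. prime p \<and> p \<le> N}"
  have S: "finite S" "\<And>p. p \<in> S \<Longrightarrow> prime p" by (auto simp: S_def)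
  have p2: "2 \<le> real p" if "p \<in> S" for p using S(2)[OF that, THEN prime_ge_2_nat] by simp
  have "ln (real N + 1) \<le> (\<Sum>n\<in>{1..N}. 1 / real n)"
    using ln_le_harm[of N] by (simp add: harm_def inverse_eq_divide)
  also have "\<dots> \<le> (\<Prod>p\<in>S. 1 / (1 - 1 / real p))"
    unfolding S_def by (rule euler_product_ge) (auto dest: prime_gt_1_nat)
  finally have "ln (ln (real N + 1)) \<le> ln (\<Prod>p\<in>S. 1 / (1 - 1 / real p))"
    using N by (intro ln_mono) auto
  also have "\<dots> = (\<Sum>p\<in>S. ln (1 / (1 - 1 / real p)))"
  proof (rule ln_prod)
    show "1 / (1 - 1 / real p) \<noteq> 0" if "p \<in> S" for p using p2[OF that] by simp
  qed (rule S)
  also have "\<dots> \<le> (\<Sum>p\<in>S. 1 / real p + 2 * inverse ((real p)\<^sup>2))"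
  proof (rule sum_mono)
    fix p assume p: "p \<in> S"
    have "- (1 / real p) - 2 * (1 / real p)\<^sup>2 \<le> ln (1 - 1 / real p)"
      using p2[OF p] by (intro ln_one_minus_pos_lower_bound) (auto simp: field_simps)
    moreover have "ln (1 / (1 - 1 / real p)) = - ln (1 - 1 / real p)"
      using p2[OF p] by (subst ln_div) (auto simp: field_simps)
    ultimately show "ln (1 / (1 - 1 / real p)) \<le> 1 / real p + 2 * inverse ((real p)\<^sup>2)"
      by (simp add: power_divide inverse_eq_divide)
  qed
  also have "\<dots> \<le> (\<Sum>p\<in>S. 1 / real p) + C"
    unfolding sum.distrib C_def using sC S by (intro add_left_mono sum_le_suminf) auto
  finally show "ln (ln (real N + 1)) - C \<le> (\<Sum>p\<in>{p. prime p \<and> p \<le> N}. 1 / real p)"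
    by (simp add: S_def)
qed

definition nth_prime :: "nat \<Rightarrow> nat" where
  "nth_prime = enumerate {p. prime p}"

lemma prime_nth_prime: "prime (nth_prime k)"
  using enumerate_in_set[OF primes_infinite, of k] by (simp add: nth_prime_def)

lemma strict_mono_nth_prime: "strict_mono nth_prime"
  unfolding nth_prime_def by (rule strict_mono_enumerate[OF primes_infinite])

lemma range_nth_prime: "range nth_prime = {p. prime p}"
  unfolding nth_prime_def by (rule range_enumerate[OF primes_infinite])

lemma le_nth_prime: "k \<le> nth_prime k"
  unfolding nth_prime_def by (rule le_enumerate[OF primes_infinite])

lemma nth_prime_ge_2: "2 \<le> real (nth_prime k)"
  using prime_ge_2_nat[OF prime_nth_prime, of k] by simp

lemma nth_prime_pos: "0 < real (nth_prime k)" and nth_prime_gt_1: "1 < real (nth_prime k)"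
  using nth_prime_ge_2[of k] by linarith+

text \<open>With respect to \<open>v = ln (ln p)\<close> the weights \<open>1 / p\<close> on the primes have asymptotic density 1. Counting the
  primes on this scale makes the variances below linear in the parameter.\<close>
definition prime_count_loglog :: "real \<Rightarrow> nat" where
  "prime_count_loglog v = card {k. ln (ln (real (nth_prime k))) \<le> v}"

lemma ln_le_iff_le_exp: "0 < x \<Longrightarrow> ln x \<le> y \<longleftrightarrow> x \<le> exp y" for x y :: real
  by (metis exp_le_cancel_iff exp_ln)

lemma ln_ln_nth_prime_le_iff: "ln (ln (real (nth_prime k))) \<le> v \<longleftrightarrow> real (nth_prime k) \<le> exp (exp v)"
proof -
  have "ln (ln (real (nth_prime k))) \<le> v \<longleftrightarrow> ln (real (nth_prime k)) \<le> exp v"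
    using nth_prime_gt_1[of k] by (intro ln_le_iff_le_exp) simp
  also have "\<dots> \<longleftrightarrow> real (nth_prime k) \<le> exp (exp v)"
    using nth_prime_pos[of k] by (rule ln_le_iff_le_exp)
  finally show ?thesis .
qed

lemma less_prime_count_loglog_iff: "k < prime_count_loglog v \<longleftrightarrow> real (nth_prime k) \<le> exp (exp v)"
proof -
  define A where "A = {k. real (nth_prime k) \<le> exp (exp v)}"
  have "A \<subseteq> {.. nat \<lceil>exp (exp v)\<rceil>}"
  proof
    fix k assume "k \<in> A"
    then have "real k \<le> exp (exp v)" using le_nth_prime[of k] by (auto simp: A_def)
    then show "k \<in> {.. nat \<lceil>exp (exp v)\<rceil>}" by (simp add: le_nat_iff le_ceiling_iff)
  qed
  then have fin: "finite A" by (rule finite_subset) simp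
  have down: "j \<in> A" if "k \<in> A" "j \<le> k" for j k
    using that strict_mono_less_eq[OF strict_mono_nth_prime, of j k] by (auto simp: A_def)
  have "A = {..<card A}"
  proof (rule card_seteq[symmetric])
    show "{..<card A} \<subseteq> A"
    proof
      fix j assume j: "j \<in> {..<card A}"
      show "j \<in> A"
      proof (rule ccontr)
        assume "j \<notin> A"
        then have "k \<notin> A" if "j \<le> k" for k using down that by blast
        then have "A \<subseteq> {..<j}" by (auto simp: not_le[symmetric])
        then have "card A \<le> j" using card_mono[of "{..<j}" A] by simp
        then show False using j by simp
      qed
    qed
  qed (use fin in auto)
  moreover have "card A = prime_count_loglog v"
    unfolding prime_count_loglog_def A_def ln_ln_nth_prime_le_iff ..
  ultimately show ?thesis unfolding A_def by auto
qed

lemma prime_count_mono: "u \<le> v \<Longrightarrow> prime_count_loglog u \<le> prime_count_loglog v"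
  by (metis exp_le_cancel_iff le_less_linear less_irrefl less_prime_count_loglog_iff order_trans)

lemma primes_below_eq: "{p. prime p \<and> real p \<le> exp (exp v)} = nth_prime ` {..<prime_count_loglog v}"
proof (intro equalityI subsetI)
  fix p assume p: "p \<in> {p. prime p \<and> real p \<le> exp (exp v)}"
  then have "p \<in> range nth_prime" using range_nth_prime by simp
  then obtain k where "p = nth_prime k" by auto
  then show "p \<in> nth_prime ` {..<prime_count_loglog v}"
    using p by (auto simp: less_prime_count_loglog_iff)
qed (auto simp: less_prime_count_loglog_iff prime_nth_prime)

text \<open>The lower bound is Euler's. The upper bound is Rankin's trick: for \<open>p \<le> exp (exp v)\<close> the reciprocal
  \<open>1 / p\<close> is at most \<open>exp (u * exp v) * p powr (-1 - u)\<close>, whose sum is controlled by \<open>ln (1 + 1 / u)\<close>.\<close>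
lemma sum_inverse_primes_asymp:
  "((\<lambda>v. (\<Sum>k<prime_count_loglog v. 1 / real (nth_prime k)) / v) \<longlongrightarrow> 1) at_top"
proof -
  define A where "A v = (\<Sum>k<prime_count_loglog v. 1 / real (nth_prime k))" for v
  have A: "A v = (\<Sum>p\<in>{p. prime p \<and> real p \<le> exp (exp v)}. 1 / real p)" for v
    unfolding A_def primes_below_eq
    by (subst sum.reindex) (auto intro: inj_on_subset[OF strict_mono_imp_inj_on[OF strict_mono_nth_prime]])
  obtain C where C: "\<And>N. 1 \<le> N \<Longrightarrow> ln (ln (real N + 1)) - C \<le> (\<Sum>p\<in>{p. prime p \<and> p \<le> N}. 1 / real p)"
    using sum_inverse_primes_ge by blast
  have lo: "v - C \<le> A v" if v: "0 \<le> v" for v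
  proof -
    define N where "N = nat \<lfloor>exp (exp v)\<rfloor>"
    have e1: "1 \<le> exp (exp v)" by simp
    then have N: "1 \<le> N" "real N \<le> exp (exp v)" "exp (exp v) \<le> real N + 1"
      unfolding N_def by linarith+
    have eq: "{p. prime p \<and> p \<le> N} = {p. prime p \<and> real p \<le> exp (exp v)}"
      unfolding N_def using e1 by (auto simp: le_nat_iff le_floor_iff)
    have "v = ln (ln (exp (exp v)))" by simp
    also have "\<dots> \<le> ln (ln (real N + 1))"
      using N by (intro ln_mono) auto
    finally show ?thesis using C[OF N(1)] unfolding A eq by linarith
  qed
  have up: "A v \<le> exp (1 / v) * ln (1 + v * exp v)" if v: "0 < v" for v
  proof -
    \<comment> \<open>Large enough for \<open>ln (1 + 1 / u)\<close> to be asymptotic to \<open>v\<close>, small enough for the factor \<open>exp (u * exp v)\<close>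
      to tend to 1.\<close>
    define u where "u = exp (- v) / v"
    have u: "0 < u" using v by (simp add: u_def)
    have "A v \<le> (\<Sum>p\<in>{p. prime p \<and> real p \<le> exp (exp v)}. exp (1 / v) * real p powr (-1 - u))"
      unfolding A
    proof (rule sum_mono)
      fix p assume p: "p \<in> {p. prime p \<and> real p \<le> exp (exp v)}"
      then have p0: "0 < real p" by (auto simp: prime_gt_0_nat)
      have "real p powr u \<le> exp (exp v) powr u" using p u by (intro powr_mono2) auto
      also have "\<dots> = exp (1 / v)" by (simp add: powr_def u_def exp_minus)
      finally have "real p powr u * real p powr (-1 - u) \<le> exp (1 / v) * real p powr (-1 - u)"
        by (intro mult_right_mono) auto
      moreover have "real p powr u * real p powr (-1 - u) = 1 / real p"
        using p0 by (simp add: powr_add[symmetric] powr_minus_divide)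
      ultimately show "1 / real p \<le> exp (1 / v) * real p powr (-1 - u)" by simp
    qed
    also have "\<dots> \<le> exp (1 / v) * ln (1 + 1 / u)"
      unfolding sum_distrib_left[symmetric]
      by (intro mult_left_mono sum_prime_powr_le u) (auto simp: primes_below_eq prime_nth_prime)
    also have "1 / u = v * exp v" by (simp add: u_def exp_minus divide_inverse)
    finally show ?thesis .
  qed
  have "((\<lambda>v. A v / v) \<longlongrightarrow> 1) at_top"
  proof (rule tendsto_sandwich)
    show "\<forall>\<^sub>F v in at_top. (v - C) / v \<le> A v / v"
      using eventually_gt_at_top[of 0] by eventually_elim (intro divide_right_mono lo, auto)
    show "\<forall>\<^sub>F v in at_top. A v / v \<le> (exp (1 / v) * ln (1 + v * exp v)) / v"
      using eventually_gt_at_top[of 0] by eventually_elim (intro divide_right_mono up, auto)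
    show "((\<lambda>v. (v - C) / v) \<longlongrightarrow> 1) at_top" by real_asymp
    show "((\<lambda>v::real. (exp (1 / v) * ln (1 + v * exp v)) / v) \<longlongrightarrow> 1) at_top" by real_asymp
  qed
  then show ?thesis by (simp add: A_def)
qed

section \<open>Dirichlet series over the primes with slowly growing partial sums\<close>

lemma abel_summation:
  fixes a w :: "nat \<Rightarrow> real"
  assumes "K \<le> n"
  shows "(\<Sum>k=K..<n. a k * w k) = (\<Sum>j<n. a j) * w n - (\<Sum>j<K. a j) * w K
     + (\<Sum>k=K..<n. (\<Sum>j<Suc k. a j) * (w k - w (Suc k)))"
  using assms by (induction n rule: dec_induct) (simp_all add: algebra_simps)

text \<open>Abel summation writes the weighted sum as a combination of partial sums whose coefficients are
  nonnegative and add up to \<open>w 0\<close>.\<close>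
lemma sum_decseq_weights_le:
  fixes a w :: "nat \<Rightarrow> real"
  assumes w: "decseq w" "\<And>k. 0 \<le> w k" "w 0 \<le> 1"
    and B: "0 \<le> B" "\<And>k. k \<le> K \<Longrightarrow> (\<Sum>j<k. a j) \<le> B"
  shows "(\<Sum>k<K. a k * w k) \<le> B"
proof -
  have "(\<Sum>k<K. a k * w k)
      = (\<Sum>j<K. a j) * w K + (\<Sum>k=0..<K. (\<Sum>j<Suc k. a j) * (w k - w (Suc k)))"
    using abel_summation[of 0 K a w] by (simp add: atLeast0LessThan)
  also have "\<dots> \<le> B * w K + (\<Sum>k=0..<K. B * (w k - w (Suc k)))"
  proof (intro add_mono sum_mono mult_right_mono)
    fix k assume "k \<in> {0..<K}"
    then show "(\<Sum>j<Suc k. a j) \<le> B" by (intro B(2)) simp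
    show "0 \<le> w k - w (Suc k)" using decseqD[OF w(1), of k "Suc k"] by simp
  qed (use w B in auto)
  also have "(\<Sum>k=0..<K. B * (w k - w (Suc k))) = B * (w 0 - w K)"
    unfolding sum_distrib_left[symmetric] atLeast0LessThan sum_lessThan_telescope' ..
  also have "B * w K + B * (w 0 - w K) = B * w 0" by (simp add: algebra_simps)
  also have "\<dots> \<le> B * 1" using w B by (intro mult_left_mono) auto
  finally show ?thesis by simp
qed

lemma decseq_nth_prime_powr: "0 \<le> s \<Longrightarrow> decseq (\<lambda>k. real (nth_prime k) powr (-s))"
  by (intro decseq_SucI powr_mono2')
     (auto simp: strict_mono_less_eq[OF strict_mono_nth_prime] nth_prime_pos[simplified])

lemma nth_prime_powr_le_1: "0 \<le> s \<Longrightarrow> real (nth_prime k) powr (-s) \<le> 1"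
  using powr_mono[of "-s" 0 "real (nth_prime k)"] nth_prime_gt_1[of k] by simp

text \<open>The coefficient \<open>a k\<close> belongs to the \<open>k\<close>-th prime, so that the series runs through the primes in
  increasing order.\<close>
definition prime_series :: "(nat \<Rightarrow> real) \<Rightarrow> real \<Rightarrow> real" where
  "prime_series a s = (\<Sum>k. a k * real (nth_prime k) powr (-s))"

text \<open>A growth far above that of the law of the iterated logarithm still gives convergence, continuity and
  bounds for the tails. The constant may depend on the sample point, so that the results apply to almost
  every realisation.\<close>
locale prime_partial_sums =
  fixes a :: "nat \<Rightarrow> real" and C :: real
  assumes growth: "\<And>k. \<bar>\<Sum>j<Suc k. a j\<bar> \<le> C * ln (real (nth_prime k))"
begin

lemma C_nonneg: "0 \<le> C"
proof -
  have "0 \<le> C * ln (real (nth_prime 0))" using growth[of 0] by linarith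
  moreover have "0 < ln (real (nth_prime 0))" using nth_prime_gt_1[of 0] by simp
  ultimately show ?thesis using zero_le_mult_iff[of C "ln (real (nth_prime 0))"] by linarith
qed

text \<open>Half of the decay of \<open>w = p powr (- s)\<close> absorbs the growth of the partial sums, since
  \<open>ln p \<le> (2 / s) * p powr (s / 2)\<close>. With \<open>v = p powr (- s / 2)\<close> the differences of \<open>w = v * v\<close> are at most
  \<open>2 * v\<close> times those of \<open>v\<close>, so what remains telescopes.\<close>
lemma tail_sum_bound:
  assumes s: "0 < s" and Kn: "K \<le> n"
  shows "\<bar>\<Sum>k=K..<n. a k * real (nth_prime k) powr (-s)\<bar> \<le> 6 * C / s * real (nth_prime K) powr (- s/2)"
proof -
  define G where "G = 2 * C / s"
  define q where "q k = real (nth_prime k)" for k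
  define w where "w k = q k powr (-s)" for k
  define v where "v k = q k powr (-s/2)" for k
  have q: "0 < q k" "1 < q k" for k unfolding q_def by (rule nth_prime_pos nth_prime_gt_1)+
  have G0: "0 \<le> G" using C_nonneg s by (simp add: G_def)
  have qmono: "q i \<le> q j" if "i \<le> j" for i j
    using that by (simp add: q_def strict_mono_less_eq[OF strict_mono_nth_prime])
  have v0: "0 < v k" for k using q[of k] by (simp add: v_def)
  have wv: "w k = v k * v k" for k
  proof -
    have "w k = q k powr (-s/2 + -s/2)" by (simp add: w_def)
    then show ?thesis by (simp only: powr_add v_def)
  qed
  have qv: "q k powr (s/2) * v k = 1" for k
  proof -
    have "q k powr (s/2) * v k = q k powr (s/2 + -s/2)" by (simp only: powr_add v_def)
    then show ?thesis using q[of k] by simp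
  qed
  have vmono: "v (Suc k) \<le> v k" for k
    unfolding v_def using q(1)[of k] s qmono[of k "Suc k"] by (intro powr_mono2') simp_all
  have T: "\<bar>\<Sum>j<Suc k. a j\<bar> \<le> G * q k powr (s/2)" for k
  proof -
    have "ln (q k) \<le> q k powr (s/2) / (s/2)" using q(2)[of k] s by (intro ln_powr_bound) simp_all
    then have "C * ln (q k) \<le> C * (q k powr (s/2) / (s/2))" by (rule mult_left_mono[OF _ C_nonneg])
    moreover have "C * (q k powr (s/2) / (s/2)) = G * q k powr (s/2)" by (simp add: G_def)
    moreover have "\<bar>\<Sum>j<Suc k. a j\<bar> \<le> C * ln (q k)" unfolding q_def by (rule growth)
    ultimately show ?thesis by linarith
  qed
  have T': "\<bar>\<Sum>j<k. a j\<bar> * w k \<le> G * v k" for k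
  proof -
    have "\<bar>\<Sum>j<k. a j\<bar> \<le> G * q k powr (s/2)"
    proof (cases k)
      case 0 then show ?thesis using G0 by simp
    next
      case (Suc i)
      have "q i powr (s/2) \<le> q k powr (s/2)" using q(1)[of i] s qmono[of i k] Suc by (intro powr_mono2) simp_all
      then have "G * q i powr (s/2) \<le> G * q k powr (s/2)" by (rule mult_left_mono[OF _ G0])
      then show ?thesis using T[of i] unfolding Suc by linarith
    qed
    then have "\<bar>\<Sum>j<k. a j\<bar> * w k \<le> (G * q k powr (s/2)) * w k"
      by (intro mult_right_mono) (simp_all add: w_def)
    also have "\<dots> = G * (q k powr (s/2) * v k) * v k" unfolding wv by simp
    finally show ?thesis unfolding qv by simp
  qed
  have D: "\<bar>(\<Sum>j<Suc k. a j) * (w k - w (Suc k))\<bar> \<le> 2 * G * (v k - v (Suc k))" for k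
  proof -
    have dv: "0 \<le> v k - v (Suc k)" using vmono[of k] by simp
    have "w k - w (Suc k) = (v k - v (Suc k)) * (v k + v (Suc k))" unfolding wv by (simp add: algebra_simps)
    moreover have "(v k - v (Suc k)) * (v k + v (Suc k)) \<le> (v k - v (Suc k)) * (2 * v k)"
      using vmono[of k] dv by (intro mult_left_mono) auto
    moreover have "0 \<le> (v k - v (Suc k)) * (v k + v (Suc k))"
      using dv v0[of k] v0[of "Suc k"] by (intro mult_nonneg_nonneg) auto
    ultimately have "\<bar>w k - w (Suc k)\<bar> \<le> (v k - v (Suc k)) * (2 * v k)" by linarith
    then have "\<bar>\<Sum>j<Suc k. a j\<bar> * \<bar>w k - w (Suc k)\<bar>
       \<le> (G * q k powr (s/2)) * ((v k - v (Suc k)) * (2 * v k))"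
      using T[of k] G0 by (intro mult_mono) auto
    also have "\<dots> = 2 * G * (v k - v (Suc k)) * (q k powr (s/2) * v k)" by (simp add: algebra_simps)
    finally show ?thesis unfolding qv abs_mult by simp
  qed
  have "\<bar>\<Sum>k=K..<n. a k * w k\<bar> \<le> \<bar>(\<Sum>j<n. a j) * w n\<bar> + \<bar>(\<Sum>j<K. a j) * w K\<bar>
     + \<bar>\<Sum>k=K..<n. (\<Sum>j<Suc k. a j) * (w k - w (Suc k))\<bar>"
    using abel_summation[OF Kn, of a w] by linarith
  also have "\<dots> \<le> G * v n + G * v K + (\<Sum>k=K..<n. 2 * G * (v k - v (Suc k)))"
  proof (intro add_mono)
    show "\<bar>(\<Sum>j<n. a j) * w n\<bar> \<le> G * v n" "\<bar>(\<Sum>j<K. a j) * w K\<bar> \<le> G * v K"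
      using T'[of n] T'[of K] by (simp_all add: abs_mult w_def)
    show "\<bar>\<Sum>k=K..<n. (\<Sum>j<Suc k. a j) * (w k - w (Suc k))\<bar> \<le> (\<Sum>k=K..<n. 2 * G * (v k - v (Suc k)))"
      by (rule order_trans[OF sum_abs]) (intro sum_mono D)
  qed
  also have "(\<Sum>k=K..<n. 2 * G * (v k - v (Suc k))) = 2 * G * (v K - v n)"
    unfolding sum_distrib_left[symmetric] using sum_Suc_diff'[OF Kn, of "\<lambda>k. - v k"] by simp
  also have "G * v n + G * v K + 2 * G * (v K - v n) \<le> 3 * G * v K"
    using mult_nonneg_nonneg[OF G0 less_imp_le[OF v0[of n]]] by (simp add: algebra_simps)
  finally show ?thesis by (simp add: w_def v_def q_def G_def)
qed

lemma nth_prime_powr_tendsto_0: "0 < s \<Longrightarrow> (\<lambda>k. c * real (nth_prime k) powr (- s)) \<longlonglongrightarrow> 0"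
proof -
  assume s: "0 < s"
  have "filterlim (\<lambda>k. real (nth_prime k)) at_top sequentially"
    by (rule filterlim_at_top_mono[OF filterlim_real_sequentially]) (simp add: le_nth_prime)
  with s have "(\<lambda>k. real (nth_prime k) powr (- s)) \<longlonglongrightarrow> 0" by (intro tendsto_neg_powr) auto
  then show ?thesis by (rule tendsto_mult_right_zero)
qed

lemma summable_prime_series:
  assumes s: "0 < s"
  shows "summable (\<lambda>k. a k * real (nth_prime k) powr (-s))"
  unfolding summable_Cauchy
proof (intro allI impI)
  fix e :: real assume e: "0 < e"
  have "(\<lambda>k. 6 * C / s * real (nth_prime k) powr (- (s/2))) \<longlonglongrightarrow> 0"
    using s by (intro nth_prime_powr_tendsto_0) simp
  then have "\<forall>\<^sub>F k in sequentially. 6 * C / s * real (nth_prime k) powr (- (s/2)) < e"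
    by (rule order_tendstoD) (rule e)
  then obtain N where N: "\<And>k. k \<ge> N \<Longrightarrow> 6 * C / s * real (nth_prime k) powr (- (s/2)) < e"
    unfolding eventually_sequentially by blast
  show "\<exists>N. \<forall>m\<ge>N. \<forall>n. norm (\<Sum>k=m..<n. a k * real (nth_prime k) powr (-s)) < e"
  proof (intro exI allI impI)
    fix m n assume m: "N \<le> m"
    show "norm (\<Sum>k=m..<n. a k * real (nth_prime k) powr (-s)) < e"
    proof (cases "m \<le> n")
      case True
      then show ?thesis using tail_sum_bound[OF s True] N[OF m] by simp
    qed (use e in simp)
  qed
qed

lemma prime_series_tail_bound:
  assumes s: "0 < s"
  shows "\<bar>prime_series a s - (\<Sum>k<K. a k * real (nth_prime k) powr (-s))\<bar> \<le> 6 * C / s * real (nth_prime K) powr (- s/2)"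
proof (rule LIMSEQ_le_const2)
  show "(\<lambda>n. \<bar>(\<Sum>k<n. a k * real (nth_prime k) powr (-s)) - (\<Sum>k<K. a k * real (nth_prime k) powr (-s))\<bar>)
    \<longlonglongrightarrow> \<bar>prime_series a s - (\<Sum>k<K. a k * real (nth_prime k) powr (-s))\<bar>"
    unfolding prime_series_def
    by (intro tendsto_rabs tendsto_diff tendsto_const summable_LIMSEQ summable_prime_series s)
  show "\<exists>N. \<forall>n\<ge>N. \<bar>(\<Sum>k<n. a k * real (nth_prime k) powr (-s)) - (\<Sum>k<K. a k * real (nth_prime k) powr (-s))\<bar>
     \<le> 6 * C / s * real (nth_prime K) powr (- s/2)"
  proof (intro exI allI impI)
    fix n assume n: "K \<le> n"
    have "(\<Sum>k<n. a k * real (nth_prime k) powr (-s)) - (\<Sum>k<K. a k * real (nth_prime k) powr (-s))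
      = (\<Sum>k=K..<n. a k * real (nth_prime k) powr (-s))"
      using sum_diff_nat_ivl[of 0 K n "\<lambda>k. a k * real (nth_prime k) powr (-s)"] n by (simp add: atLeast0LessThan)
    then show "\<bar>(\<Sum>k<n. a k * real (nth_prime k) powr (-s)) - (\<Sum>k<K. a k * real (nth_prime k) powr (-s))\<bar>
     \<le> 6 * C / s * real (nth_prime K) powr (- s/2)"
      using tail_sum_bound[OF s n] by simp
  qed
qed

text \<open>The bound for the tails is uniform as long as \<open>s\<close> stays away from 0.\<close>
lemma continuous_on_prime_series: "continuous_on {0<..} (prime_series a)"
proof -
  have "isCont (prime_series a) s" if s: "0 < s" for s
  proof -
    define c where "c = s / 2"
    have c: "0 < c" "c < s" using s by (auto simp: c_def)
    have "continuous_on {c<..} (prime_series a)"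
    proof (rule uniform_limit_theorem)
      show "\<forall>\<^sub>F n in sequentially. continuous_on {c<..} (\<lambda>s. \<Sum>k<n. a k * real (nth_prime k) powr (-s))"
        using nth_prime_pos by (intro always_eventually allI continuous_intros) (auto dest: less_imp_neq)
      show "uniform_limit {c<..} (\<lambda>n s. \<Sum>k<n. a k * real (nth_prime k) powr (-s)) (prime_series a) sequentially"
      proof (rule uniform_limitI)
        fix e :: real assume e: "0 < e"
        have "(\<lambda>k. 6 * C / c * real (nth_prime k) powr (- (c/2))) \<longlonglongrightarrow> 0"
          using c by (intro nth_prime_powr_tendsto_0) simp
        then have "\<forall>\<^sub>F k in sequentially. 6 * C / c * real (nth_prime k) powr (- (c/2)) < e"
          by (rule order_tendstoD) (rule e)
        then show "\<forall>\<^sub>F n in sequentially. \<forall>x\<in>{c<..}.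
           dist (\<Sum>k<n. a k * real (nth_prime k) powr (-x)) (prime_series a x) < e"
        proof eventually_elim
          case (elim n)
          show ?case
          proof
            fix x assume x: "x \<in> {c<..}"
            have "6 * C / x * real (nth_prime n) powr (- x/2) \<le> 6 * C / c * real (nth_prime n) powr (- (c/2))"
              using x c C_nonneg nth_prime_gt_1[of n] by (intro mult_mono divide_left_mono powr_mono) auto
            then show "dist (\<Sum>k<n. a k * real (nth_prime k) powr (-x)) (prime_series a x) < e"
              using prime_series_tail_bound[of x n] x c elim by (simp add: dist_real_def abs_minus_commute)
          qed
        qed
      qed
    qed simp
    then show ?thesis using c by (simp add: continuous_on_eq_continuous_at)
  qed
  then show ?thesis by (simp add: continuous_at_imp_continuous_on)
qed

end

lemma partial_sums_abs_bound:
  assumes up: "\<forall>\<^sub>F v in at_top. \<forall>k\<le>prime_count_loglog v. (\<Sum>j<k. a j) \<le> (1 + 1) * \<sigma> * lil_scale v"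
    and lo: "\<forall>\<^sub>F v in at_top. \<forall>k\<le>prime_count_loglog v. (\<Sum>j<k. - a j) \<le> (1 + 1) * \<sigma> * lil_scale v"
  shows "\<forall>\<^sub>F v in at_top. \<forall>k\<le>prime_count_loglog v. \<bar>\<Sum>j<k. a j\<bar> \<le> 2 * \<sigma> * lil_scale v"
  using up lo
proof eventually_elim
  case (elim v)
  show ?case
  proof (intro allI impI)
    fix k assume k: "k \<le> prime_count_loglog v"
    have "(\<Sum>j<k. a j) \<le> (1 + 1) * \<sigma> * lil_scale v" using elim(1) k by blast
    moreover have "- (\<Sum>j<k. a j) \<le> (1 + 1) * \<sigma> * lil_scale v"
      using elim(2) k unfolding sum_negf by blast
    ultimately show "\<bar>\<Sum>j<k. a j\<bar> \<le> 2 * \<sigma> * lil_scale v" by simp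
  qed
qed

text \<open>For \<open>l' = (2 / \<epsilon>\<^sup>2) * l\<close> the block at \<open>l'\<close> starts where the one at \<open>l\<close> ends, while the primes
  left out before it carry only about the fraction \<open>\<epsilon>\<^sup>2\<close> of the variance.\<close>
definition prime_block :: "real \<Rightarrow> real \<Rightarrow> nat set" where
  "prime_block \<epsilon> l = {prime_count_loglog (\<epsilon>\<^sup>2 * l)..<prime_count_loglog (2 * l)}"

lemma block_ratio_gt_1:
  fixes \<epsilon> :: real
  assumes "0 < \<epsilon>" "\<epsilon> \<le> 1/8"
  shows "1 < 2 / \<epsilon>\<^sup>2"
proof -
  have "\<epsilon>\<^sup>2 \<le> 1" using assms by (simp add: power_le_one)
  then show ?thesis using assms by (simp add: less_divide_eq)
qed

text \<open>Since \<open>lil_scale v \<le> exp v\<close> eventually, the hypothesis with \<open>v = ln (ln p)\<close> gives the bound for all large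
  primes; the constant is enlarged to cover the finitely many others.\<close>
lemma growth_constant:
  fixes a :: "nat \<Rightarrow> real"
  assumes ev: "\<forall>\<^sub>F v in at_top. \<forall>k\<le>prime_count_loglog v. \<bar>\<Sum>j<k. a j\<bar> \<le> c * lil_scale v" and c: "0 \<le> c"
  obtains C where "prime_partial_sums a C"
proof -
  have "\<forall>\<^sub>F v in at_top. lil_scale v \<le> exp v" unfolding lil_scale_def by real_asymp
  with ev have "\<forall>\<^sub>F v in at_top. \<forall>k\<le>prime_count_loglog v. \<bar>\<Sum>j<k. a j\<bar> \<le> c * exp v"
  proof eventually_elim
    case (elim v)
    have "c * lil_scale v \<le> c * exp v" using elim(2) c by (rule mult_left_mono)
    then show ?case using elim(1) by force
  qed
  then obtain v0 where v0: "\<And>v k. v0 \<le> v \<Longrightarrow> k \<le> prime_count_loglog v \<Longrightarrow> \<bar>\<Sum>j<k. a j\<bar> \<le> c * exp v"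
    unfolding eventually_at_top_linorder by blast
  define C where "C = c + (\<Sum>k<prime_count_loglog v0. \<bar>\<Sum>j<Suc k. a j\<bar> / ln (real (nth_prime k)))"
  have ln_pos: "0 < ln (real (nth_prime k))" for k using nth_prime_gt_1[of k] by simp
  have sum0: "0 \<le> (\<Sum>k<prime_count_loglog v0. \<bar>\<Sum>j<Suc k. a j\<bar> / ln (real (nth_prime k)))"
    using ln_pos by (intro sum_nonneg divide_nonneg_nonneg) (auto intro: less_imp_le)
  have "\<bar>\<Sum>j<Suc k. a j\<bar> \<le> C * ln (real (nth_prime k))" for k
  proof (cases "k < prime_count_loglog v0")
    case True
    have "\<bar>\<Sum>j<Suc k. a j\<bar> / ln (real (nth_prime k))
      \<le> (\<Sum>k<prime_count_loglog v0. \<bar>\<Sum>j<Suc k. a j\<bar> / ln (real (nth_prime k)))"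
      using True ln_pos by (intro member_le_sum divide_nonneg_nonneg) (auto intro: less_imp_le)
    then have "\<bar>\<Sum>j<Suc k. a j\<bar> / ln (real (nth_prime k)) \<le> C" using c by (simp add: C_def)
    then show ?thesis using ln_pos[of k] by (simp only: pos_divide_le_eq)
  next
    case False
    define v where "v = ln (ln (real (nth_prime k)))"
    have "k < prime_count_loglog v" unfolding less_prime_count_loglog_iff ln_ln_nth_prime_le_iff[symmetric] v_def ..
    moreover have "v0 \<le> v"
      using False unfolding less_prime_count_loglog_iff ln_ln_nth_prime_le_iff[symmetric] v_def by simp
    ultimately have "\<bar>\<Sum>j<Suc k. a j\<bar> \<le> c * exp v" using v0[of v "Suc k"] by simp
    also have "exp v = ln (real (nth_prime k))" unfolding v_def using ln_pos[of k] by simp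
    also have "c * ln (real (nth_prime k)) \<le> C * ln (real (nth_prime k))"
      using ln_pos[of k] sum0 by (intro mult_right_mono) (auto simp: C_def)
    finally show ?thesis .
  qed
  then have "prime_partial_sums a C" by unfold_locales
  then show thesis by (rule that)
qed

context prime_partial_sums
begin

text \<open>For \<open>s = exp (- l)\<close> and \<open>p \<ge> exp (exp ((1 + h) * l))\<close>, the factor \<open>p powr (- s / 2)\<close> is doubly
  exponentially small in \<open>l\<close>.\<close>
lemma prime_series_tail_exp_bound:
  assumes h: "0 < h"
  shows "\<bar>prime_series a (exp (-l)) - (\<Sum>k<prime_count_loglog ((1 + h) * l). a k * real (nth_prime k) powr (-exp (-l)))\<bar>
     \<le> 6 * C * exp l * exp (- exp (h * l) / 2)"
proof -
  define K where "K = prime_count_loglog ((1 + h) * l)"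
  have "\<not> K < prime_count_loglog ((1 + h) * l)" by (simp add: K_def)
  then have K: "exp (exp ((1 + h) * l)) \<le> real (nth_prime K)" unfolding less_prime_count_loglog_iff by simp
  have "real (nth_prime K) powr (- exp (-l)/2) \<le> exp (exp ((1 + h) * l)) powr (- exp (-l)/2)"
    using K by (intro powr_mono2') auto
  also have "\<dots> = exp (- (exp (-l) * exp ((1 + h) * l)) / 2)" by (simp add: powr_def)
  also have "exp (-l) * exp ((1 + h) * l) = exp (h * l)" unfolding exp_add[symmetric] by (simp add: algebra_simps)
  finally have "real (nth_prime K) powr (- exp (-l)/2) \<le> exp (- exp (h * l) / 2)" .
  then have "6 * C / exp (-l) * real (nth_prime K) powr (- exp (-l)/2) \<le> 6 * C / exp (-l) * exp (- exp (h * l) / 2)"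
    using C_nonneg by (intro mult_left_mono) auto
  also have "\<dots> = 6 * C * exp l * exp (- exp (h * l) / 2)" by (simp add: exp_minus field_simps)
  finally show ?thesis using prime_series_tail_bound[of "exp (-l)" K] unfolding K_def by simp
qed

lemma prime_series_tail_exp_small:
  assumes h: "0 < h" and e: "0 < e"
  shows "\<forall>\<^sub>F l in at_top. \<bar>prime_series a (exp (-l)) - (\<Sum>k<prime_count_loglog ((1 + h) * l). a k * real (nth_prime k) powr (-exp (-l)))\<bar>
     \<le> e * lil_scale l"
proof -
  have "((\<lambda>l. exp l * exp (- exp (h * l) / 2)) \<longlongrightarrow> 0) at_top" using h by real_asymp
  from tendsto_mult_right_zero[OF this, of "6 * C"]
  have "((\<lambda>l. 6 * C * exp l * exp (- exp (h * l) / 2)) \<longlongrightarrow> 0) at_top" by (simp only: mult.assoc)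
  then have "\<forall>\<^sub>F l in at_top. 6 * C * exp l * exp (- exp (h * l) / 2) < e"
    by (rule order_tendstoD) (rule e)
  moreover have "\<forall>\<^sub>F l in at_top. 1 \<le> lil_scale l"
    using lil_scale_at_top unfolding filterlim_at_top by auto
  ultimately show ?thesis
  proof eventually_elim
    case (elim l)
    have "e * 1 \<le> e * lil_scale l" using elim(2) e by (intro mult_left_mono) auto
    then show ?case using elim(1) prime_series_tail_exp_bound[OF h, of l] by linarith
  qed
qed

lemma decseq_weights:
  "decseq (\<lambda>k. real (nth_prime k) powr (- exp (-l)))" "0 \<le> real (nth_prime k) powr (- exp (-l))"
  "real (nth_prime 0) powr (- exp (-l)) \<le> 1"
  by (rule decseq_nth_prime_powr nth_prime_powr_le_1 powr_ge_zero; simp)+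

text \<open>Up to a negligible tail, only the primes with \<open>ln (ln p) \<le> (1 + h) * l\<close> matter. Their weighted sum is
  bounded by the maximum of the partial sums, hence by \<open>(1 + h) * \<sigma> * lil_scale ((1 + h) * l)\<close>, and
  \<open>lil_scale ((1 + h) * l)\<close> is asymptotic to \<open>sqrt (1 + h) * lil_scale l\<close>.\<close>
lemma prime_series_upper:
  assumes T: "\<And>\<epsilon>. 0 < \<epsilon> \<Longrightarrow> \<forall>\<^sub>F v in at_top. \<forall>k\<le>prime_count_loglog v. (\<Sum>j<k. a j) \<le> (1 + \<epsilon>) * \<sigma> * lil_scale v"
    and s: "0 < \<sigma>" and e: "0 < \<epsilon>"
  shows "\<forall>\<^sub>F l in at_top. prime_series a (exp (-l)) \<le> (1 + \<epsilon>) * \<sigma> * lil_scale l"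
proof -
  define h where "h = min 1 \<epsilon> / 4"
  have h: "0 < h" "h \<le> 1" "4 * h \<le> \<epsilon>" using e by (auto simp: h_def)
  have lim: "filterlim (\<lambda>l. (1 + h) * l) at_top at_top" using h by real_asymp
  have "sqrt (1 + h) < 1 + h" using h by (intro real_less_lsqrt) (simp_all add: power2_eq_square)
  then have "\<forall>\<^sub>F l in at_top. lil_scale ((1 + h) * l) / lil_scale l < 1 + h"
    using order_tendstoD(2)[OF lil_scale_scale[of "1 + h"]] h by simp
  moreover note eventually_lil_scale_pos
  moreover have "\<forall>\<^sub>F l in at_top. 0 < lil_scale ((1 + h) * l)"
    using filterlim_compose[OF lil_scale_at_top lim] unfolding filterlim_at_top_dense by auto
  moreover have "\<forall>\<^sub>F l in at_top. \<forall>k\<le>prime_count_loglog ((1 + h) * l). (\<Sum>j<k. a j) \<le> (1 + h) * \<sigma> * lil_scale ((1 + h) * l)"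
    using filterlim_iff[THEN iffD1, OF lim, rule_format, OF T[OF h(1)]] .
  moreover have "\<forall>\<^sub>F l in at_top. \<bar>prime_series a (exp (-l)) - (\<Sum>k<prime_count_loglog ((1 + h) * l). a k * real (nth_prime k) powr (-exp (-l)))\<bar>
     \<le> (h * \<sigma>) * lil_scale l"
    using h s by (intro prime_series_tail_exp_small) auto
  ultimately show ?thesis
  proof eventually_elim
    case (elim l)
    have "(\<Sum>k<prime_count_loglog ((1 + h) * l). a k * real (nth_prime k) powr (-exp (-l)))
       \<le> (1 + h) * \<sigma> * lil_scale ((1 + h) * l)"
      using elim(3,4) h s by (intro sum_decseq_weights_le decseq_weights) auto
    also have "\<dots> \<le> (1 + h) * \<sigma> * ((1 + h) * lil_scale l)"
      using elim(1,2) h s by (intro mult_left_mono) (auto simp: pos_divide_less_eq)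
    finally have "prime_series a (exp (-l)) \<le> (1 + h) * \<sigma> * ((1 + h) * lil_scale l) + (h * \<sigma>) * lil_scale l"
      using elim(5) by linarith
    also have "\<dots> = (1 + 3 * h + h * h) * (\<sigma> * lil_scale l)" by (simp add: algebra_simps)
    also have "\<dots> \<le> (1 + \<epsilon>) * (\<sigma> * lil_scale l)"
    proof (rule mult_right_mono)
      have "h * h \<le> h * 1" using h by (intro mult_left_mono) auto
      then show "1 + 3 * h + h * h \<le> 1 + \<epsilon>" using h by linarith
    qed (use elim(2) s in simp)
    finally show ?case by (simp add: mult.assoc)
  qed
qed

text \<open>The primes before the block satisfy \<open>ln (ln p) \<le> \<epsilon>\<^sup>2 * l\<close>, so their contribution is at most
  \<open>2 * \<sigma> * lil_scale (\<epsilon>\<^sup>2 * l)\<close>, asymptotically \<open>2 * \<epsilon> * \<sigma> * lil_scale l\<close>. The primes after the block form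
  a negligible tail.\<close>
lemma prime_series_lower:
  assumes T: "\<forall>\<^sub>F v in at_top. \<forall>k\<le>prime_count_loglog v. \<bar>\<Sum>j<k. a j\<bar> \<le> 2 * \<sigma> * lil_scale v"
    and s: "0 < \<sigma>" and e: "0 < \<epsilon>" "\<epsilon> \<le> 1/8"
    and l: "filterlim l at_top sequentially"
    and block: "\<exists>\<^sub>\<infinity>n. c * \<sigma> * lil_scale (l n) \<le>
       (\<Sum>k\<in>prime_block \<epsilon> (l n). a k * real (nth_prime k) powr (-exp (-l n)))"
  shows "\<exists>\<^sub>\<infinity>n. (c - 5 * \<epsilon>) * \<sigma> * lil_scale (l n) \<le> prime_series a (exp (- l n))"
proof -
  have lim: "filterlim (\<lambda>l. \<epsilon>\<^sup>2 * l) at_top at_top" using e by real_asymp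
  have "sqrt (\<epsilon>\<^sup>2) < 2 * \<epsilon>" using e by simp
  then have "\<forall>\<^sub>F l in at_top. lil_scale (\<epsilon>\<^sup>2 * l) / lil_scale l < 2 * \<epsilon>"
    using order_tendstoD(2)[OF lil_scale_scale[of "\<epsilon>\<^sup>2"]] e by simp
  moreover note eventually_lil_scale_pos
  moreover have "\<forall>\<^sub>F l in at_top. 0 < lil_scale (\<epsilon>\<^sup>2 * l)"
    using filterlim_compose[OF lil_scale_at_top lim] unfolding filterlim_at_top_dense by auto
  moreover have "\<forall>\<^sub>F l in at_top. \<forall>k\<le>prime_count_loglog (\<epsilon>\<^sup>2 * l). \<bar>\<Sum>j<k. a j\<bar> \<le> 2 * \<sigma> * lil_scale (\<epsilon>\<^sup>2 * l)"
    using filterlim_iff[THEN iffD1, OF lim, rule_format, OF T] .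
  moreover have "\<forall>\<^sub>F l in at_top. \<bar>prime_series a (exp (-l)) - (\<Sum>k<prime_count_loglog ((1 + 1) * l). a k * real (nth_prime k) powr (-exp (-l)))\<bar>
     \<le> (\<epsilon> * \<sigma>) * lil_scale l"
    using e s by (intro prime_series_tail_exp_small) auto
  moreover have "\<forall>\<^sub>F l::real in at_top. 0 \<le> l" by (rule eventually_ge_at_top)
  ultimately have "\<forall>\<^sub>F l in at_top. (\<Sum>k\<in>prime_block \<epsilon> l. a k * real (nth_prime k) powr (-exp (-l)))
     - 5 * \<epsilon> * \<sigma> * lil_scale l \<le> prime_series a (exp (-l))"
  proof eventually_elim
    case (elim l)
    define w where "w k = real (nth_prime k) powr (-exp (-l))" for k
    define K where "K = prime_count_loglog (\<epsilon>\<^sup>2 * l)"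
    define N where "N = prime_count_loglog (2 * l)"
    have "\<epsilon>\<^sup>2 \<le> 1" using e by (simp add: power_le_one)
    then have "\<epsilon>\<^sup>2 * l \<le> 2 * l" using elim(6) by (intro mult_right_mono) auto
    then have KN: "K \<le> N" unfolding K_def N_def by (rule prime_count_mono)
    have "- (\<Sum>k<K. a k * w k) = (\<Sum>k<K. (- a k) * w k)" by (simp add: sum_negf)
    also have "\<dots> \<le> 2 * \<sigma> * lil_scale (\<epsilon>\<^sup>2 * l)"
      unfolding w_def
    proof (intro sum_decseq_weights_le decseq_weights)
      fix k assume "k \<le> K"
      then have "\<bar>\<Sum>j<k. a j\<bar> \<le> 2 * \<sigma> * lil_scale (\<epsilon>\<^sup>2 * l)" using elim(4) by (simp add: K_def)
      then show "(\<Sum>j<k. - a j) \<le> 2 * \<sigma> * lil_scale (\<epsilon>\<^sup>2 * l)" by (simp add: sum_negf)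
    qed (use elim(3) s in auto)
    also have "\<dots> \<le> 2 * \<sigma> * (2 * \<epsilon> * lil_scale l)"
      using elim(1,2) s by (intro mult_left_mono) (auto simp: pos_divide_less_eq)
    finally have low: "- (\<Sum>k<K. a k * w k) \<le> 4 * \<epsilon> * \<sigma> * lil_scale l" by (simp add: mult_ac)
    have "(\<Sum>k<N. a k * w k) = (\<Sum>k<K. a k * w k) + (\<Sum>k=K..<N. a k * w k)"
      using sum.atLeastLessThan_concat[of 0 K N "\<lambda>k. a k * w k"] KN by (simp add: atLeast0LessThan)
    moreover have "\<bar>prime_series a (exp (-l)) - (\<Sum>k<N. a k * w k)\<bar> \<le> \<epsilon> * \<sigma> * lil_scale l"
      using elim(5) by (simp add: N_def w_def)
    ultimately have "(\<Sum>k=K..<N. a k * w k) - 5 * \<epsilon> * \<sigma> * lil_scale l \<le> prime_series a (exp (-l))"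
      using low by linarith
    then show ?case by (simp add: prime_block_def K_def N_def w_def)
  qed
  from filterlim_iff[THEN iffD1, OF l, rule_format, OF this]
  have "\<forall>\<^sub>F n in sequentially. (\<Sum>k\<in>prime_block \<epsilon> (l n). a k * real (nth_prime k) powr (-exp (-l n)))
     - 5 * \<epsilon> * \<sigma> * lil_scale (l n) \<le> prime_series a (exp (-l n))" .
  then have "\<forall>\<^sub>\<infinity>n. (\<Sum>k\<in>prime_block \<epsilon> (l n). a k * real (nth_prime k) powr (-exp (-l n)))
     - 5 * \<epsilon> * \<sigma> * lil_scale (l n) \<le> prime_series a (exp (-l n))" by (simp add: cofinite_eq_sequentially)
  with block have "\<exists>\<^sub>\<infinity>n. c * \<sigma> * lil_scale (l n) \<le>
       (\<Sum>k\<in>prime_block \<epsilon> (l n). a k * real (nth_prime k) powr (-exp (-l n)))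
     \<and> (\<Sum>k\<in>prime_block \<epsilon> (l n). a k * real (nth_prime k) powr (-exp (-l n)))
     - 5 * \<epsilon> * \<sigma> * lil_scale (l n) \<le> prime_series a (exp (-l n))"
    by (rule INFM_conjI)
  then show ?thesis by (rule INFM_mono) (auto simp: left_diff_distrib)
qed

end

lemma sum_primes_eq_prime_series:
  "sum_primes (\<lambda>p. x p / real p powr (1 / 2 + s)) = prime_series (\<lambda>k. x (nth_prime k) / sqrt (real (nth_prime k))) s"
proof -
  have "x (nth_prime k) / real (nth_prime k) powr (1 / 2 + s)
     = x (nth_prime k) / sqrt (real (nth_prime k)) * real (nth_prime k) powr (-s)" for k
  proof -
    have "real (nth_prime k) powr (1 / 2 + s) = sqrt (real (nth_prime k)) * real (nth_prime k) powr s"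
      using nth_prime_pos[of k] by (simp only: powr_add) (simp add: powr_half_sqrt)
    then show ?thesis by (simp add: powr_minus_divide)
  qed
  then show ?thesis unfolding sum_primes_def prime_series_def nth_prime_def[symmetric] by simp
qed

section \<open>From one-sided bounds to limit points\<close>

text \<open>Arbitrarily close to 0 the function takes values near 1 and near -1, hence by continuity all values in
  between.\<close>
lemma limit_points_0_eq_interval:
  fixes h :: "real \<Rightarrow> real"
  assumes r: "0 < r" and cont: "continuous_on {0<..<r} h"
    and up: "\<And>e. 0 < e \<Longrightarrow> \<forall>\<^sub>F s in at_right 0. h s \<le> 1 + e"
    and lo: "\<And>e. 0 < e \<Longrightarrow> \<forall>\<^sub>F s in at_right 0. - h s \<le> 1 + e"
    and fup: "\<And>e. 0 < e \<Longrightarrow> \<exists>\<^sub>F s in at_right 0. 1 - e \<le> h s"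
    and flo: "\<And>e. 0 < e \<Longrightarrow> \<exists>\<^sub>F s in at_right 0. 1 - e \<le> - h s"
  shows "limit_points_0 {0<..<r} h = {-1..1}"
proof (intro equalityI subsetI)
  fix y assume "y \<in> limit_points_0 {0<..<r} h"
  then obtain t where t: "\<And>n. t n \<in> {0<..<r}" "t \<longlonglongrightarrow> 0" "(\<lambda>n. h (t n)) \<longlonglongrightarrow> y"
    by (auto simp: limit_points_0_def)
  have tr: "filterlim t (at_right 0) sequentially"
    using t by (intro tendsto_imp_filterlim_at_right) auto
  have "y \<le> 1 + e" if e: "0 < e" for e
    using filterlim_iff[THEN iffD1, OF tr, rule_format, OF up[OF e]]
    by (intro tendsto_upperbound[OF t(3)]) auto
  moreover have "- y \<le> 1 + e" if e: "0 < e" for e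
    using filterlim_iff[THEN iffD1, OF tr, rule_format, OF lo[OF e]]
    by (intro tendsto_upperbound[OF tendsto_minus[OF t(3)]]) auto
  ultimately show "y \<in> {-1..1}"
    using field_le_epsilon[of y 1] field_le_epsilon[of "- y" 1] by auto
next
  fix y :: real assume y: "y \<in> {-1..1}"
  have ex: "\<exists>s. 0 < s \<and> s < d \<and> P s" if "\<exists>\<^sub>F s in at_right 0. P s" "0 < d" for P and d :: real
    using that unfolding frequently_def eventually_at_right_field by (meson order.strict_trans)
  have near: "\<exists>s. 0 < s \<and> s < r \<and> s < e \<and> \<bar>h s - y\<bar> \<le> e" if e: "0 < e" "e \<le> 1" for e
  proof -
    obtain s1 where s1: "0 < s1" "s1 < min r e" "1 - e \<le> h s1" using ex[OF fup[OF e(1)], of "min r e"] e r by auto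
    obtain s2 where s2: "0 < s2" "s2 < min r e" "1 - e \<le> - h s2" using ex[OF flo[OF e(1)], of "min r e"] e r by auto
    \<comment> \<open>The point of the guaranteed range of \<open>h\<close> that is nearest to \<open>y\<close>.\<close>
    define z where "z = max (-1 + e) (min (1 - e) y)"
    have z: "\<bar>z - y\<bar> \<le> e" "h s2 \<le> z" "z \<le> h s1" using y e s1 s2 by (auto simp: z_def max_def min_def)
    have sub: "closed_segment s2 s1 \<subseteq> {0<..<min r e}"
      using s1 s2 by (intro closed_segment_subset) (auto simp: convex_real_interval)
    have "\<exists>x\<in>closed_segment s2 s1. h x = z"
    proof (rule IVT'_closed_segment_real)
      show "z \<in> closed_segment (h s2) (h s1)" using z(2,3) by (simp add: closed_segment_eq_real_ivl)
      show "continuous_on (closed_segment s2 s1) h"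
        by (rule continuous_on_subset[OF cont]) (use sub in auto)
    qed
    then obtain x where "x \<in> {0<..<min r e}" "h x = z" using sub by blast
    then show ?thesis using z by (intro exI[of _ x]) auto
  qed
  have "\<exists>s. 0 < s \<and> s < r \<and> s < 1 / (real n + 1) \<and> \<bar>h s - y\<bar> \<le> 1 / (real n + 1)" for n
    by (rule near) auto
  then obtain t where t: "\<And>n. 0 < t n \<and> t n < r \<and> t n < 1 / (real n + 1) \<and> \<bar>h (t n) - y\<bar> \<le> 1 / (real n + 1)"
    by metis
  have z: "(\<lambda>n. 1 / (real n + 1)) \<longlonglongrightarrow> 0"
    using LIMSEQ_inverse_real_of_nat by (simp add: inverse_eq_divide add.commute)
  have "t \<longlonglongrightarrow> 0"
    by (rule tendsto_sandwich[OF _ _ tendsto_const z]) (use t in \<open>auto intro!: always_eventually less_imp_le\<close>)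
  moreover have "(\<lambda>n. h (t n) - y) \<longlonglongrightarrow> 0"
    by (rule Lim_null_comparison[OF _ z]) (use t in \<open>auto intro!: always_eventually\<close>)
  then have "(\<lambda>n. h (t n)) \<longlonglongrightarrow> y" by (rule LIM_zero_cancel)
  ultimately show "y \<in> limit_points_0 {0<..<r} h" using t by (auto simp: limit_points_0_def)
qed

lemma Limsup_eqI_frequently:
  fixes g :: "'a \<Rightarrow> real"
  assumes up: "\<And>e. 0 < e \<Longrightarrow> \<forall>\<^sub>F s in F. g s \<le> c + e"
    and fup: "\<And>e. 0 < e \<Longrightarrow> \<exists>\<^sub>F s in F. c - e \<le> g s"
  shows "Limsup F (\<lambda>s. ereal (g s)) = ereal c"
proof (rule antisym)
  show "Limsup F (\<lambda>s. ereal (g s)) \<le> ereal c"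
  proof (rule ccontr)
    assume "\<not> Limsup F (\<lambda>s. ereal (g s)) \<le> ereal c"
    then obtain b where b: "ereal c < ereal b" "ereal b < Limsup F (\<lambda>s. ereal (g s))"
      using ereal_dense2[of "ereal c" "Limsup F (\<lambda>s. ereal (g s))"] by (auto simp: not_le)
    have "\<forall>\<^sub>F s in F. ereal (g s) \<le> ereal b" using up[of "b - c"] b(1) by simp
    then have "Limsup F (\<lambda>s. ereal (g s)) \<le> ereal b" by (rule Limsup_bounded)
    then show False using b(2) by simp
  qed
  show "ereal c \<le> Limsup F (\<lambda>s. ereal (g s))"
  proof (rule ccontr)
    assume "\<not> ereal c \<le> Limsup F (\<lambda>s. ereal (g s))"
    then obtain b where b: "Limsup F (\<lambda>s. ereal (g s)) < ereal b" "ereal b < ereal c"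
      using ereal_dense2[of "Limsup F (\<lambda>s. ereal (g s))" "ereal c"] by (auto simp: not_le)
    have "\<forall>\<^sub>F s in F. ereal (g s) < ereal b"
      using Limsup_le_iff[THEN iffD1, OF order.refl, rule_format, OF b(1)] .
    then have "\<not> (\<exists>\<^sub>F s in F. c - (c - b) \<le> g s)" by (simp add: frequently_def not_le)
    then show False using fup[of "c - b"] b(2) by simp
  qed
qed

lemma Limsup_scale_eqI_frequently:
  fixes h :: "'a \<Rightarrow> real"
  assumes c: "0 < c"
    and up: "\<And>e. 0 < e \<Longrightarrow> \<forall>\<^sub>F s in F. h s \<le> 1 + e"
    and fup: "\<And>e. 0 < e \<Longrightarrow> \<exists>\<^sub>F s in F. 1 - e \<le> h s"
  shows "Limsup F (\<lambda>s. ereal (c * h s)) = ereal c"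
proof (rule Limsup_eqI_frequently)
  fix e :: real assume e: "0 < e"
  then have d: "0 < e / c" using c by simp
  show "\<forall>\<^sub>F s in F. c * h s \<le> c + e"
    using up[OF d] by eventually_elim (use c in \<open>simp add: field_simps\<close>)
  show "\<exists>\<^sub>F s in F. c - e \<le> c * h s"
    using fup[OF d] by (rule frequently_elim1) (use c in \<open>simp add: field_simps\<close>)
qed

lemma eventually_at_right_0_exp: "(\<forall>\<^sub>F s::real in at_right 0. P s) \<longleftrightarrow> (\<forall>\<^sub>F l in at_top. P (exp (-l)))"
proof
  assume "\<forall>\<^sub>F s::real in at_right 0. P s"
  moreover have "filterlim (\<lambda>l::real. exp (-l)) (at_right 0) at_top" by real_asymp
  ultimately show "\<forall>\<^sub>F l in at_top. P (exp (-l))" unfolding filterlim_iff by blast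
next
  assume ev: "\<forall>\<^sub>F l in at_top. P (exp (-l))"
  have "filterlim (\<lambda>s::real. ln (1 / s)) at_top (at_right 0)" by real_asymp
  with ev have "\<forall>\<^sub>F s in at_right 0. P (exp (- ln (1 / s)))" unfolding filterlim_iff by blast
  moreover have "\<forall>\<^sub>F s::real in at_right 0. 0 < s" by (simp add: eventually_at_right_less)
  ultimately show "\<forall>\<^sub>F s in at_right 0. P s" by eventually_elim (simp add: ln_div)
qed

lemma frequently_at_right_0_exp: "(\<exists>\<^sub>F s::real in at_right 0. P s) \<longleftrightarrow> (\<exists>\<^sub>F l in at_top. P (exp (-l)))"
  unfolding frequently_def eventually_at_right_0_exp ..

text \<open>The substitution \<open>s = exp (- l)\<close> turns both normalisations into multiples of \<open>1 / (\<sigma> * lil_scale l)\<close>; they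
  differ by the factor \<open>sqrt 2 * \<sigma>\<close>.\<close>
lemma lil_limits:
  fixes X :: "real \<Rightarrow> real"
  assumes s: "0 < \<sigma>" and cont: "continuous_on {0<..} X"
    and up: "\<And>e. 0 < e \<Longrightarrow> \<forall>\<^sub>F l in at_top. X (exp (-l)) \<le> (1 + e) * \<sigma> * lil_scale l"
    and lo: "\<And>e. 0 < e \<Longrightarrow> \<forall>\<^sub>F l in at_top. - X (exp (-l)) \<le> (1 + e) * \<sigma> * lil_scale l"
    and fup: "\<And>e. 0 < e \<Longrightarrow> \<exists>\<^sub>F l in at_top. (1 - e) * \<sigma> * lil_scale l \<le> X (exp (-l))"
    and flo: "\<And>e. 0 < e \<Longrightarrow> \<exists>\<^sub>F l in at_top. (1 - e) * \<sigma> * lil_scale l \<le> - X (exp (-l))"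
  defines "h \<equiv> (\<lambda>s. sqrt (1 / (2 * \<sigma>\<^sup>2 * ln (1 / s) * ln (ln (ln (1 / s))))) * X s)"
    and "g \<equiv> (\<lambda>s. sqrt (1 / (ln (1 / s) * ln (ln (ln (1 / s))))) * X s)"
  shows "limit_points_0 {0<..<exp (- exp 1)} h = {-1..1}"
    and "Limsup (at_right 0) (\<lambda>s. ereal (g s)) = ereal (sqrt 2 * \<sigma>)"
    and "Liminf (at_right 0) (\<lambda>s. ereal (g s)) = ereal (- (sqrt 2 * \<sigma>))"
proof -
  have hs: "h (exp (-l)) = X (exp (-l)) / (\<sigma> * lil_scale l)" for l
  proof -
    have "ln (1 / exp (-l)) = l" by (simp add: ln_div)
    moreover have "2 * \<sigma>\<^sup>2 * l * ln (ln l) = \<sigma>\<^sup>2 * (2 * l * ln (ln l))" by simp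
    then have "sqrt (1 / (2 * \<sigma>\<^sup>2 * l * ln (ln l))) = 1 / (\<sigma> * lil_scale l)"
      using s by (simp only: real_sqrt_divide real_sqrt_mult lil_scale_def) simp
    ultimately show ?thesis unfolding h_def by simp
  qed
  have div_up: "\<forall>\<^sub>F l in at_top. Y l / (\<sigma> * lil_scale l) \<le> 1 + e"
    if "\<forall>\<^sub>F l in at_top. Y l \<le> (1 + e) * \<sigma> * lil_scale l" for Y e
    using that eventually_lil_scale_pos
    by eventually_elim (use s in \<open>simp add: pos_divide_le_eq mult.assoc\<close>)
  have div_fup: "\<exists>\<^sub>F l in at_top. 1 - e \<le> Y l / (\<sigma> * lil_scale l)"
    if "\<exists>\<^sub>F l in at_top. (1 - e) * \<sigma> * lil_scale l \<le> Y l" for Y e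
    using frequently_eventually_conj[OF that eventually_lil_scale_pos]
    by (rule frequently_elim1) (use s in \<open>simp add: pos_le_divide_eq mult.assoc\<close>)
  have hup: "\<forall>\<^sub>F s in at_right 0. h s \<le> 1 + e" if "0 < e" for e
    unfolding eventually_at_right_0_exp hs by (rule div_up[OF up[OF that]])
  have hlo: "\<forall>\<^sub>F s in at_right 0. - h s \<le> 1 + e" if "0 < e" for e
    unfolding eventually_at_right_0_exp hs minus_divide_left by (rule div_up[OF lo[OF that]])
  have hfup: "\<exists>\<^sub>F s in at_right 0. 1 - e \<le> h s" if "0 < e" for e
    unfolding frequently_at_right_0_exp hs by (rule div_fup[OF fup[OF that]])
  have hflo: "\<exists>\<^sub>F s in at_right 0. 1 - e \<le> - h s" if "0 < e" for e
    unfolding frequently_at_right_0_exp hs minus_divide_left by (rule div_fup[OF flo[OF that]])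
  show "limit_points_0 {0<..<exp (- exp 1)} h = {-1..1}"
  proof (rule limit_points_0_eq_interval)
    show "continuous_on {0<..<exp (- exp 1)} h"
      unfolding h_def
    proof (rule continuous_on_mult)
      show "continuous_on {0<..<exp (- exp 1)} X" by (rule continuous_on_subset[OF cont]) auto
      have b: "0 < s" "exp 1 < ln (1 / s)" if "s \<in> {0<..<exp (- exp 1)}" for s :: real
      proof -
        show s0: "0 < s" using that by simp
        have "ln s < ln (exp (- exp 1))" using that by (subst ln_less_cancel_iff) auto
        then show "exp 1 < ln (1 / s)" using s0 by (simp add: ln_div)
      qed
      have b1: "0 < ln (1 / s)" "1 < ln (ln (1 / s))" if "s \<in> {0<..<exp (- exp 1)}" for s :: real
      proof -
        show "0 < ln (1 / s)" using b(2)[OF that] exp_gt_zero[of "1::real"] by linarith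
        then show "1 < ln (ln (1 / s))" using b(2)[OF that] ln_less_cancel_iff[of "exp 1" "ln (1/s)"] by simp
      qed
      have b2: "s \<noteq> 0" "1 / s \<noteq> 0" "0 < 1 / s" "ln (1 / s) \<noteq> 0" "ln (ln (1 / s)) \<noteq> 0" "ln (ln (ln (1 / s))) \<noteq> 0"
        if "s \<in> {0<..<exp (- exp 1)}" for s :: real
      proof -
        have "0 < ln (ln (ln (1 / s)))" using b1(2)[OF that] by (rule ln_gt_zero)
        then show "ln (ln (ln (1 / s))) \<noteq> 0" by (rule less_imp_neq[symmetric])
        show "ln (1 / s) \<noteq> 0" using b1(1)[OF that] by (rule less_imp_neq[symmetric])
        show "ln (ln (1 / s)) \<noteq> 0" using b1(2)[OF that] by linarith
      qed (use b(1)[OF that] in simp_all)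
      have c1: "continuous_on {0<..<exp (- exp 1)} (\<lambda>s::real. ln (1 / s))"
        using b2 by (intro continuous_on_ln continuous_on_divide continuous_on_const continuous_on_id) auto
      have c2: "continuous_on {0<..<exp (- exp 1)} (\<lambda>s::real. ln (ln (1 / s)))"
        using b2 by (intro continuous_on_ln c1) auto
      have c3: "continuous_on {0<..<exp (- exp 1)} (\<lambda>s::real. ln (ln (ln (1 / s))))"
        using b2 by (intro continuous_on_ln c2) auto
      show "continuous_on {0<..<exp (- exp 1)} (\<lambda>s. sqrt (1 / (2 * \<sigma>\<^sup>2 * ln (1 / s) * ln (ln (ln (1 / s))))))"
      proof (rule continuous_on_real_sqrt, rule continuous_on_divide)
        show "continuous_on {0<..<exp (- exp 1)} (\<lambda>s. 2 * \<sigma>\<^sup>2 * ln (1 / s) * ln (ln (ln (1 / s))))"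
          by (intro continuous_on_mult continuous_on_const c1 c3)
        show "\<forall>x\<in>{0<..<exp (- exp 1)}. 2 * \<sigma>\<^sup>2 * ln (1 / x) * ln (ln (ln (1 / x))) \<noteq> (0::real)"
        proof
          fix x :: real assume x: "x \<in> {0<..<exp (- exp 1)}"
          show "2 * \<sigma>\<^sup>2 * ln (1 / x) * ln (ln (ln (1 / x))) \<noteq> 0"
            using b2(4,6)[OF x] s unfolding mult_eq_0_iff by simp
        qed
      qed (rule continuous_on_const)
    qed
  qed (use hup hlo hfup hflo in auto)
  have c0: "0 < sqrt 2 * \<sigma>" using s by simp
  have gh: "g s = sqrt 2 * \<sigma> * h s" for s
  proof -
    define r where "r = ln (1 / s) * ln (ln (ln (1 / s)))"
    have eq: "2 * \<sigma>\<^sup>2 * ln (1 / s) * ln (ln (ln (1 / s))) = 2 * \<sigma>\<^sup>2 * r" by (simp add: r_def)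
    have "sqrt 2 * \<sigma> * sqrt (1 / (2 * \<sigma>\<^sup>2 * r)) = sqrt (1 / r)"
      using \<open>0 < \<sigma>\<close> by (simp only: real_sqrt_divide real_sqrt_mult) simp
    moreover have "g s = sqrt (1 / r) * X s" by (simp only: g_def r_def)
    moreover have "h s = sqrt (1 / (2 * \<sigma>\<^sup>2 * r)) * X s" by (simp only: h_def eq)
    ultimately show ?thesis by (metis mult.assoc)
  qed
  show "Limsup (at_right 0) (\<lambda>s. ereal (g s)) = ereal (sqrt 2 * \<sigma>)"
    unfolding gh by (rule Limsup_scale_eqI_frequently[OF c0 hup hfup])
  have "Limsup (at_right 0) (\<lambda>s. ereal (- g s)) = ereal (sqrt 2 * \<sigma>)"
    unfolding gh mult_minus_right[symmetric] by (rule Limsup_scale_eqI_frequently[OF c0 hlo hflo])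
  then show "Liminf (at_right 0) (\<lambda>s. ereal (g s)) = ereal (- (sqrt 2 * \<sigma>))"
    using ereal_Liminf_uminus[of "at_right 0" "\<lambda>s. ereal (- g s)"] by simp
qed

section \<open>Truncation\<close>

lemma weighted_cesaro:
  fixes b c :: "nat \<Rightarrow> real"
  assumes b: "\<And>k. 0 \<le> b k" and B: "filterlim (\<lambda>n. \<Sum>k<n. b k) at_top sequentially"
    and c: "c \<longlonglongrightarrow> L"
  shows "(\<lambda>n. (\<Sum>k<n. c k * b k) / (\<Sum>k<n. b k)) \<longlonglongrightarrow> L"
proof (rule LIMSEQ_I)
  fix e :: real assume e: "0 < e"
  obtain k0 where k0: "\<And>k. k \<ge> k0 \<Longrightarrow> norm (c k - L) < e / 2"
    using LIMSEQ_D[OF c, of "e/2"] e by auto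
  define K where "K = (\<Sum>k<k0. \<bar>c k - L\<bar> * b k)"
  have bound: "\<bar>(\<Sum>k<n. (c k - L) * b k)\<bar> \<le> K + e / 2 * (\<Sum>k<n. b k)" for n
  proof -
    have "\<bar>(\<Sum>k<n. (c k - L) * b k)\<bar> \<le> (\<Sum>k<n. \<bar>c k - L\<bar> * b k)"
      using b by (intro order_trans[OF sum_abs]) (simp add: abs_mult)
    also have "\<dots> \<le> (\<Sum>k<n. (if k < k0 then \<bar>c k - L\<bar> * b k else 0) + e / 2 * b k)"
    proof (rule sum_mono)
      fix k
      show "\<bar>c k - L\<bar> * b k \<le> (if k < k0 then \<bar>c k - L\<bar> * b k else 0) + e / 2 * b k"
        using k0[of k] b[of k] e mult_right_mono[of "\<bar>c k - L\<bar>" "e/2" "b k"] by auto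
    qed
    also have "\<dots> = (\<Sum>k\<in>{..<n} \<inter> {k. k < k0}. \<bar>c k - L\<bar> * b k) + e / 2 * (\<Sum>k<n. b k)"
      by (simp add: sum.distrib sum_distrib_left sum.inter_restrict)
    also have "(\<Sum>k\<in>{..<n} \<inter> {k. k < k0}. \<bar>c k - L\<bar> * b k) \<le> K"
      unfolding K_def using b by (intro sum_mono2) auto
    finally show ?thesis by simp
  qed
  have "\<forall>\<^sub>F n in sequentially. max 0 (2 * K / e) < (\<Sum>k<n. b k)"
    using filterlim_at_top_dense[THEN iffD1, rule_format, OF B, of "max 0 (2 * K / e)"] .
  then obtain N where N: "\<And>n. n \<ge> N \<Longrightarrow> max 0 (2 * K / e) < (\<Sum>k<n. b k)"
    unfolding eventually_sequentially by blast
  show "\<exists>N. \<forall>n\<ge>N. norm ((\<Sum>k<n. c k * b k) / (\<Sum>k<n. b k) - L) < e"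
  proof (intro exI allI impI)
    fix n assume n: "N \<le> n"
    define S where "S = (\<Sum>k<n. b k)"
    have S: "0 < S" "2 * K / e < S" using N[OF n] by (auto simp: S_def)
    have "(\<Sum>k<n. (c k - L) * b k) = (\<Sum>k<n. c k * b k) - L * S"
      by (simp add: S_def left_diff_distrib sum_subtractf sum_distrib_left)
    then have "(\<Sum>k<n. c k * b k) / S - L = (\<Sum>k<n. (c k - L) * b k) / S"
      using S by (simp add: field_simps)
    then have "norm ((\<Sum>k<n. c k * b k) / S - L) = \<bar>\<Sum>k<n. (c k - L) * b k\<bar> / S"
      using S by simp
    also have "\<dots> \<le> (K + e / 2 * S) / S"
      using bound[of n] S by (intro divide_right_mono) (auto simp: S_def)
    also have "\<dots> < e"
    proof -
      have "K < e / 2 * S" using S(2) e by (simp add: field_simps)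
      then show ?thesis using S(1) by (simp add: pos_divide_less_eq)
    qed
    finally show "norm ((\<Sum>k<n. c k * b k) / (\<Sum>k<n. b k) - L) < e" by (simp add: S_def)
  qed
qed

lemma sum_inverse_sqrt_le: "(\<Sum>j\<in>{1..N}. 1 / sqrt (real j)) \<le> 2 * sqrt (real N)"
proof (induction N)
  case (Suc N)
  define x where "x = sqrt (real N)"
  define y where "y = sqrt (real (Suc N))"
  have xy: "0 \<le> x" "x \<le> y" "0 < y" "y\<^sup>2 = x\<^sup>2 + 1" by (auto simp: x_def y_def)
  have "(y - x) * (y + y) \<ge> (y - x) * (y + x)" using xy by (intro mult_left_mono) auto
  moreover have "(y - x) * (y + x) = 1" using xy(4) by (simp add: power2_eq_square algebra_simps)
  ultimately have "1 \<le> 2 * (y - x) * y" by (simp add: algebra_simps)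
  then have "1 / y \<le> 2 * (y - x)" using xy(3) by (simp only: pos_divide_le_eq)
  then show ?case using Suc by (simp add: x_def y_def)
qed simp

text \<open>Only primes below \<open>x\<^sup>2\<close> contribute. Even the sum of \<open>1 / sqrt j\<close> over all integers \<open>j \<le> x\<^sup>2\<close> is at most
  \<open>2 * \<bar>x\<bar>\<close>. This estimate is the reason why a finite second moment suffices.\<close>
lemma sum_truncated_primes_le:
  "(\<Sum>k<n. if sqrt (real (nth_prime k)) < \<bar>x\<bar> then \<bar>x\<bar> / sqrt (real (nth_prime k)) else 0) \<le> 2 * x\<^sup>2"
proof -
  define N where "N = nat \<lfloor>x\<^sup>2\<rfloor>"
  define A where "A = {k. k < n \<and> sqrt (real (nth_prime k)) < \<bar>x\<bar>}"
  have inj: "inj_on nth_prime A"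
    by (rule inj_on_subset[OF strict_mono_imp_inj_on[OF strict_mono_nth_prime] subset_UNIV])
  have sub: "nth_prime ` A \<subseteq> {1..N}"
  proof
    fix p assume "p \<in> nth_prime ` A"
    then obtain k where k: "p = nth_prime k" "sqrt (real p) < \<bar>x\<bar>" by (auto simp: A_def)
    have "real p < x\<^sup>2" using k(2) by (metis real_sqrt_abs real_sqrt_less_iff)
    then have "p \<le> N" unfolding N_def by (simp add: le_nat_iff le_floor_iff)
    then show "p \<in> {1..N}" using k(1) prime_nth_prime[of k] prime_ge_1_nat by simp
  qed
  have "(\<Sum>k<n. if sqrt (real (nth_prime k)) < \<bar>x\<bar> then \<bar>x\<bar> / sqrt (real (nth_prime k)) else 0)
     = (\<Sum>k\<in>A. \<bar>x\<bar> / sqrt (real (nth_prime k)))"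
    unfolding A_def by (subst sum.inter_filter[symmetric]) (auto intro!: sum.cong)
  also have "\<dots> = \<bar>x\<bar> * (\<Sum>p\<in>nth_prime ` A. 1 / sqrt (real p))"
    by (simp add: sum.reindex[OF inj] sum_distrib_left)
  also have "\<dots> \<le> \<bar>x\<bar> * (\<Sum>p\<in>{1..N}. 1 / sqrt (real p))"
    using sub by (intro mult_left_mono sum_mono2) auto
  also have "\<dots> \<le> \<bar>x\<bar> * (2 * sqrt (real N))"
    by (intro mult_left_mono sum_inverse_sqrt_le) auto
  also have "\<dots> \<le> \<bar>x\<bar> * (2 * \<bar>x\<bar>)"
  proof -
    have "sqrt (real N) \<le> sqrt (x\<^sup>2)" unfolding N_def by (intro real_sqrt_le_mono) simp
    then show ?thesis by (intro mult_left_mono) auto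
  qed
  also have "\<dots> = 2 * x\<^sup>2" by (simp add: power2_eq_square abs_mult_self_eq)
  finally show ?thesis .
qed

text \<open>The common law \<open>D\<close> is a parameter of its own so that moments of truncated variables become integrals
  over the real line. The variable \<open>\<xi> k\<close> will be attached to the \<open>k\<close>-th prime.\<close>
locale iid_sequence = prob_space M for M :: "'a measure" +
  fixes \<xi> :: "nat \<Rightarrow> 'a \<Rightarrow> real" and D :: "real measure" and \<sigma> :: real
  assumes indep: "indep_vars (\<lambda>_. borel) \<xi> UNIV"
    and distr: "\<And>k. distr M borel (\<xi> k) = D"
    and int1: "integrable D (\<lambda>x. x)" and mean: "integral\<^sup>L D (\<lambda>x. x) = 0"
    and int2: "integrable D (\<lambda>x. x\<^sup>2)" and var: "integral\<^sup>L D (\<lambda>x. x\<^sup>2) = \<sigma>\<^sup>2"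
    and sigma_pos: "0 < \<sigma>"
begin

lemma rv [measurable]: "random_variable borel (\<xi> k)"
  using indep by (auto simp: indep_vars_def)

lemma sets_D [measurable_cong]: "sets D = sets borel"
  using distr[of 0, symmetric] by simp

lemma prob_space_D: "prob_space D"
  using prob_space_distr[OF rv, of 0] distr[of 0] by simp

lemma expectation_xi: 
  fixes g :: "real \<Rightarrow> real"
  assumes "g \<in> borel_measurable borel"
  shows "expectation (\<lambda>x. g (\<xi> k x)) = integral\<^sup>L D g"
  using assms by (subst distr[of k, symmetric], subst integral_distr) auto

text \<open>The cut-off \<open>sqrt p\<close> matches the coefficient \<open>1 / sqrt p\<close>: the truncated terms are bounded uniformly in
  \<open>k\<close>, and \<open>excess\<close>, the size of the part cut off, is still summable in expectation.\<close>
definition trunc :: "nat \<Rightarrow> real \<Rightarrow> real" where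
  "trunc k x = (if \<bar>x\<bar> \<le> sqrt (real (nth_prime k)) then x / sqrt (real (nth_prime k)) else 0)"

definition excess :: "nat \<Rightarrow> real \<Rightarrow> real" where
  "excess k x = (if sqrt (real (nth_prime k)) < \<bar>x\<bar> then \<bar>x\<bar> / sqrt (real (nth_prime k)) else 0)"

definition truncated :: "nat \<Rightarrow> 'a \<Rightarrow> real" where
  "truncated k \<omega> = trunc k (\<xi> k \<omega>) - integral\<^sup>L D (trunc k)"

lemma trunc_measurable [measurable]: "trunc k \<in> borel_measurable borel"
  unfolding trunc_def[abs_def] by measurable

lemma excess_measurable [measurable]: "excess k \<in> borel_measurable borel"
  unfolding excess_def[abs_def] by measurable

lemma excess_nonneg: "0 \<le> excess k x"
  by (simp add: excess_def)

lemma abs_trunc_le: "\<bar>trunc k x\<bar> \<le> 1"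
  using nth_prime_pos[of k] by (simp add: trunc_def abs_divide)

lemma integrable_trunc: "integrable D (trunc k)" "integrable D (\<lambda>x. (trunc k x)\<^sup>2)"
proof -
  interpret D: prob_space D by (rule prob_space_D)
  show "integrable D (trunc k)"
    by (rule D.integrable_const_bound[of _ 1]) (auto simp: abs_trunc_le)
  show "integrable D (\<lambda>x. (trunc k x)\<^sup>2)"
    by (rule D.integrable_const_bound[of _ 1]) (auto simp: abs_square_le_1 abs_trunc_le)
qed

lemma integrable_excess: "integrable D (excess k)"
  by (rule Bochner_Integration.integrable_bound[OF integrable_divide[OF integrable_abs[OF int1], of "sqrt (real (nth_prime k))"]])
     (auto simp: excess_def)

lemma abs_integral_trunc_le: "\<bar>integral\<^sup>L D (trunc k)\<bar> \<le> 1"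
proof -
  interpret D: prob_space D by (rule prob_space_D)
  have "\<bar>integral\<^sup>L D (trunc k)\<bar> \<le> (\<integral>x. \<bar>trunc k x\<bar> \<partial>D)" by (rule integral_abs_bound)
  also have "\<dots> \<le> (\<integral>x. 1 \<partial>D)"
    using integrable_trunc(1) abs_trunc_le by (intro integral_mono) auto
  finally show ?thesis by (simp add: D.prob_space)
qed

lemma indep_bounded_centered_truncated: "indep_bounded_centered truncated 2 UNIV"
  unfolding indep_bounded_centered_def
proof (intro conjI ballI)
  show "indep_vars (\<lambda>_. borel) truncated UNIV"
    unfolding truncated_def[abs_def] by (rule indep_vars_compose2[OF indep]) simp
  fix k
  show "\<bar>truncated k x\<bar> \<le> 2" for x
    using abs_trunc_le[of k "\<xi> k x"] abs_integral_trunc_le[of k] by (simp add: truncated_def)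
  have i: "integrable M (\<lambda>x. trunc k (\<xi> k x))"
    by (rule integrable_const_bound[of _ 1]) (auto simp: abs_trunc_le)
  show "expectation (truncated k) = 0"
    unfolding truncated_def[abs_def] using i expectation_xi[of "trunc k" k] by (simp add: prob_space)
qed

text \<open>As \<open>D\<close> has mean 0, the mean of the truncated term is minus the mean of what has been cut off.\<close>
lemma abs_integral_trunc_le_excess: "\<bar>integral\<^sup>L D (trunc k)\<bar> \<le> integral\<^sup>L D (excess k)"
proof -
  define r where "r = sqrt (real (nth_prime k))"
  have r: "0 < r" using nth_prime_pos[of k] by (simp add: r_def)
  have i: "integrable D (\<lambda>x. trunc k x - x / r)" using integrable_trunc int1 by auto
  have "integral\<^sup>L D (trunc k) = (\<integral>x. trunc k x - x / r \<partial>D)"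
    using integrable_trunc int1 mean by simp
  also have "\<bar>\<dots>\<bar> \<le> (\<integral>x. \<bar>trunc k x - x / r\<bar> \<partial>D)" by (rule integral_abs_bound)
  also have "\<dots> \<le> integral\<^sup>L D (excess k)"
    using r by (intro integral_mono integrable_abs i integrable_excess)
      (auto simp: trunc_def excess_def r_def[symmetric])
  finally show ?thesis .
qed

lemma summable_integral_excess: "summable (\<lambda>k. integral\<^sup>L D (excess k))"
proof (rule summableI_nonneg_bounded)
  show "0 \<le> integral\<^sup>L D (excess k)" for k by (intro integral_nonneg_AE) (simp add: excess_nonneg)
  fix n
  have "(\<Sum>k<n. integral\<^sup>L D (excess k)) = (\<integral>x. (\<Sum>k<n. excess k x) \<partial>D)"
    using integrable_excess by (intro Bochner_Integration.integral_sum[symmetric])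
  also have "\<dots> \<le> (\<integral>x. 2 * x\<^sup>2 \<partial>D)"
  proof (rule integral_mono)
    show "integrable D (\<lambda>x. \<Sum>k<n. excess k x)"
      by (intro Bochner_Integration.integrable_sum integrable_excess)
    show "integrable D (\<lambda>x. 2 * x\<^sup>2)" using int2 by simp
    show "(\<Sum>k<n. excess k x) \<le> 2 * x\<^sup>2" for x
      using sum_truncated_primes_le[of x n] by (simp add: excess_def)
  qed
  also have "\<dots> = 2 * \<sigma>\<^sup>2" using var by simp
  finally show "(\<Sum>k<n. integral\<^sup>L D (excess k)) \<le> 2 * \<sigma>\<^sup>2" .
qed

text \<open>The error is at most the excess plus its mean, and the excesses have a finite total expectation.\<close>
lemma AE_summable_truncation_error:
  "AE \<omega> in M. summable (\<lambda>k. \<bar>\<xi> k \<omega> / sqrt (real (nth_prime k)) - truncated k \<omega>\<bar>)"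
proof -
  have "(\<integral>\<^sup>+\<omega>. (\<Sum>k. ennreal (excess k (\<xi> k \<omega>))) \<partial>M) = (\<Sum>k. \<integral>\<^sup>+\<omega>. ennreal (excess k (\<xi> k \<omega>)) \<partial>M)"
    by (rule nn_integral_suminf) measurable
  also have "\<dots> = (\<Sum>k. ennreal (integral\<^sup>L D (excess k)))"
  proof (rule suminf_cong)
    fix k
    have "integrable M (\<lambda>\<omega>. excess k (\<xi> k \<omega>))"
      using integrable_excess[of k] unfolding distr[of k, symmetric] by (subst (asm) integrable_distr_eq) auto
    then show "(\<integral>\<^sup>+\<omega>. ennreal (excess k (\<xi> k \<omega>)) \<partial>M) = ennreal (integral\<^sup>L D (excess k))"
      by (subst nn_integral_eq_integral) (auto simp: excess_nonneg expectation_xi)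
  qed
  also have "\<dots> = ennreal (\<Sum>k. integral\<^sup>L D (excess k))"
    by (rule suminf_ennreal2[OF _ summable_integral_excess]) (intro integral_nonneg_AE, simp add: excess_nonneg)
  finally have "(\<integral>\<^sup>+\<omega>. (\<Sum>k. ennreal (excess k (\<xi> k \<omega>))) \<partial>M) \<noteq> \<infinity>" by simp
  then have "AE \<omega> in M. (\<Sum>k. ennreal (excess k (\<xi> k \<omega>))) \<noteq> \<infinity>"
    by (intro nn_integral_noteq_infinite) measurable
  then show ?thesis
  proof eventually_elim
    case (elim \<omega>)
    then have "summable (\<lambda>k. excess k (\<xi> k \<omega>))"
      by (intro summable_suminf_not_top) (auto simp: excess_nonneg)
    then have s: "summable (\<lambda>k. excess k (\<xi> k \<omega>) + integral\<^sup>L D (excess k))"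
      by (rule summable_add[OF _ summable_integral_excess])
    show ?case
    proof (rule summable_comparison_test_ev[OF always_eventually s], rule allI)
      fix k
      have "\<bar>\<xi> k \<omega> / sqrt (real (nth_prime k)) - trunc k (\<xi> k \<omega>)\<bar> \<le> excess k (\<xi> k \<omega>)"
        by (auto simp: trunc_def excess_def)
      then show "norm \<bar>\<xi> k \<omega> / sqrt (real (nth_prime k)) - truncated k \<omega>\<bar> \<le> excess k (\<xi> k \<omega>) + integral\<^sup>L D (excess k)"
        using abs_integral_trunc_le_excess[of k] by (simp add: truncated_def)
    qed
  qed
qed

lemma variance_truncated:
  "expectation (\<lambda>\<omega>. (truncated k \<omega>)\<^sup>2) = integral\<^sup>L D (\<lambda>x. (trunc k x)\<^sup>2) - (integral\<^sup>L D (trunc k))\<^sup>2"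
proof -
  interpret D: prob_space D by (rule prob_space_D)
  have "expectation (\<lambda>\<omega>. (truncated k \<omega>)\<^sup>2) = (\<integral>x. (trunc k x - integral\<^sup>L D (trunc k))\<^sup>2 \<partial>D)"
    unfolding truncated_def by (rule expectation_xi) measurable
  also have "\<dots> = integral\<^sup>L D (\<lambda>x. (trunc k x)\<^sup>2) - (integral\<^sup>L D (trunc k))\<^sup>2"
    using D.variance_eq[OF integrable_trunc] by simp
  finally show ?thesis .
qed

lemma filterlim_nth_prime: "filterlim (\<lambda>k. real (nth_prime k)) at_top sequentially"
  by (rule filterlim_at_top_mono[OF filterlim_real_sequentially]) (simp add: le_nth_prime)

text \<open>Dominated convergence for the first and second moments as the cut-off tends to infinity.\<close>
lemma variance_truncated_asymp:
  "(\<lambda>k. real (nth_prime k) * expectation (\<lambda>\<omega>. (truncated k \<omega>)\<^sup>2)) \<longlonglongrightarrow> \<sigma>\<^sup>2"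
proof -
  define r where "r k = sqrt (real (nth_prime k))" for k
  have r: "0 < r k" "(r k)\<^sup>2 = real (nth_prime k)" for k using nth_prime_pos[of k] by (simp_all add: r_def)
  have rinf: "filterlim r at_top sequentially"
    unfolding r_def[abs_def] by (rule filterlim_compose[OF sqrt_at_top filterlim_nth_prime])
  define f where "f k x = (if \<bar>x\<bar> \<le> r k then x else 0)" for k and x :: real
  have fm [measurable]: "f k \<in> borel_measurable borel" for k unfolding f_def[abs_def] by measurable
  have tf: "r k * trunc k x = f k x" for k x using r(1)[of k] by (simp add: trunc_def f_def r_def)
  have lim: "(\<lambda>k. f k x) \<longlonglongrightarrow> x" for x
  proof (rule tendsto_eventually)
    have "\<forall>\<^sub>F k in sequentially. \<bar>x\<bar> \<le> r k" using rinf unfolding filterlim_at_top by auto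
    then show "\<forall>\<^sub>F k in sequentially. f k x = x" by eventually_elim (simp add: f_def)
  qed
  have l1: "(\<lambda>k. integral\<^sup>L D (f k)) \<longlonglongrightarrow> integral\<^sup>L D (\<lambda>x. x)"
  proof (rule integral_dominated_convergence[where w="\<lambda>x. \<bar>x\<bar>"])
    show "AE x in D. (\<lambda>k. f k x) \<longlonglongrightarrow> x" by (intro AE_I2 lim)
    show "AE x in D. norm (f k x) \<le> \<bar>x\<bar>" for k by (simp add: f_def)
    show "integrable D (\<lambda>x. \<bar>x\<bar>)" using int1 by (rule integrable_abs)
  qed measurable
  have l2: "(\<lambda>k. integral\<^sup>L D (\<lambda>x. (f k x)\<^sup>2)) \<longlonglongrightarrow> integral\<^sup>L D (\<lambda>x. x\<^sup>2)"
  proof (rule integral_dominated_convergence[where w="\<lambda>x. x\<^sup>2"])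
    show "AE x in D. (\<lambda>k. (f k x)\<^sup>2) \<longlonglongrightarrow> x\<^sup>2" by (intro AE_I2 tendsto_power lim)
    show "AE x in D. norm ((f k x)\<^sup>2) \<le> x\<^sup>2" for k by (simp add: f_def)
  qed (use int2 in measurable)
  have "real (nth_prime k) * expectation (\<lambda>\<omega>. (truncated k \<omega>)\<^sup>2)
     = integral\<^sup>L D (\<lambda>x. (f k x)\<^sup>2) - (integral\<^sup>L D (f k))\<^sup>2" for k
  proof -
    have f: "f k = (\<lambda>x. r k * trunc k x)" by (simp add: tf)
    have "integral\<^sup>L D (\<lambda>x. (f k x)\<^sup>2) = (r k)\<^sup>2 * integral\<^sup>L D (\<lambda>x. (trunc k x)\<^sup>2)"
      unfolding f power_mult_distrib by (rule integral_mult_right_zero)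
    moreover have "integral\<^sup>L D (f k) = r k * integral\<^sup>L D (trunc k)"
      unfolding f by (rule integral_mult_right_zero)
    ultimately show ?thesis
      by (simp add: variance_truncated right_diff_distrib power_mult_distrib r(2))
  qed
  moreover have "(\<lambda>k. integral\<^sup>L D (\<lambda>x. (f k x)\<^sup>2) - (integral\<^sup>L D (f k))\<^sup>2) \<longlonglongrightarrow> \<sigma>\<^sup>2 - 0\<^sup>2"
    using l1 l2 mean var by (intro tendsto_diff tendsto_power) auto
  ultimately show ?thesis by simp
qed

definition cum_variance :: "nat \<Rightarrow> real" where
  "cum_variance n = (\<Sum>k<n. expectation (\<lambda>\<omega>. (truncated k \<omega>)\<^sup>2))"

lemma cum_variance_mono: "m \<le> n \<Longrightarrow> cum_variance m \<le> cum_variance n"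
  unfolding cum_variance_def by (intro sum_mono2) (auto intro!: integral_nonneg_AE)

lemma filterlim_prime_count: "filterlim prime_count_loglog at_top at_top"
  unfolding filterlim_at_top
proof
  fix Z
  have "\<forall>\<^sub>F v in at_top. ln (ln (real (nth_prime Z))) \<le> v" by (rule eventually_ge_at_top)
  then show "\<forall>\<^sub>F v in at_top. Z \<le> prime_count_loglog v"
  proof eventually_elim
    case (elim v)
    then have "Z < prime_count_loglog v"
      unfolding ln_ln_nth_prime_le_iff less_prime_count_loglog_iff .
    then show ?case by simp
  qed
qed

lemma sum_inverse_primes_at_top: "filterlim (\<lambda>n. \<Sum>k<n. 1 / real (nth_prime k)) at_top sequentially"
proof -
  define B where "B n = (\<Sum>k<n. 1 / real (nth_prime k))" for n
  have mono: "B m \<le> B n" if "m \<le> n" for m n using that unfolding B_def by (intro sum_mono2) auto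
  have "filterlim (\<lambda>v. B (prime_count_loglog v) / v * v) at_top at_top"
    using sum_inverse_primes_asymp unfolding B_def
    by (rule filterlim_tendsto_pos_mult_at_top) (auto intro: filterlim_ident)
  moreover have "\<forall>\<^sub>F v::real in at_top. B (prime_count_loglog v) / v * v = B (prime_count_loglog v)"
    using eventually_gt_at_top[of 0] by eventually_elim simp
  ultimately have lim: "filterlim (\<lambda>v. B (prime_count_loglog v)) at_top at_top"
    by (simp add: filterlim_cong)
  have "filterlim B at_top sequentially"
    unfolding filterlim_at_top
  proof
    fix z
    obtain v where "z \<le> B (prime_count_loglog v)"
      using lim unfolding filterlim_at_top eventually_at_top_linorder by blast
    then have "z \<le> B n" if "prime_count_loglog v \<le> n" for n using mono[OF that] by linarith
    then show "\<forall>\<^sub>F n in sequentially. z \<le> B n" unfolding eventually_sequentially by blast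
  qed
  then show ?thesis by (simp add: B_def[abs_def])
qed

text \<open>The variance of the \<open>k\<close>-th term is asymptotic to \<open>\<sigma>\<^sup>2 / p\<close>, so a weighted Cesaro mean reduces the
  claim to the sum of the reciprocals of the primes.\<close>
lemma cum_variance_asymp: "((\<lambda>v. cum_variance (prime_count_loglog v) / v) \<longlongrightarrow> \<sigma>\<^sup>2) at_top"
proof -
  define B where "B n = (\<Sum>k<n. 1 / real (nth_prime k))" for n
  have "(\<lambda>n. (\<Sum>k<n. (real (nth_prime k) * expectation (\<lambda>\<omega>. (truncated k \<omega>)\<^sup>2)) * (1 / real (nth_prime k))) / B n) \<longlonglongrightarrow> \<sigma>\<^sup>2"
    unfolding B_def by (rule weighted_cesaro[OF _ sum_inverse_primes_at_top variance_truncated_asymp]) simp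
  moreover have "(\<Sum>k<n. (real (nth_prime k) * expectation (\<lambda>\<omega>. (truncated k \<omega>)\<^sup>2)) * (1 / real (nth_prime k))) = cum_variance n" for n
    unfolding cum_variance_def
  proof (intro sum.cong refl)
    fix k
    show "real (nth_prime k) * expectation (\<lambda>\<omega>. (truncated k \<omega>)\<^sup>2) * (1 / real (nth_prime k))
       = expectation (\<lambda>\<omega>. (truncated k \<omega>)\<^sup>2)"
      using nth_prime_pos[of k] by simp
  qed
  ultimately have "(\<lambda>n. cum_variance n / B n) \<longlonglongrightarrow> \<sigma>\<^sup>2" by simp
  from filterlim_compose[OF this filterlim_prime_count]
  have lim: "((\<lambda>v. cum_variance (prime_count_loglog v) / B (prime_count_loglog v) * (B (prime_count_loglog v) / v)) \<longlongrightarrow> \<sigma>\<^sup>2 * 1) at_top"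
    using sum_inverse_primes_asymp unfolding B_def by (intro tendsto_mult)
  have "\<forall>\<^sub>F v in at_top. cum_variance (prime_count_loglog v) / B (prime_count_loglog v) * (B (prime_count_loglog v) / v)
     = cum_variance (prime_count_loglog v) / v"
  proof -
    have "filterlim (\<lambda>v. B (prime_count_loglog v)) at_top at_top"
      unfolding B_def by (rule filterlim_compose[OF sum_inverse_primes_at_top filterlim_prime_count])
    then have "\<forall>\<^sub>F v in at_top. 0 < B (prime_count_loglog v)" unfolding filterlim_at_top_dense by auto
    then show ?thesis by eventually_elim simp
  qed
  from tendsto_cong[OF this] lim show ?thesis by simp
qed

lemma cum_variance_at_top: "filterlim cum_variance at_top sequentially"
proof -
  have "filterlim (\<lambda>v. cum_variance (prime_count_loglog v) / v * v) at_top at_top"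
    using cum_variance_asymp sigma_pos by (intro filterlim_tendsto_pos_mult_at_top[OF cum_variance_asymp]) (auto intro: filterlim_ident)
  moreover have "\<forall>\<^sub>F v::real in at_top. cum_variance (prime_count_loglog v) / v * v = cum_variance (prime_count_loglog v)"
    using eventually_gt_at_top[of 0] by eventually_elim simp
  ultimately have lim: "filterlim (\<lambda>v. cum_variance (prime_count_loglog v)) at_top at_top"
    by (simp add: filterlim_cong)
  show ?thesis
    unfolding filterlim_at_top
  proof
    fix z
    obtain v where "z \<le> cum_variance (prime_count_loglog v)"
      using lim unfolding filterlim_at_top eventually_at_top_linorder by blast
    then have "z \<le> cum_variance n" if "prime_count_loglog v \<le> n" for n using cum_variance_mono[OF that] by linarith
    then show "\<forall>\<^sub>F n in sequentially. z \<le> cum_variance n" unfolding eventually_sequentially by blast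
  qed
qed

end

section \<open>Both halves of the law for the random series\<close>

context iid_sequence
begin

definition weighted :: "'a \<Rightarrow> nat \<Rightarrow> real" where
  "weighted \<omega> k = \<xi> k \<omega> / sqrt (real (nth_prime k))"

text \<open>Eventually the variance accumulated up to \<open>ln (ln p) \<le> v\<close> is below \<open>(1 + h) * \<sigma>\<^sup>2 * v\<close>, and
  \<open>lil_scale ((1 + h) * \<sigma>\<^sup>2 * v)\<close> is asymptotic to \<open>sqrt (1 + h) * \<sigma> * lil_scale v\<close>. The truncation error is
  bounded, hence absorbed by the scale.\<close>
lemma AE_partial_sums_upper:
  "AE \<omega> in M. \<forall>\<epsilon>>0. \<forall>\<^sub>F v in at_top. \<forall>k\<le>prime_count_loglog v. (\<Sum>j<k. weighted \<omega> j) \<le> (1 + \<epsilon>) * \<sigma> * lil_scale v"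
proof -
  have "AE \<omega> in M. \<forall>m::nat. \<forall>\<^sub>F v in at_top. \<forall>k. cum_variance k \<le> v \<longrightarrow>
      (\<Sum>j<k. truncated j \<omega>) \<le> (1 + inverse (real (Suc m))) * lil_scale v"
    unfolding AE_all_countable
    by (intro allI kolmogorov_lil_upper[OF indep_bounded_centered_truncated _ cum_variance_at_top]) (simp_all add: cum_variance_def)
  then show ?thesis using AE_summable_truncation_error
  proof eventually_elim
    case (elim \<omega>)
    show ?case
    proof (intro allI impI)
      fix \<epsilon> :: real assume e: "0 < \<epsilon>"
      define h where "h = min 1 \<epsilon> / 4"
      have h: "0 < h" "h \<le> 1" "4 * h \<le> \<epsilon>" using e by (auto simp: h_def)
      obtain m where m: "inverse (real (Suc m)) < h" using reals_Archimedean[OF h(1)] by blast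
      define c where "c = (1 + h) * \<sigma>\<^sup>2"
      define E where "E = (\<Sum>k. \<bar>weighted \<omega> k - truncated k \<omega>\<bar>)"
      have sumE: "summable (\<lambda>k. \<bar>weighted \<omega> k - truncated k \<omega>\<bar>)" using elim(2) by (simp add: weighted_def)
      have s2: "0 < \<sigma>\<^sup>2" using sigma_pos by simp
      have c0: "0 < c" using h s2 by (simp add: c_def)
      have lim: "filterlim (\<lambda>v. c * v) at_top at_top" using c0 by real_asymp
      have "\<forall>\<^sub>F v in at_top. cum_variance (prime_count_loglog v) / v < c"
      proof (rule order_tendstoD(2)[OF cum_variance_asymp])
        have "1 * \<sigma>\<^sup>2 < (1 + h) * \<sigma>\<^sup>2" using h s2 by (intro mult_strict_right_mono) auto
        then show "\<sigma>\<^sup>2 < c" by (simp add: c_def)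
      qed
      moreover have "\<forall>\<^sub>F v in at_top. lil_scale (c * v) / lil_scale v < (1 + h) * \<sigma>"
      proof (rule order_tendstoD(2)[OF lil_scale_scale[OF c0]])
        have "sqrt (1 + h) < 1 + h" using h by (intro real_less_lsqrt) (simp_all add: power2_eq_square)
        then show "sqrt c < (1 + h) * \<sigma>" using sigma_pos by (simp add: c_def real_sqrt_mult)
      qed
      moreover have "\<forall>\<^sub>F v in at_top. max 0 (E / (h * \<sigma>)) < lil_scale v"
        using lil_scale_at_top filterlim_at_top_dense by metis
      moreover have "\<forall>\<^sub>F v in at_top. 0 < lil_scale (c * v)"
        using filterlim_compose[OF lil_scale_at_top lim] unfolding filterlim_at_top_dense by auto
      moreover have "\<forall>\<^sub>F v in at_top. \<forall>k. cum_variance k \<le> c * v \<longrightarrow>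
          (\<Sum>j<k. truncated j \<omega>) \<le> (1 + inverse (real (Suc m))) * lil_scale (c * v)"
        using filterlim_iff[THEN iffD1, OF lim, rule_format, OF elim(1)[rule_format, of m]] .
      moreover have "\<forall>\<^sub>F v::real in at_top. 0 < v" by (rule eventually_gt_at_top)
      ultimately show "\<forall>\<^sub>F v in at_top. \<forall>k\<le>prime_count_loglog v. (\<Sum>j<k. weighted \<omega> j) \<le> (1 + \<epsilon>) * \<sigma> * lil_scale v"
      proof eventually_elim
        case (elim v)
        have hs: "0 < h * \<sigma>" using h sigma_pos by simp
        show ?case
        proof (intro allI impI)
          fix k assume k: "k \<le> prime_count_loglog v"
          have "cum_variance k \<le> cum_variance (prime_count_loglog v)" by (rule cum_variance_mono[OF k])
          also have "\<dots> \<le> c * v" using elim(1,6) by (simp add: pos_divide_less_eq)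
          finally have "(\<Sum>j<k. truncated j \<omega>) \<le> (1 + inverse (real (Suc m))) * lil_scale (c * v)"
            using elim(5) by blast
          also have "\<dots> \<le> (1 + h) * lil_scale (c * v)"
            using m elim(4) by (intro mult_right_mono) auto
          also have "\<dots> \<le> (1 + h) * ((1 + h) * \<sigma> * lil_scale v)"
            using elim(2,3) h by (intro mult_left_mono) (auto simp: pos_divide_less_eq)
          finally have t: "(\<Sum>j<k. truncated j \<omega>) \<le> (1 + h) * ((1 + h) * \<sigma> * lil_scale v)" .
          have "(\<Sum>j<k. weighted \<omega> j) - (\<Sum>j<k. truncated j \<omega>) \<le> (\<Sum>j<k. \<bar>weighted \<omega> j - truncated j \<omega>\<bar>)"
            unfolding sum_subtractf[symmetric] by (intro sum_mono) auto
          also have "\<dots> \<le> E" unfolding E_def using sumE by (intro sum_le_suminf) auto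
          also have "E \<le> h * \<sigma> * lil_scale v" using elim(3) hs by (simp add: pos_divide_less_eq mult.commute)
          finally have "(\<Sum>j<k. weighted \<omega> j) \<le> (1 + h) * ((1 + h) * \<sigma> * lil_scale v) + h * \<sigma> * lil_scale v"
            using t by linarith
          also have "\<dots> = (1 + 3 * h + h * h) * (\<sigma> * lil_scale v)" by (simp add: algebra_simps)
          also have "\<dots> \<le> (1 + \<epsilon>) * (\<sigma> * lil_scale v)"
          proof (rule mult_right_mono)
            have "h * h \<le> h * 1" using h by (intro mult_left_mono) auto
            then show "1 + 3 * h + h * h \<le> 1 + \<epsilon>" using h by linarith
          qed (use elim(3) sigma_pos in simp)
          finally show "(\<Sum>j<k. weighted \<omega> j) \<le> (1 + \<epsilon>) * \<sigma> * lil_scale v" by (simp add: mult.assoc)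
        qed
      qed
    qed
  qed
qed

definition block_sum :: "real \<Rightarrow> real \<Rightarrow> 'a \<Rightarrow> real" where
  "block_sum \<epsilon> l \<omega> = (\<Sum>k\<in>prime_block \<epsilon> l. truncated k \<omega> * real (nth_prime k) powr (-exp (-l)))"

definition block_variance :: "real \<Rightarrow> real \<Rightarrow> real" where
  "block_variance \<epsilon> l = (\<Sum>k\<in>prime_block \<epsilon> l. expectation (\<lambda>\<omega>. (truncated k \<omega> * real (nth_prime k) powr (-exp (-l)))\<^sup>2))"

text \<open>Keep only the primes with \<open>\<epsilon>\<^sup>2 * l < ln (ln p) \<le> (1 - \<epsilon>) * l\<close>. On them \<open>p powr (- exp (- l))\<close> tends to 1
  uniformly, so their variance is asymptotic to \<open>\<sigma>\<^sup>2 * (1 - \<epsilon> - \<epsilon>\<^sup>2) * l\<close>.\<close>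
lemma block_variance_ge:
  assumes e: "0 < \<epsilon>" "\<epsilon> \<le> 1/8"
  shows "\<forall>\<^sub>F l in at_top. \<sigma>\<^sup>2 * (1 - 2 * \<epsilon>) * l \<le> block_variance \<epsilon> l"
proof -
  have s2: "0 < \<sigma>\<^sup>2" using sigma_pos by simp
  have e2: "0 < \<epsilon>\<^sup>2" "\<epsilon>\<^sup>2 < \<epsilon>" using e by (auto simp: power2_eq_square)
  define U where "U v = cum_variance (prime_count_loglog v)" for v
  have U: "((\<lambda>l. U (c * l) / l) \<longlongrightarrow> c * \<sigma>\<^sup>2) at_top" if c: "0 < c" for c
  proof -
    have "filterlim (\<lambda>l. c * l) at_top at_top" using c by real_asymp
    from filterlim_compose[OF cum_variance_asymp this] have "((\<lambda>l. U (c * l) / (c * l)) \<longlongrightarrow> \<sigma>\<^sup>2) at_top" by (simp add: U_def)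
    from tendsto_mult_left[OF this, of c] have "((\<lambda>l. c * (U (c * l) / (c * l))) \<longlongrightarrow> c * \<sigma>\<^sup>2) at_top" .
    then show ?thesis using c by simp
  qed
  have "((\<lambda>l. exp (-2 * exp (- (\<epsilon> * l)))) \<longlongrightarrow> 1) at_top" using e by real_asymp
  then have "((\<lambda>l. exp (-2 * exp (- (\<epsilon> * l))) * (U ((1 - \<epsilon>) * l) / l - U (\<epsilon>\<^sup>2 * l) / l)) \<longlongrightarrow> 1 * ((1 - \<epsilon>) * \<sigma>\<^sup>2 - \<epsilon>\<^sup>2 * \<sigma>\<^sup>2)) at_top"
    using e e2 by (intro tendsto_mult tendsto_diff U) auto
  moreover have "\<sigma>\<^sup>2 * (1 - 2 * \<epsilon>) < 1 * ((1 - \<epsilon>) * \<sigma>\<^sup>2 - \<epsilon>\<^sup>2 * \<sigma>\<^sup>2)"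
  proof -
    have "\<sigma>\<^sup>2 * (1 - 2 * \<epsilon>) < \<sigma>\<^sup>2 * (1 - \<epsilon> - \<epsilon>\<^sup>2)" using e2 by (intro mult_strict_left_mono s2) auto
    then show ?thesis by (simp add: algebra_simps)
  qed
  ultimately have "\<forall>\<^sub>F l in at_top. \<sigma>\<^sup>2 * (1 - 2 * \<epsilon>) < exp (-2 * exp (- (\<epsilon> * l))) * (U ((1 - \<epsilon>) * l) / l - U (\<epsilon>\<^sup>2 * l) / l)"
    by (rule order_tendstoD)
  moreover have "\<forall>\<^sub>F l::real in at_top. 0 < l" by (rule eventually_gt_at_top)
  ultimately show ?thesis
  proof eventually_elim
    case (elim l)
    define K where "K = prime_count_loglog (\<epsilon>\<^sup>2 * l)"
    define L where "L = prime_count_loglog ((1 - \<epsilon>) * l)"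
    define N where "N = prime_count_loglog (2 * l)"
    have KL: "K \<le> L" unfolding K_def L_def using e2 e elim(2) by (intro prime_count_mono mult_right_mono) auto
    have LN: "L \<le> N" unfolding L_def N_def using e elim(2) by (intro prime_count_mono mult_right_mono) auto
    define x where "x k = expectation (\<lambda>\<omega>. (truncated k \<omega>)\<^sup>2)" for k
    have x0: "0 \<le> x k" for k unfolding x_def by (intro integral_nonneg_AE) auto
    define w where "w k = (real (nth_prime k) powr (-exp (-l)))\<^sup>2" for k
    have w0: "0 \<le> w k" for k by (simp add: w_def)
    have wL: "exp (-2 * exp (- (\<epsilon> * l))) \<le> w k" if "k < L" for k
    proof -
      have "real (nth_prime k) \<le> exp (exp ((1 - \<epsilon>) * l))"
        using that unfolding L_def less_prime_count_loglog_iff .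
      then have "exp (exp ((1 - \<epsilon>) * l)) powr (-exp (-l)) \<le> real (nth_prime k) powr (-exp (-l))"
        using nth_prime_pos[of k] by (intro powr_mono2') auto
      then have "(exp (exp ((1 - \<epsilon>) * l)) powr (-exp (-l)))\<^sup>2 \<le> w k" unfolding w_def by (intro power_mono) auto
      also have "exp (exp ((1 - \<epsilon>) * l)) powr (-exp (-l)) = exp (- (exp (-l) * exp ((1 - \<epsilon>) * l)))" by (simp add: powr_def)
      also have "exp (-l) * exp ((1 - \<epsilon>) * l) = exp (- (\<epsilon> * l))" unfolding exp_add[symmetric] by (simp add: algebra_simps)
      also have "(exp (- exp (- (\<epsilon> * l))))\<^sup>2 = exp (-2 * exp (- (\<epsilon> * l)))" by (simp add: exp_double[symmetric])
      finally show ?thesis .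
    qed
    have cum_variance: "cum_variance L - cum_variance K = (\<Sum>k=K..<L. x k)"
      using sum.atLeastLessThan_concat[of 0 K L x] KL unfolding cum_variance_def x_def[symmetric] by (simp add: atLeast0LessThan)
    have bv: "block_variance \<epsilon> l = (\<Sum>k=K..<N. x k * w k)"
      unfolding block_variance_def prime_block_def K_def N_def x_def w_def power_mult_distrib by simp
    have "\<sigma>\<^sup>2 * (1 - 2 * \<epsilon>) * l \<le> exp (-2 * exp (- (\<epsilon> * l))) * (U ((1 - \<epsilon>) * l) / l - U (\<epsilon>\<^sup>2 * l) / l) * l"
      using elim by (intro mult_right_mono) auto
    also have "\<dots> = exp (-2 * exp (- (\<epsilon> * l))) * (cum_variance L - cum_variance K)"
      using elim(2) by (simp add: U_def L_def K_def diff_divide_distrib[symmetric])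
    also have "\<dots> = (\<Sum>k=K..<L. x k * exp (-2 * exp (- (\<epsilon> * l))))"
      unfolding cum_variance by (subst mult.commute) (rule sum_distrib_right)
    also have "\<dots> \<le> (\<Sum>k=K..<L. x k * w k)"
      using x0 wL by (intro sum_mono mult_left_mono) auto
    also have "\<dots> \<le> (\<Sum>k=K..<N. x k * w k)"
      using LN x0 w0 by (intro sum_mono2) auto
    finally show ?case by (simp add: bv)
  qed
qed

lemma block_indep_bounded_centered:
  "indep_bounded_centered (\<lambda>k \<omega>. truncated k \<omega> * real (nth_prime k) powr (-exp (-l))) 2 I"
proof -
  have w: "0 \<le> real (nth_prime k) powr (-exp (-l))" "real (nth_prime k) powr (-exp (-l)) \<le> 1" for k
    by (simp_all add: nth_prime_powr_le_1)
  note bc = indep_bounded_centered_truncated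
  show ?thesis
    unfolding indep_bounded_centered_def
  proof (intro conjI ballI)
    show "indep_vars (\<lambda>_. borel) (\<lambda>k \<omega>. truncated k \<omega> * real (nth_prime k) powr (-exp (-l))) I"
      by (rule indep_vars_compose2[OF indep_vars_subset[OF _ subset_UNIV]])
         (use bc in \<open>auto simp: indep_bounded_centered_def\<close>)
    fix k
    show "\<bar>truncated k x * real (nth_prime k) powr (-exp (-l))\<bar> \<le> 2" if "x \<in> space M" for x
    proof -
      have "\<bar>truncated k x\<bar> * real (nth_prime k) powr (-exp (-l)) \<le> 2 * 1"
        using indep_bounded_centeredD(2)[OF bc UNIV_I that, of k] w[of k] by (intro mult_mono) auto
      then show ?thesis using w(1)[of k] by (simp add: abs_mult)
    qed
    show "expectation (\<lambda>\<omega>. truncated k \<omega> * real (nth_prime k) powr (-exp (-l))) = 0"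
      using indep_bounded_centeredD(3)[OF bc UNIV_I, of k] by simp
  qed
qed

lemma indep_block_sums:
  assumes disj: "disjoint_family (\<lambda>n. prime_block \<epsilon> (l n))"
  shows "indep_vars (\<lambda>_. borel) (\<lambda>n. block_sum \<epsilon> (l n)) UNIV"
proof -
  define F where "F n f = (\<Sum>k\<in>prime_block \<epsilon> (l n). f k * real (nth_prime k) powr (-exp (-l n)))" for n and f :: "nat \<Rightarrow> real"
  have "indep_vars (\<lambda>n. PiM (prime_block \<epsilon> (l n)) (\<lambda>_. borel)) (\<lambda>n \<omega>. restrict (\<lambda>k. truncated k \<omega>) (prime_block \<epsilon> (l n))) UNIV"
    by (rule indep_vars_restrict[where I=UNIV])
       (use indep_bounded_centered_truncated disj in \<open>auto simp: indep_bounded_centered_def\<close>)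
  then have "indep_vars (\<lambda>_. borel) (\<lambda>n \<omega>. F n (restrict (\<lambda>k. truncated k \<omega>) (prime_block \<epsilon> (l n)))) UNIV"
  proof (rule indep_vars_compose2)
    fix n
    show "F n \<in> borel_measurable (PiM (prime_block \<epsilon> (l n)) (\<lambda>_. borel))"
      unfolding F_def[abs_def] by (intro borel_measurable_sum borel_measurable_times measurable_component_singleton) auto
  qed
  moreover have "F n (restrict (\<lambda>k. truncated k \<omega>) (prime_block \<epsilon> (l n))) = block_sum \<epsilon> (l n) \<omega>" for n \<omega>
    unfolding F_def block_sum_def by (intro sum.cong) auto
  ultimately show ?thesis by simp
qed

text \<open>The level \<open>y\<close> is chosen so that \<open>y\<^sup>2 / (2 * W) = (1 - 4 * \<epsilon>) * ln (ln l)\<close>, where \<open>W\<close> is the variance of the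
  block. Since \<open>(1 - 4 * \<epsilon>) * (1 + 3 * \<epsilon>) \<le> 1 - \<epsilon>\<close>, the lower tail estimate bounds the probability of
  exceeding \<open>(1 - \<epsilon>) * y\<close> from below by a multiple of \<open>n powr (- (1 - \<epsilon>))\<close>, whose sum diverges.\<close>
lemma AE_block_sum_lower:
  assumes e: "0 < \<epsilon>" "\<epsilon> \<le> 1/8"
  defines "l \<equiv> (\<lambda>n::nat. (2 / \<epsilon>\<^sup>2) ^ n)"
  shows "AE \<omega> in M. \<exists>\<^sub>\<infinity>n. (1 - 5 * \<epsilon>) * \<sigma> * lil_scale (l n) \<le> block_sum \<epsilon> (l n) \<omega>"
proof -
  define \<theta> where "\<theta> = 2 / \<epsilon>\<^sup>2"
  have th: "1 < \<theta>" unfolding \<theta>_def by (rule block_ratio_gt_1[OF e])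
  have l_def': "l n = \<theta> ^ n" for n by (simp add: l_def \<theta>_def)
  have l_inf: "filterlim l at_top sequentially" unfolding l_def'[abs_def] by (rule filterlim_power_at_top[OF th])
  have l_step: "\<epsilon>\<^sup>2 * l (Suc n) = 2 * l n" for n using e by (simp add: l_def' \<theta>_def)
  have l_mono: "l m \<le> l n" if "m \<le> n" for m n unfolding l_def' using th that by (intro power_increasing) auto
  have disj: "disjoint_family (\<lambda>n. prime_block \<epsilon> (l n))"
  proof -
    have "prime_block \<epsilon> (l m) \<inter> prime_block \<epsilon> (l n) = {}" if mn: "m < n" for m n
    proof -
      have "2 * l m \<le> \<epsilon>\<^sup>2 * l n"
      proof -
        obtain n' where n: "n = Suc n'" using mn by (cases n) auto
        have "l m \<le> l n'" using mn n by (intro l_mono) simp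
        then show ?thesis unfolding n l_step by simp
      qed
      from prime_count_mono[OF this] show ?thesis by (auto simp: prime_block_def)
    qed
    then show ?thesis unfolding disjoint_family_on_def by (metis Int_commute linorder_neqE_nat)
  qed
  define W where "W n = block_variance \<epsilon> (l n)" for n
  define z where "z n = ln (ln (l n))" for n
  define y where "y n = sqrt (2 * W n * ((1 - 4 * \<epsilon>) * z n))" for n
  have s2: "0 < \<sigma>\<^sup>2" using sigma_pos by simp
  define q where "q = \<sigma>\<^sup>2 * (1 - 2 * \<epsilon>)"
  have q: "0 < q" using s2 e by (simp add: q_def)
  have ev: "\<forall>\<^sub>F n in sequentially. q * l n \<le> W n \<and> 0 < l n \<and> 0 < z n \<and> 1 < ln (l n)
      \<and> sqrt (2 * z n / (q * l n)) < \<epsilon>\<^sup>2 / 128 \<and> 16 * ln 2 \<le> 2 * ((1 - 4 * \<epsilon>) * z n) * \<epsilon>\<^sup>2"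
  proof -
    have "\<forall>\<^sub>F v in at_top. q * v \<le> block_variance \<epsilon> v"
      using block_variance_ge[OF e] by (simp add: q_def)
    moreover have "\<forall>\<^sub>F v::real in at_top. 0 < v" by (rule eventually_gt_at_top)
    moreover have "filterlim (\<lambda>v::real. ln (ln v)) at_top at_top" by real_asymp
    then have "\<forall>\<^sub>F v::real in at_top. max 0 (8 * ln 2 / ((1 - 4 * \<epsilon>) * \<epsilon>\<^sup>2)) < ln (ln v)"
      using filterlim_at_top_dense by metis
    moreover have "\<forall>\<^sub>F v::real in at_top. 1 < ln v" by real_asymp
    moreover have "((\<lambda>v. sqrt (2 * ln (ln v) / (q * v))) \<longlongrightarrow> 0) at_top" using q by real_asymp
    then have "\<forall>\<^sub>F v in at_top. sqrt (2 * ln (ln v) / (q * v)) < \<epsilon>\<^sup>2 / 128"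
      by (rule order_tendstoD) (use e in simp)
    ultimately have "\<forall>\<^sub>F v in at_top. q * v \<le> block_variance \<epsilon> v \<and> 0 < v \<and> 0 < ln (ln v) \<and> 1 < ln v
       \<and> sqrt (2 * ln (ln v) / (q * v)) < \<epsilon>\<^sup>2 / 128 \<and> 16 * ln 2 \<le> 2 * ((1 - 4 * \<epsilon>) * ln (ln v)) * \<epsilon>\<^sup>2"
    proof eventually_elim
      case (elim v)
      have "0 < (1 - 4 * \<epsilon>) * \<epsilon>\<^sup>2" using e by (intro mult_pos_pos) auto
      moreover have "8 * ln 2 / ((1 - 4 * \<epsilon>) * \<epsilon>\<^sup>2) < ln (ln v)" using elim(3) by simp
      ultimately have "8 * ln 2 < ln (ln v) * ((1 - 4 * \<epsilon>) * \<epsilon>\<^sup>2)" by (simp only: pos_divide_less_eq)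
      then have "16 * ln 2 \<le> 2 * ((1 - 4 * \<epsilon>) * ln (ln v)) * \<epsilon>\<^sup>2" by (simp add: mult_ac)
      then show ?case using elim by simp
    qed
    from filterlim_iff[THEN iffD1, OF l_inf, rule_format, OF this] show ?thesis by (simp add: W_def z_def)
  qed
  have prob_lower: "ln \<theta> powr (- (1 - \<epsilon>)) * real n powr (- (1 - \<epsilon>)) \<le> 2 * prob {\<omega> \<in> space M. (1 - \<epsilon>) * y n \<le> block_sum \<epsilon> (l n) \<omega>}"
    if n: "q * l n \<le> W n" "0 < l n" "0 < z n" "1 < ln (l n)" "sqrt (2 * z n / (q * l n)) < \<epsilon>\<^sup>2 / 128"
      "16 * ln 2 \<le> 2 * ((1 - 4 * \<epsilon>) * z n) * \<epsilon>\<^sup>2" for n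
  proof -
    have W0: "0 < W n" using n(1,2) q by (meson less_le_trans mult_pos_pos)
    have a: "0 < (1 - 4 * \<epsilon>) * z n" using e n(3) by simp
    have y0: "0 < y n" unfolding y_def using W0 a by simp
    have y2: "(y n)\<^sup>2 = 2 * W n * ((1 - 4 * \<epsilon>) * z n)" unfolding y_def using W0 a by simp
    have "y n / W n = sqrt ((y n)\<^sup>2 / (W n)\<^sup>2)" using y0 W0 by (simp add: real_sqrt_divide)
    also have "(y n)\<^sup>2 / (W n)\<^sup>2 = 2 * ((1 - 4 * \<epsilon>) * z n) / W n"
      unfolding y2 using W0 by (simp add: power2_eq_square)
    also have "sqrt (2 * ((1 - 4 * \<epsilon>) * z n) / W n) \<le> sqrt (2 * z n / (q * l n))"
    proof (rule real_sqrt_le_mono, rule frac_le)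
      have "(1 - 4 * \<epsilon>) * z n \<le> 1 * z n" using n(3) e by (intro mult_right_mono) auto
      then show "2 * ((1 - 4 * \<epsilon>) * z n) \<le> 2 * z n" by simp
    qed (use n q in auto)
    finally have small: "y n / W n * 2 \<le> \<epsilon>\<^sup>2 / 64" using n(5) by simp
    have yW: "(y n)\<^sup>2 / W n = 2 * ((1 - 4 * \<epsilon>) * z n)" unfolding y2 using W0 by simp
    have "exp (- ((y n)\<^sup>2 / (2 * W n)) * (1 + 3 * \<epsilon>)) \<le> 2 * prob {\<omega> \<in> space M. (1 - \<epsilon>) * y n \<le> block_sum \<epsilon> (l n) \<omega>}"
      unfolding block_sum_def
    proof (rule sum_lower_tail[OF block_indep_bounded_centered _ _ W0 y0 _ _ small])
      show "finite (prime_block \<epsilon> (l n))" by (simp add: prime_block_def)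
      show "W n = (\<Sum>i\<in>prime_block \<epsilon> (l n). expectation (\<lambda>x. (truncated i x * real (nth_prime i) powr - exp (- l n))\<^sup>2))"
        by (simp add: W_def block_variance_def)
      show "16 * ln 2 \<le> (y n)\<^sup>2 / W n * \<epsilon>\<^sup>2" unfolding yW by (rule n(6))
    qed (use e in auto)
    moreover have "(y n)\<^sup>2 / (2 * W n) = (1 - 4 * \<epsilon>) * z n" using yW by simp
    moreover have "(1 - 4 * \<epsilon>) * z n * (1 + 3 * \<epsilon>) \<le> (1 - \<epsilon>) * z n"
    proof -
      have "(1 - 4 * \<epsilon>) * (1 + 3 * \<epsilon>) = 1 - \<epsilon> - 12 * (\<epsilon> * \<epsilon>)" by (simp add: algebra_simps)
      then have "(1 - 4 * \<epsilon>) * (1 + 3 * \<epsilon>) \<le> 1 - \<epsilon>" by simp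
      from mult_right_mono[OF this, of "z n"] n(3) show ?thesis by (simp add: mult_ac)
    qed
    ultimately have "exp (- ((1 - \<epsilon>) * z n)) \<le> 2 * prob {\<omega> \<in> space M. (1 - \<epsilon>) * y n \<le> block_sum \<epsilon> (l n) \<omega>}"
      by (smt (verit) exp_le_cancel_iff mult_minus_left)
    also have "exp (- ((1 - \<epsilon>) * z n)) = ln (l n) powr (- (1 - \<epsilon>))"
      using n(4) by (simp add: powr_def z_def algebra_simps)
    also have "ln (l n) = ln \<theta> * real n" unfolding l_def' using th by (simp add: ln_realpow)
    also have "(ln \<theta> * real n) powr (- (1 - \<epsilon>)) = ln \<theta> powr (- (1 - \<epsilon>)) * real n powr (- (1 - \<epsilon>))"
      using th by (simp only: powr_mult)
    finally show ?thesis .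
  qed
  have "\<not> summable (\<lambda>n. prob {\<omega> \<in> space M. (1 - \<epsilon>) * y n \<le> block_sum \<epsilon> (l n) \<omega>})"
  proof
    assume "summable (\<lambda>n. prob {\<omega> \<in> space M. (1 - \<epsilon>) * y n \<le> block_sum \<epsilon> (l n) \<omega>})"
    then have "summable (\<lambda>n. 2 * prob {\<omega> \<in> space M. (1 - \<epsilon>) * y n \<le> block_sum \<epsilon> (l n) \<omega>})"
      by (rule summable_mult)
    then have "summable (\<lambda>n. ln \<theta> powr (- (1 - \<epsilon>)) * real n powr (- (1 - \<epsilon>)))"
    proof (rule summable_comparison_test_ev[rotated])
      show "\<forall>\<^sub>F n in sequentially. norm (ln \<theta> powr (- (1 - \<epsilon>)) * real n powr (- (1 - \<epsilon>)))
         \<le> 2 * prob {\<omega> \<in> space M. (1 - \<epsilon>) * y n \<le> block_sum \<epsilon> (l n) \<omega>}"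
        using ev
      proof eventually_elim
        case (elim n)
        have "ln \<theta> powr (- (1 - \<epsilon>)) * real n powr (- (1 - \<epsilon>)) \<le> 2 * prob {\<omega> \<in> space M. (1 - \<epsilon>) * y n \<le> block_sum \<epsilon> (l n) \<omega>}"
          using elim by (intro prob_lower) blast+
        then show ?case by simp
      qed
    qed
    then have "summable (\<lambda>n. real n powr (- (1 - \<epsilon>)))"
      using th by (subst (asm) summable_cmult_iff) auto
    then show False using e by (simp add: summable_real_powr_iff)
  qed
  from borel_cantelli_indep_vars[OF indep_block_sums[OF disj] this]
  show ?thesis
  proof eventually_elim
    case (elim \<omega>)
    have "\<forall>\<^sub>\<infinity>n. (1 - 5 * \<epsilon>) * \<sigma> * lil_scale (l n) \<le> (1 - \<epsilon>) * y n"
      unfolding cofinite_eq_sequentially using ev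
    proof eventually_elim
      case (elim n)
      have r: "0 \<le> 2 * l n * z n" using elim by simp
      have "(1 - 4 * \<epsilon>)\<^sup>2 * \<sigma>\<^sup>2 * (2 * l n * z n) \<le> (1 - 2 * \<epsilon>) * (1 - 4 * \<epsilon>) * \<sigma>\<^sup>2 * (2 * l n * z n)"
        using e r by (intro mult_right_mono) (auto simp: power2_eq_square)
      also have "\<dots> = 2 * (q * l n) * ((1 - 4 * \<epsilon>) * z n)" by (simp add: q_def mult_ac)
      also have "\<dots> \<le> 2 * W n * ((1 - 4 * \<epsilon>) * z n)"
        using elim e by (intro mult_right_mono mult_left_mono) auto
      finally have "sqrt ((1 - 4 * \<epsilon>)\<^sup>2 * \<sigma>\<^sup>2 * (2 * l n * z n)) \<le> y n"
        unfolding y_def by (rule real_sqrt_le_mono)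
      then have b: "(1 - 4 * \<epsilon>) * \<sigma> * lil_scale (l n) \<le> y n"
        using e sigma_pos by (simp add: real_sqrt_mult lil_scale_def z_def)
      have "0 \<le> lil_scale (l n)" using r by (simp add: lil_scale_def z_def)
      then have sl: "0 \<le> \<sigma> * lil_scale (l n)" using sigma_pos by simp
      have "(1 - 5 * \<epsilon>) * (\<sigma> * lil_scale (l n)) \<le> ((1 - \<epsilon>) * (1 - 4 * \<epsilon>)) * (\<sigma> * lil_scale (l n))"
        using sl by (intro mult_right_mono) (auto simp: algebra_simps)
      also have "\<dots> = (1 - \<epsilon>) * ((1 - 4 * \<epsilon>) * \<sigma> * lil_scale (l n))" by (simp add: mult_ac)
      also have "\<dots> \<le> (1 - \<epsilon>) * y n" using b e by (intro mult_left_mono) auto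
      finally show ?case by (simp add: mult_ac)
    qed
    with elim have "\<exists>\<^sub>\<infinity>n. (1 - \<epsilon>) * y n \<le> block_sum \<epsilon> (l n) \<omega> \<and> (1 - 5 * \<epsilon>) * \<sigma> * lil_scale (l n) \<le> (1 - \<epsilon>) * y n"
      by (rule INFM_conjI)
    then show ?case by (rule INFM_mono) auto
  qed
qed

end

context iid_sequence
begin

lemma iid_sequence_uminus: "iid_sequence M (\<lambda>k \<omega>. - \<xi> k \<omega>) (distr D borel uminus) \<sigma>"
proof
  show "indep_vars (\<lambda>_. borel) (\<lambda>k \<omega>. - \<xi> k \<omega>) UNIV"
    by (rule indep_vars_compose2[OF indep]) simp
  show "distr M borel (\<lambda>\<omega>. - \<xi> k \<omega>) = distr D borel uminus" for k
  proof -
    have u: "(uminus :: real \<Rightarrow> real) \<in> measurable borel borel" by measurable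
    have "distr (distr M borel (\<xi> k)) borel uminus = distr M borel (uminus \<circ> \<xi> k)"
      by (rule distr_distr[OF u rv])
    then show ?thesis by (simp only: distr comp_def)
  qed
  have m: "uminus \<in> measurable D borel" "(\<lambda>x. x) \<in> borel_measurable borel"
    "(\<lambda>x. x\<^sup>2) \<in> borel_measurable (borel :: real measure)" by measurable
  show "integrable (distr D borel uminus) (\<lambda>x. x)" "integrable (distr D borel uminus) (\<lambda>x. x\<^sup>2)"
    unfolding integrable_distr_eq[OF m(1,2)] integrable_distr_eq[OF m(1,3)] power2_minus
    by (intro integrable_minus int1 int2)+
  show "integral\<^sup>L (distr D borel uminus) (\<lambda>x. x) = 0" "integral\<^sup>L (distr D borel uminus) (\<lambda>x. x\<^sup>2) = \<sigma>\<^sup>2"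
    unfolding integral_distr[OF m(1,2)] integral_distr[OF m(1,3)] power2_minus
    by (simp_all only: integral_minus mean var minus_zero)
qed (rule sigma_pos)

text \<open>Undoing the truncation changes a block sum by at most a random constant, which costs another \<open>\<epsilon>\<close>.\<close>
lemma AE_weighted_block_lower:
  assumes e: "0 < \<epsilon>" "\<epsilon> \<le> 1/8"
  defines "l \<equiv> (\<lambda>n::nat. (2 / \<epsilon>\<^sup>2) ^ n)"
  shows "AE \<omega> in M. \<exists>\<^sub>\<infinity>n. (1 - 6 * \<epsilon>) * \<sigma> * lil_scale (l n) \<le>
     (\<Sum>k\<in>prime_block \<epsilon> (l n). weighted \<omega> k * real (nth_prime k) powr (-exp (-l n)))"
  using AE_block_sum_lower[OF e] AE_summable_truncation_error
proof eventually_elim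
  case (elim \<omega>)
  define E where "E = (\<Sum>k. \<bar>weighted \<omega> k - truncated k \<omega>\<bar>)"
  have sumE: "summable (\<lambda>k. \<bar>weighted \<omega> k - truncated k \<omega>\<bar>)" using elim(2) by (simp add: weighted_def)
  have es: "0 < \<epsilon> * \<sigma>" using e sigma_pos by simp
  have l_inf: "filterlim l at_top sequentially"
    unfolding l_def by (rule filterlim_power_at_top[OF block_ratio_gt_1[OF e]])
  have "\<forall>\<^sub>F n in sequentially. E / (\<epsilon> * \<sigma>) < lil_scale (l n)"
    using filterlim_compose[OF lil_scale_at_top l_inf] unfolding filterlim_at_top_dense by auto
  then have "\<forall>\<^sub>\<infinity>n. E / (\<epsilon> * \<sigma>) < lil_scale (l n)" by (simp add: cofinite_eq_sequentially)
  with elim(1) have "\<exists>\<^sub>\<infinity>n. (1 - 5 * \<epsilon>) * \<sigma> * lil_scale (l n) \<le> block_sum \<epsilon> (l n) \<omega> \<and> E / (\<epsilon> * \<sigma>) < lil_scale (l n)"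
    unfolding l_def by (rule INFM_conjI)
  then show ?case
  proof (rule INFM_mono)
    fix n assume n: "(1 - 5 * \<epsilon>) * \<sigma> * lil_scale (l n) \<le> block_sum \<epsilon> (l n) \<omega> \<and> E / (\<epsilon> * \<sigma>) < lil_scale (l n)"
    define w where "w k = real (nth_prime k) powr (-exp (-l n))" for k
    have w: "0 \<le> w k" "w k \<le> 1" for k by (simp_all add: w_def nth_prime_powr_le_1)
    have "block_sum \<epsilon> (l n) \<omega> - (\<Sum>k\<in>prime_block \<epsilon> (l n). weighted \<omega> k * w k)
      = (\<Sum>k\<in>prime_block \<epsilon> (l n). (truncated k \<omega> - weighted \<omega> k) * w k)"
      by (simp add: block_sum_def w_def left_diff_distrib sum_subtractf)
    also have "\<dots> \<le> (\<Sum>k\<in>prime_block \<epsilon> (l n). \<bar>weighted \<omega> k - truncated k \<omega>\<bar>)"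
    proof (rule sum_mono)
      fix k
      have "(truncated k \<omega> - weighted \<omega> k) * w k \<le> \<bar>weighted \<omega> k - truncated k \<omega>\<bar> * w k"
        using w by (intro mult_right_mono) auto
      also have "\<dots> \<le> \<bar>weighted \<omega> k - truncated k \<omega>\<bar> * 1" using w by (intro mult_left_mono) auto
      finally show "(truncated k \<omega> - weighted \<omega> k) * w k \<le> \<bar>weighted \<omega> k - truncated k \<omega>\<bar>" by simp
    qed
    also have "\<dots> \<le> E" unfolding E_def using sumE by (intro sum_le_suminf) (auto simp: prime_block_def)
    also have "E \<le> \<epsilon> * \<sigma> * lil_scale (l n)" using n es by (simp add: pos_divide_less_eq mult.commute)
    finally show "(1 - 6 * \<epsilon>) * \<sigma> * lil_scale (l n) \<le>
       (\<Sum>k\<in>prime_block \<epsilon> (l n). weighted \<omega> k * real (nth_prime k) powr (-exp (-l n)))"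
      using conjunct1[OF n] by (simp add: w_def left_diff_distrib)
  qed
qed

text \<open>The growth of the partial sums is needed in absolute value, so the upper half is used for \<open>\<xi>\<close> and for
  \<open>- \<xi>\<close>.\<close>
lemma AE_prime_series_one_sided:
  "AE \<omega> in M. (\<forall>s>0. summable (\<lambda>k. weighted \<omega> k * real (nth_prime k) powr (-s)))
     \<and> continuous_on {0<..} (prime_series (weighted \<omega>))
     \<and> (\<forall>\<epsilon>>0. \<forall>\<^sub>F l in at_top. prime_series (weighted \<omega>) (exp (-l)) \<le> (1 + \<epsilon>) * \<sigma> * lil_scale l)
     \<and> (\<forall>\<epsilon>>0. \<exists>\<^sub>F l in at_top. (1 - \<epsilon>) * \<sigma> * lil_scale l \<le> prime_series (weighted \<omega>) (exp (-l)))"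
proof -
  interpret neg: iid_sequence M "\<lambda>k \<omega>. - \<xi> k \<omega>" "distr D borel uminus" \<sigma>
    by (rule iid_sequence_uminus)
  \<comment> \<open>Countably many \<open>\<epsilon>\<close> suffice. The total loss will be \<open>11 * \<epsilon>\<close>, whence the factor 1/16.\<close>
  define eps where "eps m = inverse (real (Suc m)) / 16" for m
  have eps: "0 < eps m" "eps m \<le> 1/8" for m by (auto simp: eps_def field_simps)
  have "AE \<omega> in M. \<forall>m. \<exists>\<^sub>\<infinity>n. (1 - 6 * eps m) * \<sigma> * lil_scale ((2 / (eps m)\<^sup>2) ^ n) \<le>
     (\<Sum>k\<in>prime_block (eps m) ((2 / (eps m)\<^sup>2) ^ n). weighted \<omega> k * real (nth_prime k) powr (-exp (-((2 / (eps m)\<^sup>2) ^ n))))"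
    unfolding AE_all_countable by (intro allI AE_weighted_block_lower eps)
  with AE_partial_sums_upper neg.AE_partial_sums_upper
  show ?thesis
  proof eventually_elim
    case (elim \<omega>)
    have neg: "neg.weighted \<omega> k = - weighted \<omega> k" for k
      unfolding neg.weighted_def weighted_def by simp
    have T: "\<forall>\<^sub>F v in at_top. \<forall>k\<le>prime_count_loglog v. \<bar>\<Sum>j<k. weighted \<omega> j\<bar> \<le> 2 * \<sigma> * lil_scale v"
      using elim(1)[rule_format, of 1] elim(2)[rule_format, of 1] unfolding neg
      by (intro partial_sums_abs_bound) auto
    obtain C where "prime_partial_sums (weighted \<omega>) C"
      by (rule growth_constant[OF T]) (use sigma_pos in simp)
    then interpret prime_partial_sums "weighted \<omega>" C .
    show ?case
    proof (intro conjI allI impI)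
      show "summable (\<lambda>k. weighted \<omega> k * real (nth_prime k) powr (-s))" if "0 < s" for s
        using that by (rule summable_prime_series)
      show "continuous_on {0<..} (prime_series (weighted \<omega>))" by (rule continuous_on_prime_series)
      fix \<epsilon> :: real assume e: "0 < \<epsilon>"
      show "\<forall>\<^sub>F l in at_top. prime_series (weighted \<omega>) (exp (-l)) \<le> (1 + \<epsilon>) * \<sigma> * lil_scale l"
        using elim(1) sigma_pos e by (intro prime_series_upper) auto
      obtain m where m: "inverse (real (Suc m)) < \<epsilon>" using reals_Archimedean[OF e] by blast
      define l where "l n = (2 / (eps m)\<^sup>2) ^ n" for n :: nat
      have l_inf: "filterlim l at_top sequentially"
        unfolding l_def[abs_def] by (rule filterlim_power_at_top[OF block_ratio_gt_1[OF eps]])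
      have "\<exists>\<^sub>\<infinity>n. (1 - 6 * eps m - 5 * eps m) * \<sigma> * lil_scale (l n) \<le> prime_series (weighted \<omega>) (exp (- l n))"
        by (rule prime_series_lower[OF T sigma_pos eps l_inf])
           (use elim(3)[rule_format, of m] in \<open>simp add: l_def prime_block_def\<close>)
      then have fr: "\<exists>\<^sub>F n in sequentially. (1 - 11 * eps m) * \<sigma> * lil_scale (l n) \<le> prime_series (weighted \<omega>) (exp (- l n))"
        by (simp add: cofinite_eq_sequentially)
      show "\<exists>\<^sub>F l in at_top. (1 - \<epsilon>) * \<sigma> * lil_scale l \<le> prime_series (weighted \<omega>) (exp (-l))"
        unfolding frequently_def
      proof
        assume "\<forall>\<^sub>F l in at_top. \<not> (1 - \<epsilon>) * \<sigma> * lil_scale l \<le> prime_series (weighted \<omega>) (exp (-l))"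
        moreover note eventually_lil_scale_pos
        ultimately have "\<forall>\<^sub>F l in at_top. \<not> (1 - 11 * eps m) * \<sigma> * lil_scale l \<le> prime_series (weighted \<omega>) (exp (-l))"
        proof eventually_elim
          case (elim l)
          have "11 * eps m \<le> \<epsilon>" using m eps(1)[of m] unfolding eps_def by linarith
          then have "(1 - \<epsilon>) * (\<sigma> * lil_scale l) \<le> (1 - 11 * eps m) * (\<sigma> * lil_scale l)"
            using elim(2) sigma_pos by (intro mult_right_mono) auto
          then show ?case using elim(1) by (simp add: mult.assoc)
        qed
        from filterlim_iff[THEN iffD1, OF l_inf, rule_format, OF this] fr
        show False by (simp add: frequently_def)
      qed
    qed
  qed
qed

end

lemma (in iid_sequence) AE_prime_series_lil:
  "AE \<omega> in M. continuous_on {0<..} (prime_series (weighted \<omega>))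
     \<and> (\<forall>\<epsilon>>0. \<forall>\<^sub>F l in at_top. prime_series (weighted \<omega>) (exp (-l)) \<le> (1 + \<epsilon>) * \<sigma> * lil_scale l)
     \<and> (\<forall>\<epsilon>>0. \<forall>\<^sub>F l in at_top. - prime_series (weighted \<omega>) (exp (-l)) \<le> (1 + \<epsilon>) * \<sigma> * lil_scale l)
     \<and> (\<forall>\<epsilon>>0. \<exists>\<^sub>F l in at_top. (1 - \<epsilon>) * \<sigma> * lil_scale l \<le> prime_series (weighted \<omega>) (exp (-l)))
     \<and> (\<forall>\<epsilon>>0. \<exists>\<^sub>F l in at_top. (1 - \<epsilon>) * \<sigma> * lil_scale l \<le> - prime_series (weighted \<omega>) (exp (-l)))"
proof -
  interpret neg: iid_sequence M "\<lambda>k \<omega>. - \<xi> k \<omega>" "distr D borel uminus" \<sigma>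
    by (rule iid_sequence_uminus)
  show ?thesis
    using AE_prime_series_one_sided neg.AE_prime_series_one_sided
  proof eventually_elim
    case (elim \<omega>)
    \<comment> \<open>Convergence is essential here: \<open>suminf\<close> of a divergent series need not respect the sign.\<close>
    have "prime_series (neg.weighted \<omega>) s = - prime_series (weighted \<omega>) s" if "0 < s" for s
      unfolding prime_series_def neg.weighted_def using suminf_minus[OF elim(1)[THEN conjunct1, rule_format, OF that]]
      by (simp add: weighted_def)
    then show ?case using elim(1,2) by simp
  qed
qed

theorem theorem2:
  fixes M :: "'a measure" and N :: "'b measure"
    and \<eta> :: "'b \<Rightarrow> real" and \<eta>s :: "nat \<Rightarrow> 'a \<Rightarrow> real" and \<sigma> :: real
  assumes "prob_space M" and "prob_space N"
    and "\<eta> \<in> borel_measurable N"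
    and "integrable N \<eta>" and "integral\<^sup>L N \<eta> = 0"
    and "integrable N (\<lambda>x. (\<eta> x)\<^sup>2)" and "\<sigma>\<^sup>2 = integral\<^sup>L N (\<lambda>x. (\<eta> x)\<^sup>2)"
    and "\<sigma> > 0"
    and "prob_space.indep_vars M (\<lambda>_. borel) \<eta>s {1..}"
    and "\<And>n. n \<ge> 1 \<Longrightarrow> distr M borel (\<eta>s n) = distr N borel \<eta>"
  shows "(AE \<omega> in M.
            limit_points_0 {0<..<exp (- exp 1)}
              (\<lambda>s. sqrt (1 / (2 * \<sigma>\<^sup>2 * ln (1 / s) * ln (ln (ln (1 / s)))))
                     * sum_primes (\<lambda>p. \<eta>s p \<omega> / real p powr (1 / 2 + s)))
            = {-1..1})
       \<and> (AE \<omega> in M.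
            Limsup (at_right 0)
              (\<lambda>s. ereal (sqrt (1 / (ln (1 / s) * ln (ln (ln (1 / s)))))
                     * sum_primes (\<lambda>p. \<eta>s p \<omega> / real p powr (1 / 2 + s))))
            = ereal (sqrt 2 * \<sigma>))
       \<and> (AE \<omega> in M.
            Liminf (at_right 0)
              (\<lambda>s. ereal (sqrt (1 / (ln (1 / s) * ln (ln (ln (1 / s)))))
                     * sum_primes (\<lambda>p. \<eta>s p \<omega> / real p powr (1 / 2 + s))))
            = ereal (- (sqrt 2 * \<sigma>)))"
proof -
  interpret M: prob_space M by fact
  have inj: "inj nth_prime" by (rule strict_mono_imp_inj_on[OF strict_mono_nth_prime])
  have ge1: "1 \<le> nth_prime k" for k using prime_ge_1_nat[OF prime_nth_prime] .
  interpret iid_sequence M "\<lambda>k. \<eta>s (nth_prime k)" "distr N borel \<eta>" \<sigma>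
  proof
    show "M.indep_vars (\<lambda>_. borel) (\<lambda>k. \<eta>s (nth_prime k)) UNIV"
      by (rule M.indep_vars_reindex_inj[OF assms(9) inj]) (use ge1 in auto)
    show "distr M borel (\<eta>s (nth_prime k)) = distr N borel \<eta>" for k by (rule assms(10)[OF ge1])
    have m: "(\<lambda>x. x) \<in> borel_measurable borel" "(\<lambda>x. x\<^sup>2) \<in> borel_measurable (borel :: real measure)" by measurable
    show "integrable (distr N borel \<eta>) (\<lambda>x. x)" "integrable (distr N borel \<eta>) (\<lambda>x. x\<^sup>2)"
      unfolding integrable_distr_eq[OF assms(3) m(1)] integrable_distr_eq[OF assms(3) m(2)] by (rule assms)+
    show "integral\<^sup>L (distr N borel \<eta>) (\<lambda>x. x) = 0" "integral\<^sup>L (distr N borel \<eta>) (\<lambda>x. x\<^sup>2) = \<sigma>\<^sup>2"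
      unfolding integral_distr[OF assms(3) m(1)] integral_distr[OF assms(3) m(2)] by (simp_all only: assms)
    show "0 < \<sigma>" by (rule assms(8))
  qed
  have X: "sum_primes (\<lambda>p. \<eta>s p \<omega> / real p powr (1 / 2 + s)) = prime_series (weighted \<omega>) s" for \<omega> s
    using sum_primes_eq_prime_series[of "\<lambda>p. \<eta>s p \<omega>" s] by (simp only: weighted_def[abs_def])
  show ?thesis unfolding X
    by (intro conjI; rule AE_mp[OF AE_prime_series_lil], intro AE_I2 impI lil_limits[OF sigma_pos]; blast)
qed

end
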